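(* Let $(X_t)_{t\ge0}$ be a rich Lévy-type process on $\mathbb{R}^d$ with bounded coefficients, symbol $q$ and characteristics $(b,0,\nu)$. Let $\varepsilon>0$ be a constant and $\alpha:\mathbb{R}^d\to(\varepsilon,2]$ a uniformly continuous mapping. Suppose that either the sector condition is satisfied, i.e. there is a constant $C>0$ with $|\operatorname{Im}q(x,\xi)|\le C\operatorname{Re}q(x,\xi)$ for all $x,\xi\in\mathbb{R}^d$, or $\alpha(x)-\varepsilon\ge\beta_\infty^x$ for all $x\in\mathbb{R}^d$. If $$\sup_{x\in\mathbb{R}^d}\int_{0<|y|\le1}|y|^{\alpha(x)-\varepsilon}\,\nu(x,dy)<\infty,$$ then the space $$\mathcal{C}_0^{1,(\alpha(\cdot)-1)^+}:=\left\{f\in C_0^1(\mathbb{R}^d):\ \forall j=1,\dots,d:\ \partial_jf\in\mathcal{C}_0^{\max\{\alpha(\cdot)-1,0\}}\right\}$$ is contained in the domain of the generator $A$ of $(X_t)_{t\ge0}$, and for all $x\in\mathbb{R}^d$ and $f\in\mathcal{C}_0^{1,(\alpha(\cdot)-1)^+}$ $$Af(x)=b(x)\cdot\nabla f(x)+\int_{\mathbb{R}^d\setminus\{0\}}\left(f(x+y)-f(x)-\nabla f(x)\cdot y\,\mathbf{1}_{(0,1)}(|y|)\right)\nu(x,dy).$$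
   Context: $C_0(\mathbb{R}^d)$ is the space of continuous functions $\mathbb{R}^d\to\mathbb{R}$ vanishing at infinity; $C_0^1(\mathbb{R}^d)$ is the set of functions which together with their first-order partial derivatives are in $C_0(\mathbb{R}^d)$. For a function $\kappa:\mathbb{R}^d\to[0,\infty)$, $$\mathcal{C}_0^{\kappa(\cdot)}:=\left\{f\in C_0(\mathbb{R}^d):\ \sup_{x\in\mathbb{R}^d}\sup_{0<|y|\le1}\frac{|f(x+y)-f(x)|}{|y|^{\kappa(x)}}<\infty\right\}.$$ A Lévy-type process (= Feller process) $(X_t)_{t\ge0}$ on $\mathbb{R}^d$ is a Markov process with càdlàg sample paths whose transition semigroup $f\mapsto \mathbb{E}^{\bullet}f(X_t)$ is a Feller semigroup on $C_0(\mathbb{R}^d)$. Its generator $(A,\mathcal{D}(A))$ has as domain the set of $f\in C_0(\mathbb{R}^d)$ for which $\frac1t(\mathbb{E}^xf(X_t)-f(x))$ converges as $t\to0$, uniformly in $x\in\mathbb{R}^d$, to a function in $C_0(\mathbb{R}^d)$, and $Af$ is this limit. The process is called rich if $C_c^\infty(\mathbb{R}^d)\subseteq\mathcal{D}(A)$. For a rich process, $Af(x)=-\int_{\mathbb{R}^d}e^{ix\cdot\xi}q(x,\xi)\widehat f(\xi)\,d\xi$ for $f\in C_c^\infty(\mathbb{R}^d)$, where $\widehat f(\xi)=(2\pi)^{-d}\int_{\mathbb{R}^d} e^{-ix\cdot\xi}f(x)\,dx$ and $q$ is the symbol $$q(x,\xi)=q(x,0)-ib(x)\cdot\xi+\tfrac12\xi\cdot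 Q(x)\xi+\int_{\mathbb{R}^d\setminus\{0\}}\left(1-e^{iy\cdot\xi}+iy\cdot\xi\,\mathbf{1}_{(0,1)}(|y|)\right)\nu(x,dy).$$ For each $x$, $(b(x),Q(x),\nu(x,dy))$ is a Lévy triplet: $b(x)\in\mathbb{R}^d$, $Q(x)\in\mathbb{R}^{d\times d}$ symmetric positive semidefinite, $\nu(x,\cdot)$ a measure on $\mathbb{R}^d\setminus\{0\}$ with $\int\min\{|y|^2,1\}\,\nu(x,dy)<\infty$. The family $(b,Q,\nu)$ is called the characteristics; characteristics $(b,0,\nu)$ means $Q\equiv0$. Standing assumption: $q(x,0)=0$ for all $x$. Bounded coefficients means that there is $c>0$ with $|q(x,\xi)|\le c(1+|\xi|^2)$ for all $x,\xi\in\mathbb{R}^d$. The generalized Blumenthal–Getoor index at infinity at $x$ is $\beta_\infty^{x}:=\inf\{\gamma>0:\ \lim_{r\to\infty}r^{-\gamma}\sup_{|\xi|\le r}|q(x,\xi)|<\infty\}\in[0,2]$. *)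

theory Defs
  imports "HOL-Probability.Probability"
begin

section \<open>Function spaces\<close>

definition partial_differentiable :: "'n::finite \<Rightarrow> (real^'n \<Rightarrow> real) \<Rightarrow> bool" where
  "partial_differentiable j f \<longleftrightarrow>
     (\<forall>x. (\<lambda>s. f (x + s *\<^sub>R axis j 1)) field_differentiable (at 0))"

definition partial_deriv :: "'n::finite \<Rightarrow> (real^'n \<Rightarrow> real) \<Rightarrow> real^'n \<Rightarrow> real" where
  "partial_deriv j f x = deriv (\<lambda>s. f (x + s *\<^sub>R axis j 1)) 0"

definition grad :: "(real^'n \<Rightarrow> real) \<Rightarrow> real^'n \<Rightarrow> real^'n::finite" where
  "grad f x = (\<chi> j. partial_deriv j f x)"

definition C_zero :: "(real^'n::finite \<Rightarrow> real) set" where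
  "C_zero = {f. continuous_on UNIV f \<and> (f \<longlongrightarrow> 0) at_infinity}"

definition C_zero_1 :: "(real^'n::finite \<Rightarrow> real) set" where
  "C_zero_1 =
     {f \<in> C_zero. \<forall>j. partial_differentiable j f \<and> partial_deriv j f \<in> C_zero}"

definition C_zero_Holder :: "(real^'n::finite \<Rightarrow> real) \<Rightarrow> (real^'n \<Rightarrow> real) set" where
  "C_zero_Holder \<kappa> =
     {f \<in> C_zero. (SUP x. SUP y\<in>{y. 0 < norm y \<and> norm y \<le> 1}.
                      ereal (\<bar>f (x + y) - f x\<bar> / norm y powr \<kappa> x)) < \<infinity>}"

definition C_zero_1_Holder :: "(real^'n::finite \<Rightarrow> real) \<Rightarrow> (real^'n \<Rightarrow> real) set" where
  "C_zero_1_Holder \<kappa> = {f \<in> C_zero_1. \<forall>j. partial_deriv j f \<in> C_zero_Holder \<kappa>}"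

primrec C_k :: "nat \<Rightarrow> (real^'n::finite \<Rightarrow> real) \<Rightarrow> bool" where
  "C_k 0 f \<longleftrightarrow> continuous_on UNIV f"
| "C_k (Suc k) f \<longleftrightarrow> continuous_on UNIV f \<and>
     (\<forall>j. partial_differentiable j f \<and> C_k k (partial_deriv j f))"

definition C_c_infinity :: "(real^'n::finite \<Rightarrow> real) set" where
  "C_c_infinity = {f. (\<forall>k. C_k k f) \<and> compact (closure {x. f x \<noteq> 0})}"

section \<open>Feller semigroups and their generators\<close>

definition feller_semigroup ::
  "(real \<Rightarrow> (real^'n::finite \<Rightarrow> real) \<Rightarrow> real^'n \<Rightarrow> real) \<Rightarrow> bool" where
  "feller_semigroup T \<longleftrightarrow>
     (\<forall>t\<ge>0. \<forall>f\<in>C_zero. T t f \<in> C_zero) \<and>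
     (\<forall>t\<ge>0. \<forall>f\<in>C_zero. \<forall>g\<in>C_zero. \<forall>a b.
        T t (\<lambda>x. a * f x + b * g x) = (\<lambda>x. a * T t f x + b * T t g x)) \<and>
     (\<forall>f\<in>C_zero. T 0 f = f) \<and>
     (\<forall>s\<ge>0. \<forall>t\<ge>0. \<forall>f\<in>C_zero. T (s + t) f = T s (T t f)) \<and>
     (\<forall>t\<ge>0. \<forall>f\<in>C_zero. (\<forall>x. 0 \<le> f x \<and> f x \<le> 1) \<longrightarrow> (\<forall>x. 0 \<le> T t f x \<and> T t f x \<le> 1)) \<and>
     (\<forall>f\<in>C_zero. uniform_limit UNIV (\<lambda>t. T t f) f (at_right 0))"

definition generator_graph ::
  "(real \<Rightarrow> (real^'n::finite \<Rightarrow> real) \<Rightarrow> real^'n \<Rightarrow> real) \<Rightarrow>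
     (real^'n \<Rightarrow> real) \<Rightarrow> (real^'n \<Rightarrow> real) \<Rightarrow> bool" where
  "generator_graph T f g \<longleftrightarrow> f \<in> C_zero \<and> g \<in> C_zero \<and>
     uniform_limit UNIV (\<lambda>t x. (T t f x - f x) / t) g (at_right 0)"

definition generator_domain ::
  "(real \<Rightarrow> (real^'n::finite \<Rightarrow> real) \<Rightarrow> real^'n \<Rightarrow> real) \<Rightarrow> (real^'n \<Rightarrow> real) set" where
  "generator_domain T = {f. \<exists>g. generator_graph T f g}"

definition generator ::
  "(real \<Rightarrow> (real^'n::finite \<Rightarrow> real) \<Rightarrow> real^'n \<Rightarrow> real) \<Rightarrow>
     (real^'n \<Rightarrow> real) \<Rightarrow> real^'n \<Rightarrow> real" where
  "generator T f = (THE g. generator_graph T f g)"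

section \<open>Levy-type processes\<close>

definition natural_filtration ::
  "'w measure \<Rightarrow> (real \<Rightarrow> 'w \<Rightarrow> real^'n::finite) \<Rightarrow> real \<Rightarrow> 'w measure" where
  "natural_filtration M X t =
     sigma (space M) {X s -` B \<inter> space M | s B. 0 \<le> s \<and> s \<le> t \<and> B \<in> sets borel}"

definition transition_semigroup ::
  "(real^'n::finite \<Rightarrow> 'w measure) \<Rightarrow> (real \<Rightarrow> 'w \<Rightarrow> real^'n) \<Rightarrow>
     real \<Rightarrow> (real^'n \<Rightarrow> real) \<Rightarrow> real^'n \<Rightarrow> real" where
  "transition_semigroup P X t f x = (LINT \<omega>|P x. f (X t \<omega>))"

text \<open>
  The measure \<open>M\<close> only supplies the sample space and its sigma-algebra; the law of the
  process started at \<open>x\<close> is \<open>P x\<close>. Only times \<open>t \<ge> 0\<close> matter. The Markov property is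
  imposed for the natural filtration, which is the weakest choice.
\<close>

locale levy_type_process =
  fixes M :: "'w measure"
    and P :: "real^'n::finite \<Rightarrow> 'w measure"
    and X :: "real \<Rightarrow> 'w \<Rightarrow> real^'n"
  assumes prob_space_P: "prob_space (P x)"
    and sets_P: "sets (P x) = sets M"
    and measurable_X: "0 \<le> t \<Longrightarrow> X t \<in> borel_measurable M"
    and start: "AE \<omega> in P x. X 0 \<omega> = x"
    and transition_measurable:
      "0 \<le> t \<Longrightarrow> B \<in> sets borel \<Longrightarrow>
        (\<lambda>x. measure (P x) {\<omega> \<in> space M. X t \<omega> \<in> B}) \<in> borel_measurable borel"
    and markov:
      "0 \<le> s \<Longrightarrow> 0 \<le> t \<Longrightarrow> B \<in> sets borel \<Longrightarrow>
        AE \<omega> in P x.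
          real_cond_exp (P x) (natural_filtration M X s) (\<lambda>\<omega>'. indicator B (X (s + t) \<omega>')) \<omega> =
          measure (P (X s \<omega>)) {\<omega>' \<in> space M. X t \<omega>' \<in> B}"
    and right_continuous:
      "\<omega> \<in> space M \<Longrightarrow> 0 \<le> t \<Longrightarrow> ((\<lambda>s. X s \<omega>) \<longlongrightarrow> X t \<omega>) (at_right t)"
    and left_limits:
      "\<omega> \<in> space M \<Longrightarrow> 0 < t \<Longrightarrow> \<exists>l. ((\<lambda>s. X s \<omega>) \<longlongrightarrow> l) (at_left t)"
    and feller: "feller_semigroup (transition_semigroup P X)"

locale rich_levy_type_process = levy_type_process +
  assumes rich: "C_c_infinity \<subseteq> generator_domain (transition_semigroup P X)"

section \<open>Symbol and characteristics\<close>

definition fourier :: "(real^'n::finite \<Rightarrow> real) \<Rightarrow> real^'n \<Rightarrow> complex" where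
  "fourier f \<xi> =
     (LINT x|lborel. exp (- \<i> * of_real (x \<bullet> \<xi>)) * of_real (f x)) / of_real ((2 * pi) ^ CARD('n))"

text \<open>Levy measures live on the punctured space, so integrating against them is integrating
  over all nonzero \<open>y\<close>.\<close>

definition levy_triplet :: "real^'n::finite \<Rightarrow> real^'n^'n \<Rightarrow> (real^'n) measure \<Rightarrow> bool" where
  "levy_triplet b Q \<nu> \<longleftrightarrow>
     transpose Q = Q \<and> (\<forall>v. 0 \<le> v \<bullet> (Q *v v)) \<and>
     sets \<nu> = sets (restrict_space borel (- {0})) \<and>
     (\<integral>\<^sup>+ y. ennreal (min ((norm y)\<^sup>2) 1) \<partial>\<nu>) < \<infinity>"

definition has_characteristics ::
  "(real^'n::finite \<Rightarrow> real^'n \<Rightarrow> complex) \<Rightarrow>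
     (real^'n \<Rightarrow> real^'n) \<Rightarrow> (real^'n \<Rightarrow> real^'n^'n) \<Rightarrow> (real^'n \<Rightarrow> (real^'n) measure) \<Rightarrow> bool" where
  "has_characteristics q b Q \<nu> \<longleftrightarrow>
     (\<forall>x. levy_triplet (b x) (Q x) (\<nu> x)) \<and>
     (\<forall>x \<xi>. q x \<xi> = q x 0 - \<i> * of_real (b x \<bullet> \<xi>) + of_real (\<xi> \<bullet> (Q x *v \<xi>)) / 2 +
        (LINT y|\<nu> x. 1 - exp (\<i> * of_real (y \<bullet> \<xi>))
            + \<i> * of_real (y \<bullet> \<xi>) * of_real (indicator {0<..<1} (norm y))))"

definition has_symbol ::
  "(real^'n::finite \<Rightarrow> 'w measure) \<Rightarrow> (real \<Rightarrow> 'w \<Rightarrow> real^'n) \<Rightarrow>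
     (real^'n \<Rightarrow> real^'n \<Rightarrow> complex) \<Rightarrow> bool" where
  "has_symbol P X q \<longleftrightarrow>
     (\<forall>f\<in>C_c_infinity. \<forall>x. of_real (generator (transition_semigroup P X) f x) =
        - (LINT \<xi>|lborel. exp (\<i> * of_real (x \<bullet> \<xi>)) * q x \<xi> * fourier f \<xi>))"

definition bounded_coefficients :: "(real^'n::finite \<Rightarrow> real^'n \<Rightarrow> complex) \<Rightarrow> bool" where
  "bounded_coefficients q \<longleftrightarrow> (\<exists>c>0. \<forall>x \<xi>. norm (q x \<xi>) \<le> c * (1 + (norm \<xi>)\<^sup>2))"

definition sector_condition :: "(real^'n::finite \<Rightarrow> real^'n \<Rightarrow> complex) \<Rightarrow> bool" where
  "sector_condition q \<longleftrightarrow> (\<exists>C>0. \<forall>x \<xi>. \<bar>Im (q x \<xi>)\<bar> \<le> C * Re (q x \<xi>))"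

definition BG_index_infinity :: "(real^'n::finite \<Rightarrow> real^'n \<Rightarrow> complex) \<Rightarrow> real^'n \<Rightarrow> real" where
  "BG_index_infinity q x =
     Inf {\<gamma>. 0 < \<gamma> \<and>
       (\<exists>L::real. ((\<lambda>r. r powr (- \<gamma>) * (SUP \<xi>\<in>cball 0 r. norm (q x \<xi>))) \<longlongrightarrow> L) at_top)}"

end

theory Submission
  imports Defs
begin

text \<open>
  The generator of a Feller semigroup is closed, so it suffices to approximate \<open>f\<close> uniformly by test
  functions \<open>g n\<close> whose images \<open>A (g n)\<close> converge uniformly to the claimed expression. On test functions,
  Fourier inversion and Fubini turn the symbol representation into the integro-differential operator.
  Cutting off and mollifying \<open>f\<close> gives \<open>g n\<close> converging to \<open>f\<close> in \<open>C^1\<close>; since \<open>\<alpha>\<close> is uniformly continuous,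
  averaging over small balls costs only \<open>\<epsilon>/2\<close> in the Hoelder exponent, so the gradients of the \<open>g n\<close> satisfy a
  uniform Hoelder bound of order \<open>max (\<alpha>(x) - 1 - \<epsilon>/2) 0\<close>. Jumps of size below \<open>r\<close> then contribute at most
  a constant times \<open>r powr (\<epsilon>/2)\<close> by the moment hypothesis on \<open>\<nu>\<close>, and the remaining terms are controlled by the \<open>C^1\<close>
  distance because \<open>b\<close> and the mass of large jumps are bounded.
\<close>

subsection \<open>Partial derivatives and functions of class $C^k$\<close>

text \<open>Smooth functions are in general not dense in a Hoelder space under its own norm, so the
  \<open>g n\<close> cannot be expected to converge to \<open>f\<close> there, while
  \<open>C^1\<close> convergence alone says nothing about the integral over small jumps. The gap
  \<epsilon> between the smoothness of \<open>f\<close> and the exponent of the moment condition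
  removes this obstacle: a mere bound on Hoelder quotients, uniform in \<open>n\<close>, already
  makes small jumps uniformly negligible. One half of \<epsilon> pays for the variable order,
  because a mollified function at \<open>x\<close> inherits the exponent valid at nearby points
  \<open>x - z\<close>; the other half is the power of \<open>r\<close> that is gained. No bound on
  \<open>b\<close> or on large jumps is assumed. Both come from the growth bound on
  \<open>q\<close>: a Gaussian average of \<open>Re q\<close> isolates the large jumps, and with
  them controlled the values of \<open>q\<close> at unit vectors bound \<open>b\<close>. Closedness
  of the generator rests on telescoping over short time steps, a discrete substitute for the formula
  that writes \<open>T t f - f\<close> as the time integral of \<open>T s g\<close>.\<close>

lemma partial_deriv_has_derivative:
  assumes "partial_differentiable j f"
  shows "((\<lambda>s. f (x + s *\<^sub>R axis j 1)) has_real_derivative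
           partial_deriv j f (x + t *\<^sub>R axis j 1)) (at t)"
proof -
  have "((\<lambda>s. f ((x + t *\<^sub>R axis j 1) + s *\<^sub>R axis j 1)) has_real_derivative
          partial_deriv j f (x + t *\<^sub>R axis j 1)) (at 0)"
    using assms unfolding partial_differentiable_def partial_deriv_def
    by (simp add: DERIV_deriv_iff_field_differentiable)
  then have "((\<lambda>s. f (x + (s + t) *\<^sub>R axis j 1)) has_real_derivative
          partial_deriv j f (x + t *\<^sub>R axis j 1)) (at 0)"
    by (simp add: algebra_simps)
  then show ?thesis
    using DERIV_shift[of "\<lambda>s. f (x + s *\<^sub>R axis j 1)" _ 0 t] by simp
qed

lemma partial_derivI:
  assumes "\<And>x. ((\<lambda>s. f (x + s *\<^sub>R axis j 1)) has_real_derivative D x) (at 0)"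
  shows "partial_differentiable j f" "partial_deriv j f = D"
  using assms unfolding partial_differentiable_def partial_deriv_def field_differentiable_def
  by (blast, auto intro!: ext DERIV_imp_deriv)

lemma partial_deriv_at_0:
  assumes "partial_differentiable j f"
  shows "((\<lambda>s. f (x + s *\<^sub>R axis j 1)) has_real_derivative partial_deriv j f x) (at 0)"
  using partial_deriv_has_derivative[OF assms, of x 0] by simp

text \<open>Continuity of \<open>f\<close> itself is a consequence, recovered in
  \<open>C_one_continuous\<close> through total differentiability.\<close>

definition C_one :: "(real^'n::finite \<Rightarrow> real) \<Rightarrow> bool" where
  "C_one f \<longleftrightarrow> (\<forall>j. partial_differentiable j f \<and> continuous_on UNIV (partial_deriv j f))"

text \<open>The path from \<open>x\<close> to \<open>x + h\<close> changes one coordinate at a time,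
  so each step is a one-dimensional mean value estimate. The induction runs over the set
  \<open>S\<close> of coordinates in which \<open>h\<close> may be nonzero; the application takes
  all of them.\<close>

lemma increment_coordinate_subset:
  fixes f :: "real^'n::finite \<Rightarrow> real"
  assumes f: "C_one f" and "finite S"
    and close: "\<And>j z. norm (z - x) < \<delta> \<Longrightarrow> \<bar>partial_deriv j f z - partial_deriv j f x\<bar> \<le> e"
    and "norm h < \<delta>" and "\<And>j. j \<notin> S \<Longrightarrow> h $ j = 0"
  shows "\<bar>f (x + h) - f x - (\<Sum>j\<in>S. h $ j * partial_deriv j f x)\<bar> \<le> e * (\<Sum>j\<in>S. \<bar>h $ j\<bar>)"
  using \<open>finite S\<close> assms(4,5)
proof (induction S arbitrary: h rule: finite_induct)
  case empty
  then have "h = 0" by (simp add: vec_eq_iff)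
  then show ?case by simp
next
  case (insert k S)
  define h' where "h' = h - h $ k *\<^sub>R axis k 1"
  have h'_nth: "h' $ j = (if j = k then 0 else h $ j)" for j
    by (simp add: h'_def axis_def)
  \<comment> \<open>Keeping the \<open>k\<close>-th coordinate within its original size does not
    increase the norm, so the whole segment stays where \<open>close\<close> applies.\<close>
  have le: "norm (h' + s *\<^sub>R axis k 1) \<le> norm h" if "\<bar>s\<bar> \<le> \<bar>h $ k\<bar>" for s
    by (rule norm_le_componentwise_cart) (use that in \<open>auto simp: h'_nth axis_def\<close>)
  have "norm h' < \<delta>" using le[of 0] insert.prems by simp
  then have IH: "\<bar>f (x + h') - f x - (\<Sum>j\<in>S. h' $ j * partial_deriv j f x)\<bar> \<le> e * (\<Sum>j\<in>S. \<bar>h' $ j\<bar>)"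
    by (intro insert.IH) (use insert.prems in \<open>auto simp: h'_nth\<close>)
  have S: "(\<Sum>j\<in>S. h' $ j * partial_deriv j f x) = (\<Sum>j\<in>S. h $ j * partial_deriv j f x)"
    "(\<Sum>j\<in>S. \<bar>h' $ j\<bar>) = (\<Sum>j\<in>S. \<bar>h $ j\<bar>)"
    using insert.hyps by (auto intro!: sum.cong simp: h'_nth)
  \<comment> \<open>With the linear part subtracted, the derivative of \<open>F\<close> is the
    deviation of the partial derivative from its value at \<open>x\<close>, which is at most
    \<open>e\<close>.\<close>
  define F where "F s = f (x + h' + s *\<^sub>R axis k 1) - s * partial_deriv k f x" for s
  have der: "(F has_real_derivative
      (partial_deriv k f (x + h' + s *\<^sub>R axis k 1) - partial_deriv k f x)) (at s within T)" for s T
    unfolding F_def using f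
    by (intro has_field_derivative_at_within[OF DERIV_diff] DERIV_cmult_right[where x = 1, simplified]
        partial_deriv_has_derivative) (auto simp: C_one_def intro!: derivative_eq_intros)
  have "norm (F (h $ k) - F 0) \<le> e * norm (h $ k - 0)"
  proof (rule field_differentiable_bound[where S = "{-\<bar>h $ k\<bar>..\<bar>h $ k\<bar>}"])
    show "norm (partial_deriv k f (x + h' + z *\<^sub>R axis k 1) - partial_deriv k f x) \<le> e"
      if "z \<in> {-\<bar>h $ k\<bar>..\<bar>h $ k\<bar>}" for z
    proof -
      have "\<bar>z\<bar> \<le> \<bar>h $ k\<bar>" using that by auto
      then have "norm (h' + z *\<^sub>R axis k 1) < \<delta>" using le insert.prems by fastforce
      then show ?thesis using close[of "x + h' + z *\<^sub>R axis k 1" k] by (simp add: add.assoc)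
    qed
  qed (use der in auto)
  moreover have "x + h' + (h $ k) *\<^sub>R axis k 1 = x + h" by (simp add: h'_def)
  ultimately have "\<bar>f (x + h) - f (x + h') - h $ k * partial_deriv k f x\<bar> \<le> e * \<bar>h $ k\<bar>"
    by (simp add: F_def diff_right_commute)
  then show ?case
    using IH insert.hyps unfolding S by (simp add: algebra_simps)
qed

lemma C_one_has_derivative:
  fixes f :: "real^'n::finite \<Rightarrow> real"
  assumes f: "C_one f"
  shows "(f has_derivative (\<lambda>h. grad f x \<bullet> h)) (at x)"
proof (rule has_derivativeI)
  show "bounded_linear (\<lambda>h. grad f x \<bullet> h)" by (rule bounded_linear_inner_right)
  show "((\<lambda>y. ((f y - f x) - grad f x \<bullet> (y - x)) /\<^sub>R norm (y - x)) \<longlongrightarrow> 0) (at x within UNIV)"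
  proof (rule tendstoI)
    fix e :: real assume "e > 0"
    \<comment> \<open>The absolute coordinates of \<open>h\<close> sum to at most
      \<open>CARD('n)\<close> times its norm; the extra factor 2 makes the final inequality
      strict.\<close>
    define e' where "e' = e / (2 * real CARD('n))"
    have "e' > 0" using \<open>e > 0\<close> by (simp add: e'_def)
    have "\<forall>\<^sub>F z in nhds x. \<forall>j. \<bar>partial_deriv j f z - partial_deriv j f x\<bar> < e'"
    proof (rule eventually_all_finite)
      fix j
      have "isCont (partial_deriv j f) x"
        using f by (auto simp: C_one_def continuous_on_eq_continuous_at)
      then show "\<forall>\<^sub>F z in nhds x. \<bar>partial_deriv j f z - partial_deriv j f x\<bar> < e'"
        using tendstoD[of "partial_deriv j f" "partial_deriv j f x" "nhds x", OF _ \<open>e' > 0\<close>]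
        unfolding isCont_def tendsto_at_iff_tendsto_nhds dist_real_def by blast
    qed
    then obtain \<delta> where "\<delta> > 0" and \<delta>:
      "\<And>z j. dist z x < \<delta> \<Longrightarrow> \<bar>partial_deriv j f z - partial_deriv j f x\<bar> < e'"
      unfolding eventually_nhds_metric by blast
    show "\<forall>\<^sub>F y in at x. dist (((f y - f x) - grad f x \<bullet> (y - x)) /\<^sub>R norm (y - x)) 0 < e"
      unfolding eventually_at
    proof (intro exI conjI ballI impI)
      show "\<delta> > 0" by fact
      fix y assume y: "y \<noteq> x \<and> dist y x < \<delta>"
      define h where "h = y - x"
      have h: "h \<noteq> 0" "norm h < \<delta>" "y = x + h" using y by (auto simp: h_def dist_norm)
      have "\<bar>f (x + h) - f x - (\<Sum>j\<in>UNIV. h $ j * partial_deriv j f x)\<bar> \<le> e' * (\<Sum>j\<in>UNIV. \<bar>h $ j\<bar>)"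
        by (rule increment_coordinate_subset[OF f, where \<delta> = \<delta>])
          (use h \<delta> in \<open>auto simp: dist_norm less_imp_le\<close>)
      also have "\<dots> \<le> e' * (\<Sum>j\<in>(UNIV::'n set). norm h)"
        using \<open>e' > 0\<close> by (intro mult_left_mono sum_mono component_le_norm_cart) auto
      also have "\<dots> = e / 2 * norm h" by (simp add: e'_def)
      finally have "\<bar>f y - f x - grad f x \<bullet> (y - x)\<bar> \<le> e / 2 * norm h"
        by (simp add: h inner_vec_def grad_def mult.commute)
      also have "\<dots> < e * norm h" using \<open>e > 0\<close> h by simp
      finally have "\<bar>f y - f x - grad f x \<bullet> (y - x)\<bar> / norm h < e"
        using h by (simp add: pos_divide_less_eq)
      then show "dist (((f y - f x) - grad f x \<bullet> (y - x)) /\<^sub>R norm (y - x)) 0 < e"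
        by (simp add: h_def abs_mult divide_inverse mult.commute)
    qed
  qed
qed

lemma C_one_line_derivative:
  assumes "C_one f"
  shows "((\<lambda>s. f (x + s *\<^sub>R y)) has_real_derivative grad f (x + s *\<^sub>R y) \<bullet> y) (at s within T)"
proof -
  have "((\<lambda>s. x + s *\<^sub>R y) has_derivative (\<lambda>h. h *\<^sub>R y)) (at s within T)"
    by (auto intro!: derivative_eq_intros)
  then have "((\<lambda>s. f (x + s *\<^sub>R y)) has_derivative (\<lambda>h. grad f (x + s *\<^sub>R y) \<bullet> (h *\<^sub>R y))) (at s within T)"
    by (rule has_derivative_compose[OF _ C_one_has_derivative[OF assms]])
  then show ?thesis
    by (simp add: has_field_derivative_def mult_commute_abs)
qed

lemma partial_deriv_const [simp]:
  "partial_differentiable j (\<lambda>x. c)" "partial_deriv j (\<lambda>x. c) = (\<lambda>x. 0)"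
  by (rule partial_derivI[where D = "\<lambda>x. 0"], simp)+

lemma partial_deriv_add:
  assumes "partial_differentiable j f" "partial_differentiable j g"
  shows "partial_differentiable j (\<lambda>x. f x + g x)"
    and "partial_deriv j (\<lambda>x. f x + g x) = (\<lambda>x. partial_deriv j f x + partial_deriv j g x)"
  using assms by (auto intro!: partial_derivI derivative_eq_intros partial_deriv_at_0)

lemma partial_deriv_diff:
  assumes "partial_differentiable j f" "partial_differentiable j g"
  shows "partial_differentiable j (\<lambda>x. f x - g x)"
    and "partial_deriv j (\<lambda>x. f x - g x) = (\<lambda>x. partial_deriv j f x - partial_deriv j g x)"
  using assms by (auto intro!: partial_derivI derivative_eq_intros partial_deriv_at_0)

lemma partial_deriv_mult:
  assumes "partial_differentiable j f" "partial_differentiable j g"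
  shows "partial_differentiable j (\<lambda>x. f x * g x)"
    and "partial_deriv j (\<lambda>x. f x * g x) = (\<lambda>x. partial_deriv j f x * g x + f x * partial_deriv j g x)"
  using assms by (auto intro!: partial_derivI derivative_eq_intros partial_deriv_at_0)

lemma partial_deriv_scaled:
  assumes "partial_differentiable j f"
  shows "partial_differentiable j (\<lambda>x. f (c *\<^sub>R x))"
    and "partial_deriv j (\<lambda>x. f (c *\<^sub>R x)) = (\<lambda>x. c * partial_deriv j f (c *\<^sub>R x))"
proof -
  have "((\<lambda>s. f (c *\<^sub>R (x + s *\<^sub>R axis j 1))) has_real_derivative c * partial_deriv j f (c *\<^sub>R x)) (at 0)" for x
    using DERIV_chain'[OF DERIV_cmult_Id[of c 0 UNIV]
        partial_deriv_has_derivative[OF assms, of "c *\<^sub>R x" "c * 0"]]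
    by (simp add: algebra_simps)
  from partial_derivI[of "\<lambda>x. f (c *\<^sub>R x)", OF this]
  show "partial_differentiable j (\<lambda>x. f (c *\<^sub>R x))"
    and "partial_deriv j (\<lambda>x. f (c *\<^sub>R x)) = (\<lambda>x. c * partial_deriv j f (c *\<^sub>R x))" by auto
qed

lemma C_k_continuous: "C_k k f \<Longrightarrow> continuous_on UNIV f"
  by (cases k) auto

lemma C_k_Suc_imp: "C_k (Suc k) f \<Longrightarrow> C_k k f"
proof (induction k arbitrary: f)
  case (Suc k)
  then show ?case using C_k.simps(2) by blast
qed simp

lemma C_k_const: "C_k k (\<lambda>x. c)"
  by (induction k arbitrary: c) auto

lemma C_k_add: "C_k k f \<Longrightarrow> C_k k g \<Longrightarrow> C_k k (\<lambda>x. f x + g x)"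
  by (induction k arbitrary: f g) (simp_all add: partial_deriv_add continuous_on_add)

lemma C_k_mult: "C_k k f \<Longrightarrow> C_k k g \<Longrightarrow> C_k k (\<lambda>x. f x * g x)"
proof (induction k arbitrary: f g)
  case (Suc k)
  have "C_k k (partial_deriv j f)" "C_k k (partial_deriv j g)" "C_k k f" "C_k k g" for j
    using Suc.prems C_k_Suc_imp by auto
  then have "C_k k (\<lambda>x. partial_deriv j f x * g x + f x * partial_deriv j g x)" for j
    by (intro C_k_add Suc.IH)
  then show ?case
    using Suc.prems by (simp add: partial_deriv_mult continuous_on_mult)
qed (simp add: continuous_on_mult)

lemma C_k_prod:
  assumes "finite S" "\<And>i. i \<in> S \<Longrightarrow> C_k k (f i)"
  shows "C_k k (\<lambda>x. \<Prod>i\<in>S. f i x)"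
  using assms by (induction S rule: finite_induct) (auto intro: C_k_const C_k_mult)

lemma C_k_imp_C_one: "C_k (Suc k) f \<Longrightarrow> C_one f"
  using C_k_continuous by (auto simp: C_one_def)

subsection \<open>Smooth functions with compact support\<close>

text \<open>A closure is closed, so compactness of the support is just boundedness. In this form
  supports are tracked by radii.\<close>

lemma C_c_infinity_iff:
  "f \<in> C_c_infinity \<longleftrightarrow> (\<forall>k. C_k k f) \<and> (\<exists>R. \<forall>x. R < norm x \<longrightarrow> f x = 0)"
proof -
  have "compact (closure {x. f x \<noteq> 0}) \<longleftrightarrow> (\<exists>R. \<forall>x. R < norm x \<longrightarrow> f x = 0)"
    by (auto simp: bounded_iff) (meson linorder_not_le)+
  then show ?thesis by (simp add: C_c_infinity_def)
qed

lemma partial_deriv_zero_outside: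
  assumes "\<And>x. R < norm x \<Longrightarrow> f x = 0" "R < norm x"
  shows "partial_deriv j f x = 0"
proof -
  have "((\<lambda>s. norm (x + s *\<^sub>R axis j 1)) \<longlongrightarrow> norm (x + 0 *\<^sub>R axis j 1)) (nhds 0)"
    by (intro tendsto_intros filterlim_ident)
  then have "\<forall>\<^sub>F s in nhds 0. R < norm (x + s *\<^sub>R axis j 1)"
    using assms(2) by (intro order_tendstoD(1)) auto
  then have "\<forall>\<^sub>F s in nhds 0. f (x + s *\<^sub>R axis j 1) = 0"
    by eventually_elim (use assms in auto)
  then have "deriv (\<lambda>s. f (x + s *\<^sub>R axis j 1)) 0 = deriv (\<lambda>s. 0) 0"
    by (intro deriv_cong_ev) auto
  then show ?thesis by (simp add: partial_deriv_def)
qed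

lemma C_c_infinity_partial_deriv:
  assumes "f \<in> C_c_infinity"
  shows "partial_deriv j f \<in> C_c_infinity" "partial_differentiable j f"
proof -
  have "C_k (Suc k) f" for k using assms by (simp add: C_c_infinity_iff del: C_k.simps)
  then have "partial_differentiable j f \<and> C_k k (partial_deriv j f)" for k by simp
  moreover obtain R where R: "\<And>x. R < norm x \<Longrightarrow> f x = 0" using assms by (auto simp: C_c_infinity_iff)
  ultimately show "partial_deriv j f \<in> C_c_infinity" "partial_differentiable j f"
    using partial_deriv_zero_outside[of R f, OF R] unfolding C_c_infinity_iff by blast+
qed

lemma C_c_infinity_continuous: "f \<in> C_c_infinity \<Longrightarrow> continuous_on UNIV f"
  using C_k_continuous by (auto simp: C_c_infinity_iff)

lemma C_c_infinity_C_one: "f \<in> C_c_infinity \<Longrightarrow> C_one f"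
  using C_k_imp_C_one[of 0 f] by (auto simp: C_c_infinity_iff simp del: C_k.simps)

lemma C_zero_I:
  assumes "continuous_on UNIV f" "\<And>x. R < norm x \<Longrightarrow> f x = 0"
  shows "f \<in> C_zero"
proof -
  have "\<forall>\<^sub>F x in at_infinity. f x = 0"
    unfolding eventually_at_infinity using assms(2) by (intro exI[of _ "R + 1"]) auto
  then have "(f \<longlongrightarrow> 0) at_infinity" by (rule tendsto_eventually)
  then show ?thesis using assms by (simp add: C_zero_def)
qed

lemma C_c_infinity_C_zero: "f \<in> C_c_infinity \<Longrightarrow> f \<in> C_zero"
  using C_zero_I C_c_infinity_continuous C_c_infinity_iff by metis

lemma C_zero_small_outside:
  assumes "f \<in> C_zero" "e > 0"
  obtains R where "\<And>x. R \<le> norm x \<Longrightarrow> \<bar>f x\<bar> < e"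
  using assms tendstoD[of f 0 at_infinity e] unfolding C_zero_def eventually_at_infinity
  by (auto simp: dist_real_def)

lemma C_zero_bounded:
  assumes "f \<in> C_zero"
  obtains B where "B > 0" "\<And>x. \<bar>f x\<bar> \<le> B"
proof -
  obtain R where R: "\<And>x. R \<le> norm x \<Longrightarrow> \<bar>f x\<bar> < 1"
    using C_zero_small_outside[OF assms, of 1] by auto
  have "compact (f ` cball 0 R)"
    using assms by (intro compact_continuous_image)
      (auto simp: C_zero_def intro: continuous_on_subset)
  then obtain B where B: "\<And>x. norm x \<le> R \<Longrightarrow> \<bar>f x\<bar> \<le> B"
    by (force dest!: compact_imp_bounded simp: bounded_iff)
  show ?thesis
  proof
    show "\<bar>f x\<bar> \<le> max B 1" for x
      using B[of x] R[of x] by (cases "norm x \<le> R") auto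
  qed simp
qed

lemma C_zero_uniformly_continuous:
  fixes f :: "real^'n::finite \<Rightarrow> real"
  assumes "f \<in> C_zero"
  shows "uniformly_continuous_on UNIV f"
  unfolding uniformly_continuous_on_def
proof (intro allI impI)
  fix e :: real assume "e > 0"
  obtain R where R: "\<And>x. R \<le> norm x \<Longrightarrow> \<bar>f x\<bar> < e / 2"
    using C_zero_small_outside[OF assms, of "e / 2"] \<open>e > 0\<close> by auto
  have "uniformly_continuous_on (cball 0 (R + 1)) f"
    using assms by (intro compact_uniformly_continuous)
      (auto simp: C_zero_def intro: continuous_on_subset)
  then obtain d where d: "d > 0" "\<And>x x'. norm x \<le> R + 1 \<Longrightarrow> norm x' \<le> R + 1 \<Longrightarrow> dist x' x < d \<Longrightarrow>
      dist (f x') (f x) < e"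
    unfolding uniformly_continuous_on_def using \<open>e > 0\<close> by (auto 0 3 simp: Ball_def)
  show "\<exists>d>0. \<forall>x\<in>UNIV. \<forall>x'\<in>UNIV. dist x' x < d \<longrightarrow> dist (f x') (f x) < e"
  \<comment> \<open>Distance below 1 ensures that both points lie in the ball of radius
    \<open>R + 1\<close> once one lies in the ball of radius \<open>R\<close>. Otherwise both values
    are below \<open>e / 2\<close>.\<close>
  proof (intro exI[of _ "min d 1"] conjI ballI impI)
    fix x x' :: "real^'n" assume *: "dist x' x < min d 1"
    show "dist (f x') (f x) < e"
    proof (cases "norm x \<le> R \<or> norm x' \<le> R")
      case True
      moreover have "norm x \<le> norm x' + dist x' x" "norm x' \<le> norm x + dist x' x"
        by (smt (verit) dist_norm norm_minus_commute norm_triangle_sub)+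
      ultimately have "norm x \<le> R + 1" "norm x' \<le> R + 1" using * by auto
      then show ?thesis using d * by auto
    next
      case False
      then show ?thesis using R[of x] R[of x'] by (auto simp: dist_real_def)
    qed
  qed (use d in auto)
qed

section \<open>Flat functions and a smooth bump\<close>

definition flat_exp :: "real poly \<Rightarrow> real \<Rightarrow> real" where
  "flat_exp p t = (if 0 < t then poly p (inverse t) * exp (- inverse t) else 0)"

lemma poly_times_exp_minus_tendsto_0:
  "((\<lambda>u. poly p u * exp (- u)) \<longlongrightarrow> (0::real)) at_top"
proof -
  have "((\<lambda>u. \<Sum>i\<le>degree p. coeff p i * (u ^ i / exp u)) \<longlongrightarrow> (\<Sum>i\<le>degree p. coeff p i * 0)) at_top"
    by (intro tendsto_intros tendsto_power_div_exp_0)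
  then show ?thesis
    by (simp add: poly_altdef exp_minus divide_inverse sum_distrib_right mult.assoc)
qed

lemma flat_exp_tendsto_0: "(flat_exp p \<longlongrightarrow> 0) (at_right 0)"
proof -
  have "((\<lambda>t. poly p (inverse t) * exp (- inverse t)) \<longlongrightarrow> 0) (at_right 0)"
    by (rule filterlim_compose[OF poly_times_exp_minus_tendsto_0 filterlim_inverse_at_top_right])
  moreover have "\<forall>\<^sub>F t in at_right 0. poly p (inverse t) * exp (- inverse t) = flat_exp p t"
    by (auto simp: flat_exp_def eventually_at_right_less intro: eventually_mono[OF eventually_at_right_less])
  ultimately show ?thesis by (rule Lim_transform_eventually)
qed

text \<open>Differentiating \<open>p(1/t) exp(-1/t)\<close> again yields a function of this form.\<close>

lemma flat_exp_has_derivative: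
  "(flat_exp p has_real_derivative flat_exp ([:0, 0, 1:] * (p - pderiv p)) t) (at t)"
proof (cases t "0::real" rule: linorder_cases)
  case less
  have "((\<lambda>_. 0) has_real_derivative 0) (at t)" by simp
  moreover have "\<forall>\<^sub>F s in nhds t. (0::real) = flat_exp p s"
    using eventually_nhds_in_open[of "{..<0}" t] less by (auto elim!: eventually_mono simp: flat_exp_def)
  ultimately show ?thesis
    using less by (subst (asm) DERIV_cong_ev[OF refl _ refl]) (auto simp: flat_exp_def)
next
  case greater
  have "((\<lambda>t. poly p (inverse t) * exp (- inverse t)) has_real_derivative
     flat_exp ([:0, 0, 1:] * (p - pderiv p)) t) (at t)"
    using greater
    by (auto intro!: derivative_eq_intros DERIV_chain'[OF _ poly_DERIV]
        simp: flat_exp_def algebra_simps power2_eq_square)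
  moreover have "\<forall>\<^sub>F s in nhds t. poly p (inverse s) * exp (- inverse s) = flat_exp p s"
    using eventually_nhds_in_open[of "{0<..}" t] greater by (auto elim!: eventually_mono simp: flat_exp_def)
  ultimately show ?thesis
    by (subst (asm) DERIV_cong_ev[OF refl _ refl]) auto
next
  case equal
  have "((\<lambda>h. flat_exp p h / h) \<longlongrightarrow> 0) (at 0)"
  proof (rule filterlim_split_at)
    have "\<forall>\<^sub>F h in at_left (0::real). 0 = flat_exp p h / h"
      unfolding eventually_at by (intro exI[of _ 1]) (auto simp: flat_exp_def)
    then show "((\<lambda>h. flat_exp p h / h) \<longlongrightarrow> 0) (at_left 0)"
      by (rule Lim_transform_eventually[OF tendsto_const])
    \<comment> \<open>Division by \<open>h\<close> multiplies the polynomial by its variable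
      \<open>1 / h\<close>, so the difference quotient is again a flat function.\<close>
    have "\<forall>\<^sub>F h in at_right (0::real). flat_exp ([:0, 1:] * p) h = flat_exp p h / h"
      by (rule eventually_mono[OF eventually_at_right_less]) (auto simp: flat_exp_def field_simps)
    then show "((\<lambda>h. flat_exp p h / h) \<longlongrightarrow> 0) (at_right 0)"
      by (rule Lim_transform_eventually[OF flat_exp_tendsto_0])
  qed
  then show ?thesis using equal by (simp add: DERIV_def flat_exp_def)
qed

text \<open>Each derivative changes the polynomial, hence \<open>p\<close> is arbitrary in the
  induction. The affine argument covers both factors of the bump, those in \<open>1 + x $ j\<close>
  and in \<open>1 - x $ j\<close>.\<close>

lemma C_k_flat_exp_coordinate:
  "C_k k (\<lambda>x::real^'n::finite. flat_exp p (a + c * x $ j))"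
proof (induction k arbitrary: p)
  have cont: "continuous_on UNIV (\<lambda>x::real^'n. flat_exp p (a + c * x $ j))" for p
  proof -
    have "continuous_on UNIV (flat_exp p)"
      by (meson DERIV_continuous continuous_at_imp_continuous_on flat_exp_has_derivative)
    then show ?thesis
      by (rule continuous_on_compose2) (auto intro!: continuous_intros)
  qed
  { case 0 show ?case using cont by simp }
  { case (Suc k)
    let ?D = "\<lambda>i x::real^'n. (if i = j then c else 0) * flat_exp ([:0, 0, 1:] * (p - pderiv p)) (a + c * x $ j)"
    have "((\<lambda>s. flat_exp p (a + c * (x + s *\<^sub>R axis i 1) $ j)) has_real_derivative ?D i x) (at 0)" for i x
    proof -
      have "((\<lambda>s. a + c * (x + s *\<^sub>R axis i 1) $ j) has_real_derivative (if i = j then c else 0)) (at 0)"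
        by (auto intro!: derivative_eq_intros simp: axis_def)
      from DERIV_chain'[OF this flat_exp_has_derivative] show ?thesis
        by (simp add: mult.commute)
    qed
    from partial_derivI[OF this]
    have "partial_differentiable i (\<lambda>x. flat_exp p (a + c * x $ j))"
      "partial_deriv i (\<lambda>x. flat_exp p (a + c * x $ j)) = ?D i" for i by blast+
    moreover have "C_k k (?D i)" for i by (intro C_k_mult C_k_const Suc.IH)
    ultimately show ?case using cont by simp }
qed

text \<open>The product over the coordinates vanishes as soon as one coordinate exceeds 1 in
  absolute value. If none does, the norm is at most \<open>CARD('n)\<close>, because it is bounded
  by the sum of the absolute coordinates; hence the radius.\<close>

lemma smooth_bump_exists:
  obtains \<phi> :: "real^'n::finite \<Rightarrow> real"
  where "\<phi> \<in> C_c_infinity" "\<And>x. 0 \<le> \<phi> x" "0 < \<phi> 0" "\<And>x. real CARD('n) < norm x \<Longrightarrow> \<phi> x = 0"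
proof -
  let ?f = "\<lambda>i x. flat_exp 1 (1 + 1 * x $ i) * flat_exp 1 (1 + (-1) * x $ i)"
  define \<phi> :: "real^'n \<Rightarrow> real" where "\<phi> x = (\<Prod>i\<in>UNIV. ?f i x)" for x
  have zero: "\<phi> x = 0" if "real CARD('n) < norm x" for x
  proof -
    have "\<exists>i. 1 < \<bar>x $ i\<bar>"
    proof (rule ccontr)
      assume "\<not> ?thesis"
      then have "(\<Sum>i\<in>UNIV. \<bar>x $ i\<bar>) \<le> (\<Sum>i\<in>(UNIV::'n set). 1)" by (intro sum_mono) (auto simp: not_less)
      with norm_le_l1_cart[of x] that show False by simp
    qed
    then obtain i where "1 < \<bar>x $ i\<bar>" ..
    then have "?f i x = 0" by (auto simp: flat_exp_def)
    then show ?thesis unfolding \<phi>_def by (intro prod_zero) auto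
  qed
  have "C_k k \<phi>" for k
    unfolding \<phi>_def by (intro C_k_prod C_k_mult C_k_flat_exp_coordinate) auto
  with zero have "\<phi> \<in> C_c_infinity" by (auto simp: C_c_infinity_iff)
  moreover have "0 \<le> \<phi> x" for x unfolding \<phi>_def by (intro prod_nonneg) (auto simp: flat_exp_def)
  moreover have "0 < \<phi> 0" unfolding \<phi>_def by (intro prod_pos) (auto simp: flat_exp_def)
  ultimately show ?thesis using zero that by blast
qed

section \<open>Affine substitution and convolution\<close>

lemma integral_lborel_affine:
  fixes f :: "'a::euclidean_space \<Rightarrow> 'b::{banach, second_countable_topology}"
  assumes [measurable]: "f \<in> borel_measurable borel" and c: "c \<noteq> 0"
  shows "(LINT x|lborel. f x) = \<bar>c\<bar> ^ DIM('a) *\<^sub>R (LINT x|lborel. f (t + c *\<^sub>R x))"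
  by (subst lborel_affine[OF c, of t])
    (simp add: integral_density integral_distr)

lemma integrable_lborel_affine:
  fixes f :: "'a::euclidean_space \<Rightarrow> 'b::{banach, second_countable_topology}"
  assumes f: "integrable lborel f" and c: "c \<noteq> 0"
  shows "integrable lborel (\<lambda>x. f (t + c *\<^sub>R x))"
proof -
  have [measurable]: "f \<in> borel_measurable borel" using f by simp
  have "integrable (density (distr lborel borel (\<lambda>x. t + c *\<^sub>R x)) (\<lambda>_. \<bar>c\<bar>^DIM('a))) f"
    using f lborel_affine[OF c, of t] by simp
  then have "integrable lborel (\<lambda>x. \<bar>c\<bar> ^ DIM('a) *\<^sub>R f (t + c *\<^sub>R x))"
    by (subst (asm) integrable_density) (simp_all add: integrable_distr_eq)
  then have "integrable lborel (\<lambda>x. inverse (\<bar>c\<bar> ^ DIM('a)) *\<^sub>R \<bar>c\<bar> ^ DIM('a) *\<^sub>R f (t + c *\<^sub>R x))"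
    by (rule integrable_scaleR_right)
  then show ?thesis using c by simp
qed

lemma integrable_lborel_compact_support:
  fixes f :: "'a::euclidean_space \<Rightarrow> 'b::{banach, second_countable_topology}"
  assumes f: "continuous_on UNIV f" and "\<And>x. R < norm x \<Longrightarrow> f x = 0"
  shows "integrable lborel f"
proof -
  have "integrable lborel (\<lambda>x. indicator (cball 0 R) x *\<^sub>R f x)"
    by (rule borel_integrable_compact) (auto intro: continuous_on_subset[OF f])
  moreover have "(\<lambda>x. indicator (cball 0 R) x *\<^sub>R f x) = f"
    using assms(2) by (auto simp: indicator_def fun_eq_iff not_le)
  ultimately show ?thesis by simp
qed

definition func_convolution :: "(real^'n::finite \<Rightarrow> real) \<Rightarrow> (real^'n \<Rightarrow> real) \<Rightarrow> real^'n \<Rightarrow> real" where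
  "func_convolution w u x = (LINT z|lborel. w z * u (x - z))"

context
  fixes w u :: "real^'n::finite \<Rightarrow> real" and B :: real
  assumes w: "integrable lborel w" and u: "continuous_on UNIV u" and B: "\<And>x. \<bar>u x\<bar> \<le> B"
begin

private lemma bound: "\<bar>w z * u y\<bar> \<le> B * \<bar>w z\<bar>"
  using mult_left_mono[OF B[of y] abs_ge_zero[of "w z"]] by (simp add: abs_mult mult.commute)

lemma convolution_integrable: "integrable lborel (\<lambda>z. w z * u (x - z))"
proof (rule Bochner_Integration.integrable_bound)
  show "integrable lborel (\<lambda>z. B * \<bar>w z\<bar>)" using w by auto
  have [measurable]: "w \<in> borel_measurable borel" "u \<in> borel_measurable borel"
    using w u borel_measurable_continuous_onI by auto
  show "(\<lambda>z. w z * u (x - z)) \<in> borel_measurable lborel" by measurable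
  show "AE z in lborel. norm (w z * u (x - z)) \<le> norm (B * \<bar>w z\<bar>)"
    using order_trans[OF bound abs_ge_self] by (intro AE_I2) simp
qed

lemma convolution_continuous: "continuous_on UNIV (func_convolution w u)"
proof -
  have [measurable]: "w \<in> borel_measurable borel" "u \<in> borel_measurable borel"
    using w u borel_measurable_continuous_onI by auto
  have "(\<lambda>n. func_convolution w u (X n)) \<longlonglongrightarrow> func_convolution w u x" if X: "X \<longlonglongrightarrow> x" for X x
    unfolding func_convolution_def
  proof (rule integral_dominated_convergence[where w = "\<lambda>z. B * \<bar>w z\<bar>"])
    show "integrable lborel (\<lambda>z. B * \<bar>w z\<bar>)" using w by auto
    show "AE z in lborel. norm (w z * u (X n - z)) \<le> B * \<bar>w z\<bar>" for n
      using bound by (intro AE_I2) simp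
    have "isCont u (x - z)" for z using u by (simp add: continuous_on_eq_continuous_at)
    then have "(\<lambda>n. u (X n - z)) \<longlonglongrightarrow> u (x - z)" for z
      by (rule isCont_tendsto_compose) (intro tendsto_intros X)
    then show "AE z in lborel. (\<lambda>n. w z * u (X n - z)) \<longlonglongrightarrow> w z * u (x - z)"
      by (auto intro!: tendsto_intros)
  qed auto
  then show ?thesis
    by (auto simp: continuous_on_sequentially o_def)
qed

text \<open>By the mean value theorem the difference quotients of \<open>u\<close> are bounded by
  \<open>B'\<close>, so a multiple of the absolute value of \<open>w\<close> dominates and the limit
  passes under the integral.\<close>

lemma convolution_partial_deriv:
  assumes pd: "partial_differentiable j u" and cont: "continuous_on UNIV (partial_deriv j u)"
    and B': "\<And>x. \<bar>partial_deriv j u x\<bar> \<le> B'"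
  shows "partial_differentiable j (func_convolution w u)"
    and "partial_deriv j (func_convolution w u) = func_convolution w (partial_deriv j u)"
proof -
  have [measurable]: "w \<in> borel_measurable borel" "u \<in> borel_measurable borel"
    "partial_deriv j u \<in> borel_measurable borel"
    using w u cont borel_measurable_continuous_onI by auto
  have "((\<lambda>s. func_convolution w u (x + s *\<^sub>R axis j 1)) has_real_derivative func_convolution w (partial_deriv j u) x) (at 0)" for x
    unfolding DERIV_def tendsto_at_iff_sequentially o_def
  proof (intro allI impI)
    fix X :: "nat \<Rightarrow> real" assume X0: "\<forall>i. X i \<in> UNIV - {0}" and X: "X \<longlonglongrightarrow> 0"
    let ?q = "\<lambda>n z. (u (x - z + X n *\<^sub>R axis j 1) - u (x - z)) / X n"
    have "(\<lambda>n. LINT z|lborel. w z * ?q n z) \<longlonglongrightarrow> (LINT z|lborel. w z * partial_deriv j u (x - z))"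
    proof (rule integral_dominated_convergence[where w = "\<lambda>z. B' * \<bar>w z\<bar>"])
      show "integrable lborel (\<lambda>z. B' * \<bar>w z\<bar>)" using w by auto
      have "\<bar>?q n z\<bar> \<le> B'" for n z
      proof -
        have "norm (u (x - z + X n *\<^sub>R axis j 1) - u (x - z + 0 *\<^sub>R axis j 1)) \<le> B' * norm (X n - 0)"
          by (rule field_differentiable_bound[where S = UNIV])
            (use partial_deriv_has_derivative[OF pd] B' in auto)
        then show ?thesis using X0 by (simp add: divide_le_eq)
      qed
      then show "AE z in lborel. norm (w z * ?q n z) \<le> B' * \<bar>w z\<bar>" for n
        unfolding real_norm_def abs_mult by (intro AE_I2) (subst mult.commute, intro mult_right_mono, auto)
      have "(\<lambda>n. ?q n z) \<longlonglongrightarrow> partial_deriv j u (x - z)" for z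
        using partial_deriv_at_0[OF pd, of "x - z"] X X0
        unfolding DERIV_def tendsto_at_iff_sequentially o_def by auto
      then show "AE z in lborel. (\<lambda>n. w z * ?q n z) \<longlonglongrightarrow> w z * partial_deriv j u (x - z)"
        by (intro AE_I2 tendsto_mult tendsto_const)
    qed auto
    moreover have "(LINT z|lborel. w z * ?q n z) =
        (func_convolution w u (x + X n *\<^sub>R axis j 1) - func_convolution w u x) / X n" for n
    proof -
      have "(func_convolution w u (x + X n *\<^sub>R axis j 1) - func_convolution w u x) / X n =
          (LINT z|lborel. (w z * u (x + X n *\<^sub>R axis j 1 - z) - w z * u (x - z)) / X n)"
        unfolding func_convolution_def
        by (subst Bochner_Integration.integral_diff[symmetric]) (auto intro: convolution_integrable)
      also have "\<dots> = (LINT z|lborel. w z * ?q n z)"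
        by (intro Bochner_Integration.integral_cong) (auto simp: algebra_simps diff_divide_distrib)
      finally show ?thesis by (rule sym)
    qed
    ultimately have "(\<lambda>n. (func_convolution w u (x + X n *\<^sub>R axis j 1) - func_convolution w u x) / X n)
        \<longlonglongrightarrow> (LINT z|lborel. w z * partial_deriv j u (x - z))"
      by (simp only:)
    then show "(\<lambda>n. (func_convolution w u (x + (0 + X n) *\<^sub>R axis j 1) - func_convolution w u (x + 0 *\<^sub>R axis j 1)) / X n)
        \<longlonglongrightarrow> func_convolution w (partial_deriv j u) x"
      by (simp add: func_convolution_def)
  qed
  from partial_derivI[OF this] show "partial_differentiable j (func_convolution w u)"
    "partial_deriv j (func_convolution w u) = func_convolution w (partial_deriv j u)" by auto
qed

end

lemma convolution_commute:
  fixes w u :: "real^'n::finite \<Rightarrow> real"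
  assumes "w \<in> borel_measurable borel" "u \<in> borel_measurable borel"
  shows "func_convolution w u = func_convolution u w"
proof
  fix x
  have [measurable]: "w \<in> borel_measurable borel" "u \<in> borel_measurable borel" by fact+
  show "func_convolution w u x = func_convolution u w x"
    unfolding func_convolution_def
    using integral_lborel_affine[of "\<lambda>z. w z * u (x - z)" "-1" x] by (simp add: mult.commute)
qed

text \<open>All derivatives fall on the test function \<open>u\<close>, so integrability is all that
  is asked of \<open>w\<close>. Together with \<open>convolution_commute\<close> this allows one
  convolution to be read in two ways: smooth because of one factor, with a gradient inherited from
  the other.\<close>

lemma C_k_convolution:
  assumes w: "integrable lborel w" and u: "u \<in> C_c_infinity"
  shows "C_k k (func_convolution w u)"
  using u
proof (induction k arbitrary: u)
  case 0
  obtain B where "\<And>x. \<bar>u x\<bar> \<le> B" using C_zero_bounded[OF C_c_infinity_C_zero[OF 0]] by blast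
  then show ?case using convolution_continuous[OF w C_c_infinity_continuous[OF 0]] by auto
next
  case (Suc k)
  obtain B where B: "\<And>x. \<bar>u x\<bar> \<le> B" using C_zero_bounded[OF C_c_infinity_C_zero[OF Suc.prems]] by blast
  have "partial_differentiable j (func_convolution w u) \<and>
      partial_deriv j (func_convolution w u) = func_convolution w (partial_deriv j u)" for j
  proof -
    note pd = C_c_infinity_partial_deriv[OF Suc.prems, of j]
    obtain B' where "\<And>x. \<bar>partial_deriv j u x\<bar> \<le> B'"
      using C_zero_bounded[OF C_c_infinity_C_zero[OF pd(1)]] by blast
    then show ?thesis
      using convolution_partial_deriv[OF w C_c_infinity_continuous[OF Suc.prems] B pd(2)
          C_c_infinity_continuous[OF pd(1)]] by blast
  qed
  moreover have "continuous_on UNIV (func_convolution w u)"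
    using convolution_continuous[OF w C_c_infinity_continuous[OF Suc.prems] B] .
  moreover have "C_k k (func_convolution w (partial_deriv j u))" for j
    using Suc C_c_infinity_partial_deriv(1) by blast
  ultimately show ?case by simp
qed

lemma C_c_infinity_convolution:
  assumes w: "continuous_on UNIV w" "\<And>x. R < norm x \<Longrightarrow> w x = 0" and u: "u \<in> C_c_infinity"
  shows "func_convolution w u \<in> C_c_infinity"
proof -
  obtain R' where R': "\<And>x. R' < norm x \<Longrightarrow> u x = 0" using u by (auto simp: C_c_infinity_iff)
  have "func_convolution w u x = 0" if "R + R' < norm x" for x
  proof -
    have "(\<lambda>z. w z * u (x - z)) = (\<lambda>z. 0)"
    proof
      show "w z * u (x - z) = 0" for z
        using that w(2)[of z] R'[of "x - z"] norm_triangle_sub[of x z] by (cases "R < norm z") auto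
    qed
    then show ?thesis by (simp add: func_convolution_def)
  qed
  then show ?thesis
    using C_k_convolution[OF integrable_lborel_compact_support[OF w] u] unfolding C_c_infinity_iff by blast
qed

subsection \<open>Fourier inversion\<close>

text \<open>Lebesgue measure on a Euclidean space is the image of the product of one-dimensional
  Lebesgue measures. This serves the Gaussian computations and also the integrable majorant in
  \<open>fourier_moment_integrable\<close>.\<close>

lemma
  fixes f :: "'a::euclidean_space \<Rightarrow> real \<Rightarrow> 'b::{real_normed_field, banach, second_countable_topology}"
  assumes f: "\<And>b. b \<in> Basis \<Longrightarrow> integrable lborel (f b)"
  shows integrable_lborel_Basis_prod: "integrable lborel (\<lambda>x. \<Prod>b\<in>Basis. f b (x \<bullet> b))"
    and integral_lborel_Basis_prod:
      "(LINT x|lborel. (\<Prod>b\<in>Basis. f b (x \<bullet> b))) = (\<Prod>b\<in>Basis. LINT t|lborel. f b t)"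
proof -
  interpret product_sigma_finite "\<lambda>_::'a. lborel :: real measure" by standard
  have meas: "f b \<in> borel_measurable borel" if "b \<in> Basis" for b using f[OF that] by simp
  have m: "(\<lambda>x. \<Prod>b\<in>Basis. f b (x \<bullet> b)) \<in> borel_measurable borel"
    by (intro borel_measurable_prod measurable_compose[OF _ meas]) auto
  have eq: "(\<Prod>b\<in>Basis. f b ((\<Sum>b'\<in>Basis. h b' *\<^sub>R b') \<bullet> b)) = (\<Prod>b\<in>Basis. f b (h b))" for h
    by (intro prod.cong) (auto simp: inner_sum_left_Basis)
  show "integrable lborel (\<lambda>x. \<Prod>b\<in>Basis. f b (x \<bullet> b))"
    unfolding lborel_eq[where 'a = 'a] using m f
    by (subst integrable_distr_eq) (auto simp: eq intro!: product_integrable_prod)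
  show "(LINT x|lborel. (\<Prod>b\<in>Basis. f b (x \<bullet> b))) = (\<Prod>b\<in>Basis. LINT t|lborel. f b t)"
    unfolding lborel_eq[where 'a = 'a] using m f
    by (subst integral_distr) (auto simp: eq intro!: product_integral_prod)
qed

section \<open>Gaussian densities and their Fourier transforms\<close>

definition std_gauss :: "'a::euclidean_space \<Rightarrow> real" where
  "std_gauss x = (\<Prod>b\<in>Basis. std_normal_density (x \<bullet> b))"

lemma std_gauss_nonneg: "0 \<le> std_gauss x"
  unfolding std_gauss_def by (intro prod_nonneg) auto

lemma norm_power2_Basis: "(norm (x::'a::euclidean_space))\<^sup>2 = (\<Sum>b\<in>Basis. (x \<bullet> b)\<^sup>2)"
  unfolding power2_norm_eq_inner by (subst euclidean_inner) (simp add: power2_eq_square)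

lemma exp_norm_power2_Basis:
  "exp (- (norm (x::'a::euclidean_space))\<^sup>2 / 2) = (\<Prod>b\<in>Basis. exp (- (x \<bullet> b)\<^sup>2 / 2))"
proof -
  have "- (norm x)\<^sup>2 / 2 = (\<Sum>b\<in>Basis. - (x \<bullet> b)\<^sup>2 / 2)"
    unfolding sum_divide_distrib[symmetric] sum_negf norm_power2_Basis by (rule refl)
  then show ?thesis by (simp only: exp_sum finite_Basis)
qed

lemma std_gauss_eq:
  "std_gauss (x::'a::euclidean_space) = (1 / sqrt (2 * pi)) ^ DIM('a) * exp (- (norm x)\<^sup>2 / 2)"
  unfolding std_gauss_def std_normal_density_def prod.distrib prod_constant exp_norm_power2_Basis ..

lemma measurable_std_gauss [measurable]: "std_gauss \<in> borel_measurable borel"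
  unfolding std_gauss_eq[abs_def] by measurable

lemma integrable_std_gauss: "integrable lborel (std_gauss :: 'a::euclidean_space \<Rightarrow> real)"
  using integrable_lborel_Basis_prod[where 'a = 'a, of "\<lambda>_. std_normal_density"]
  by (simp add: std_gauss_def[abs_def])

lemma integral_std_gauss: "(LINT x|lborel. std_gauss (x::'a::euclidean_space)) = 1"
  using integral_lborel_Basis_prod[where 'a = 'a, of "\<lambda>_. std_normal_density"]
  by (simp add: std_gauss_def[abs_def])

text \<open>With \<open>t\<close> the squared norm, \<open>1 + t \<le> 5 * exp (t / 4)\<close>. The
  factor \<open>exp (- t / 4)\<close> that is left over is, up to the normalising constant, the
  Gaussian evaluated at \<open>sqrt (1 / 2)\<close> times the argument.\<close>

lemma std_gauss_moment:
  "integrable lborel (\<lambda>x::'a::euclidean_space. (1 + (norm x)\<^sup>2) * std_gauss x)"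
proof (rule Bochner_Integration.integrable_bound)
  let ?s = "sqrt (1 / 2)"
  show "integrable lborel (\<lambda>x::'a. 5 * std_gauss (0 + ?s *\<^sub>R x))"
    by (intro integrable_mult_right integrable_lborel_affine integrable_std_gauss) simp
  have "(1 + (norm x)\<^sup>2) * std_gauss x \<le> 5 * std_gauss (0 + ?s *\<^sub>R x)" for x :: 'a
  proof -
    define t where "t = (norm x)\<^sup>2"
    have "t \<ge> 0" by (simp add: t_def)
    have "1 + t \<le> 5 * exp (t / 4)" using exp_ge_add_one_self[of "t / 4"] \<open>t \<ge> 0\<close> by linarith
    then have "(1 + t) * exp (- t / 2) \<le> 5 * exp (t / 4) * exp (- t / 2)" by (intro mult_right_mono) auto
    also have "\<dots> = 5 * exp (- (norm (?s *\<^sub>R x))\<^sup>2 / 2)"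
      by (simp add: t_def power_mult_distrib flip: exp_add)
    finally have "(1 / sqrt (2 * pi)) ^ DIM('a) * ((1 + t) * exp (- t / 2)) \<le>
        (1 / sqrt (2 * pi)) ^ DIM('a) * (5 * exp (- (norm (?s *\<^sub>R x))\<^sup>2 / 2))"
      by (intro mult_left_mono) auto
    then show ?thesis unfolding std_gauss_eq t_def add_0_left by (simp only: mult_ac)
  qed
  then show "AE x in lborel. norm ((1 + (norm x)\<^sup>2) * std_gauss x) \<le> norm (5 * std_gauss (0 + ?s *\<^sub>R (x::'a)))"
    by (intro AE_I2) (simp add: abs_mult std_gauss_nonneg)
qed simp

text \<open>Exponential and density both factor over the basis, which leaves the characteristic
  function of the one-dimensional standard normal law.\<close>

lemma fourier_std_gauss:
  fixes u :: "'a::euclidean_space"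
  shows "(LINT x|lborel. exp (\<i> * of_real (u \<bullet> x)) * of_real (std_gauss x)) = complex_of_real (exp (- (norm u)\<^sup>2 / 2))"
proof -
  let ?f = "\<lambda>b t. exp (\<i> * of_real (u \<bullet> b * t)) * complex_of_real (std_normal_density t)"
  have char: "(LINT t|lborel. exp (\<i> * of_real (s * t)) * complex_of_real (std_normal_density t)) =
      complex_of_real (exp (- s\<^sup>2 / 2))" for s
  proof -
    have "(LINT t|lborel. exp (\<i> * of_real (s * t)) * complex_of_real (std_normal_density t)) =
        char std_normal_distribution s"
      unfolding char_def by (subst integral_density) (auto simp: scaleR_conv_of_real mult.commute)
    then show ?thesis by (simp add: char_std_normal_distribution)
  qed
  have int: "integrable lborel (?f b)" for b
  proof (rule Bochner_Integration.integrable_bound)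
    show "integrable lborel std_normal_density" by simp
  qed (auto simp: norm_mult)
  have "exp (\<i> * of_real (u \<bullet> x)) * of_real (std_gauss x) = (\<Prod>b\<in>Basis. ?f b (x \<bullet> b))" for x
  proof -
    have "u \<bullet> x = (\<Sum>b\<in>Basis. (u \<bullet> b) * (x \<bullet> b))" by (rule euclidean_inner)
    then show ?thesis
      by (simp add: std_gauss_def prod.distrib exp_sum sum_distrib_left)
  qed
  then have "(LINT x|lborel. exp (\<i> * of_real (u \<bullet> x)) * of_real (std_gauss x)) =
      (\<Prod>b\<in>Basis. complex_of_real (exp (- (u \<bullet> b)\<^sup>2 / 2)))"
    using integral_lborel_Basis_prod[of ?f, OF int] by (simp only: char)
  also have "\<dots> = complex_of_real (exp (- (norm u)\<^sup>2 / 2))"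
    unfolding exp_norm_power2_Basis by (rule of_real_prod[symmetric])
  finally show ?thesis .
qed

lemma fourier_scaled_gauss:
  fixes y :: "real^'n::finite"
  assumes s: "s > 0"
  shows "(LINT \<xi>|lborel. exp (\<i> * of_real (y \<bullet> \<xi>)) * of_real (exp (- (norm (s *\<^sub>R \<xi>))\<^sup>2 / 2))) =
    complex_of_real ((2 * pi) ^ CARD('n) * std_gauss (y /\<^sub>R s) / s ^ CARD('n))"
proof -
  define a where "a = (1 / sqrt (2 * pi)) ^ CARD('n)"
  let ?F = "\<lambda>\<xi>. exp (\<i> * of_real ((y /\<^sub>R s) \<bullet> \<xi>)) * complex_of_real (std_gauss \<xi>)"
  define J where "J = (LINT \<xi>|lborel. ?F (0 + s *\<^sub>R \<xi>))"
  have gauss: "std_gauss v = a * exp (- (norm v)\<^sup>2 / 2)" for v :: "real^'n"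
    by (simp add: std_gauss_eq a_def)
  have "(1 / sqrt (2 * pi))\<^sup>2 * (2 * pi) = 1" by (simp add: power_divide)
  moreover have "a\<^sup>2 * (2 * pi) ^ CARD('n) = ((1 / sqrt (2 * pi))\<^sup>2 * (2 * pi)) ^ CARD('n)"
    unfolding a_def by (simp only: power_mult_distrib power_mult[symmetric] mult_ac)
  ultimately have a: "a\<^sup>2 * (2 * pi) ^ CARD('n) = 1" by simp
  have a0: "a \<noteq> 0" by (simp add: a_def)
  define T where "T = (2 * pi) ^ CARD('n)"
  \<comment> \<open>Here \<open>a\<close> is the normalising constant of the Gaussian, the power
    \<open>- CARD('n) / 2\<close> of \<open>2 * pi\<close>. The identity turns a division by
    \<open>a\<close> into the factor \<open>T\<close> together with the constant that completes
    \<open>std_gauss\<close>.\<close>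
  have inv: "inverse a = T * a"
    using a a0 unfolding T_def[symmetric] by (simp add: power2_eq_square inverse_unique mult_ac)
  have ip: "(y /\<^sub>R s) \<bullet> (0 + s *\<^sub>R \<xi>) = y \<bullet> \<xi>" for \<xi> using s by simp
  have "exp (\<i> * of_real (y \<bullet> \<xi>)) * of_real (exp (- (norm (s *\<^sub>R \<xi>))\<^sup>2 / 2)) = of_real (inverse a) * ?F (0 + s *\<^sub>R \<xi>)" for \<xi>
    unfolding ip gauss using a0 by simp
  then have "(LINT \<xi>|lborel. exp (\<i> * of_real (y \<bullet> \<xi>)) * of_real (exp (- (norm (s *\<^sub>R \<xi>))\<^sup>2 / 2))) =
      of_real (inverse a) * J"
    unfolding J_def by (simp only: integral_mult_right_zero)
  moreover have "J = of_real (exp (- (norm (y /\<^sub>R s))\<^sup>2 / 2)) / of_real (s ^ CARD('n))"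
  proof -
    have "(LINT \<xi>|lborel. ?F \<xi>) = \<bar>s\<bar> ^ DIM(real^'n) *\<^sub>R J"
      unfolding J_def by (rule integral_lborel_affine) (use s in auto)
    then have "of_real (exp (- (norm (y /\<^sub>R s))\<^sup>2 / 2)) = of_real (s ^ CARD('n)) * J"
      unfolding fourier_std_gauss using s by (simp add: scaleR_conv_of_real)
    moreover have "complex_of_real (s ^ CARD('n)) \<noteq> 0" using s by simp
    ultimately show ?thesis by (simp only: nonzero_mult_div_cancel_left not_False_eq_True)
  qed
  moreover have "inverse a * (exp (- (norm (y /\<^sub>R s))\<^sup>2 / 2) / s ^ CARD('n)) = T * std_gauss (y /\<^sub>R s) / s ^ CARD('n)"
    unfolding inv gauss by simp
  ultimately show ?thesis
    unfolding T_def[symmetric] by (simp only: of_real_mult[symmetric] of_real_divide[symmetric])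
qed

section \<open>The Fourier transform: inversion, derivatives, decay\<close>

lemma fourier_measurable [measurable]:
  assumes [measurable]: "f \<in> borel_measurable borel"
  shows "fourier f \<in> borel_measurable borel"
  unfolding fourier_def by measurable

lemma norm_iexp_mult [simp]: "norm (exp (\<i> * complex_of_real t) * z) = norm z"
  "norm (exp (- (\<i> * complex_of_real t)) * z) = norm z"
  by (simp_all add: norm_mult)

lemma integrable_fourier_kernel:
  assumes "integrable lborel f"
  shows "integrable lborel (\<lambda>x. exp (- \<i> * complex_of_real (x \<bullet> \<xi>)) * of_real (f x))"
  by (rule Bochner_Integration.integrable_bound[OF assms]) (use assms in auto)

lemma norm_fourier_le:
  fixes f :: "real^'n::finite \<Rightarrow> real"
  shows "norm (fourier f \<xi>) \<le> (LINT x|lborel. \<bar>f x\<bar>) / (2 * pi) ^ CARD('n)"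
proof -
  have "norm (LINT x|lborel. exp (- \<i> * complex_of_real (x \<bullet> \<xi>)) * of_real (f x)) \<le>
      (LINT x|lborel. norm (exp (- \<i> * complex_of_real (x \<bullet> \<xi>)) * of_real (f x)))"
    by (rule integral_norm_bound)
  moreover have "norm (complex_of_real ((2 * pi) ^ CARD('n))) = (2 * pi) ^ CARD('n)"
    by (simp only: norm_of_real) simp
  ultimately show ?thesis
    unfolding fourier_def norm_divide by (auto simp: divide_right_mono)
qed

text \<open>The inversion integral cannot be treated by Fubini directly, since its double integral
  does not converge absolutely. A Gaussian factor of width governed by \<open>s\<close> is inserted
  and removed at the end by letting \<open>s\<close> tend to 0.\<close>

theorem fourier_inversion:
  fixes g :: "real^'n::finite \<Rightarrow> real"
  assumes g: "integrable lborel g" and cont: "continuous_on UNIV g" and B: "\<And>x. \<bar>g x\<bar> \<le> B"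
    and ft: "integrable lborel (fourier g)"
  shows "(LINT \<xi>|lborel. exp (\<i> * of_real (x \<bullet> \<xi>)) * fourier g \<xi>) = of_real (g x)"
proof -
  have [measurable]: "g \<in> borel_measurable borel" using g by simp
  let ?I = "\<lambda>s. LINT \<xi>|lborel. exp (\<i> * of_real (x \<bullet> \<xi>)) * fourier g \<xi> * of_real (exp (- (norm (s *\<^sub>R \<xi>))\<^sup>2 / 2))"
  \<comment> \<open>For fixed \<open>s\<close>, Fubini and \<open>fourier_scaled_gauss\<close> turn
    the regularised integral into a Gaussian average of \<open>g\<close> around \<open>x\<close> at
    scale \<open>s\<close>.\<close>
  have I: "?I s = of_real (LINT u|lborel. g (x - s *\<^sub>R u) * std_gauss u)" if s: "s > 0" for s
  proof -
    define K where "K \<xi> z = exp (\<i> * of_real ((x - z) \<bullet> \<xi>)) * of_real (exp (- (norm (s *\<^sub>R \<xi>))\<^sup>2 / 2)) * of_real (g z)"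
      for \<xi> z :: "real^'n"
    have [measurable]: "(\<lambda>(\<xi>, z). K \<xi> z) \<in> borel_measurable (borel \<Otimes>\<^sub>M borel)"
      unfolding K_def by measurable
    have gauss_int: "integrable lborel (\<lambda>\<xi>::real^'n. exp (- (norm (s *\<^sub>R \<xi>))\<^sup>2 / 2))"
    proof -
      have "integrable lborel (\<lambda>\<xi>::real^'n. std_gauss (0 + s *\<^sub>R \<xi>))"
        using integrable_lborel_affine[OF integrable_std_gauss, of s 0] s by simp
      then show ?thesis by (simp add: std_gauss_eq)
    qed
    have int: "integrable (lborel \<Otimes>\<^sub>M lborel) (\<lambda>(\<xi>, z). K \<xi> z)"
    proof (rule lborel_pair.Fubini_integrable)
      have "(LINT z|lborel. norm (K \<xi> z)) = exp (- (norm (s *\<^sub>R \<xi>))\<^sup>2 / 2) * (LINT z|lborel. \<bar>g z\<bar>)" for \<xi>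
        by (simp add: K_def norm_mult)
      then show "integrable lborel (\<lambda>\<xi>. LINT z|lborel. norm ((\<lambda>(\<xi>, z). K \<xi> z) (\<xi>, z)))"
        using gauss_int by simp
      show "AE \<xi> in lborel. integrable lborel (\<lambda>z. (\<lambda>(\<xi>, z). K \<xi> z) (\<xi>, z))"
      proof (intro AE_I2)
        show "integrable lborel (\<lambda>z. (\<lambda>(\<xi>, z). K \<xi> z) (\<xi>, z))" for \<xi>
          by (rule Bochner_Integration.integrable_bound[OF g])
            (auto simp: K_def norm_mult intro!: AE_I2 mult_left_le_one_le)
      qed
    qed measurable
    have "exp (\<i> * of_real (x \<bullet> \<xi>)) * fourier g \<xi> * of_real (exp (- (norm (s *\<^sub>R \<xi>))\<^sup>2 / 2)) =
        (LINT z|lborel. K \<xi> z) / of_real ((2 * pi) ^ CARD('n))" for \<xi>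
    proof -
      have "K \<xi> z = (exp (\<i> * of_real (x \<bullet> \<xi>)) * of_real (exp (- (norm (s *\<^sub>R \<xi>))\<^sup>2 / 2))) *
          (exp (- \<i> * of_real (z \<bullet> \<xi>)) * of_real (g z))" for z
      proof -
        have "exp (\<i> * of_real ((x - z) \<bullet> \<xi>)) = exp (\<i> * of_real (x \<bullet> \<xi>)) * exp (- \<i> * of_real (z \<bullet> \<xi>))"
          by (simp add: inner_diff_left right_diff_distrib flip: exp_add)
        then show ?thesis by (simp only: K_def mult_ac)
      qed
      then have "(LINT z|lborel. K \<xi> z) = (exp (\<i> * of_real (x \<bullet> \<xi>)) * of_real (exp (- (norm (s *\<^sub>R \<xi>))\<^sup>2 / 2))) *
          (LINT z|lborel. exp (- \<i> * of_real (z \<bullet> \<xi>)) * of_real (g z))"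
        by (simp only: integral_mult_right_zero)
      then show ?thesis
        by (simp only: fourier_def times_divide_eq_left times_divide_eq_right mult_ac)
    qed
    then have "?I s = (LINT \<xi>|lborel. LINT z|lborel. K \<xi> z) / of_real ((2 * pi) ^ CARD('n))"
      by (simp only: integral_divide_zero)
    also have "(LINT \<xi>|lborel. LINT z|lborel. K \<xi> z) = (LINT z|lborel. LINT \<xi>|lborel. K \<xi> z)"
      using lborel_pair.Fubini_integral[OF int] by simp
    also have "\<dots> / of_real ((2 * pi) ^ CARD('n)) =
        (LINT z|lborel. (LINT \<xi>|lborel. K \<xi> z) / of_real ((2 * pi) ^ CARD('n)))"
      by (rule integral_divide_zero[symmetric])
    also have "\<dots> = (LINT z|lborel. of_real (g z * std_gauss ((x - z) /\<^sub>R s) / s ^ CARD('n)))"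
    proof (intro Bochner_Integration.integral_cong refl)
      fix z
      define T where "T = (2 * pi) ^ CARD('n)"
      have "T \<noteq> 0" by (simp add: T_def)
      have "(LINT \<xi>|lborel. K \<xi> z) = of_real (T * std_gauss ((x - z) /\<^sub>R s) / s ^ CARD('n)) * of_real (g z)"
        unfolding K_def T_def fourier_scaled_gauss[OF s, symmetric] by (rule integral_mult_left_zero)
      then have "(LINT \<xi>|lborel. K \<xi> z) = of_real T * of_real (g z * std_gauss ((x - z) /\<^sub>R s) / s ^ CARD('n))"
        by simp
      then show "(LINT \<xi>|lborel. K \<xi> z) / of_real ((2 * pi) ^ CARD('n)) = of_real (g z * std_gauss ((x - z) /\<^sub>R s) / s ^ CARD('n))"
        unfolding T_def[symmetric] using \<open>T \<noteq> 0\<close> by (simp only: nonzero_mult_div_cancel_left of_real_eq_0_iff not_False_eq_True)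
    qed
    also have "\<dots> = of_real (LINT z|lborel. g z * std_gauss ((x - z) /\<^sub>R s) / s ^ CARD('n))"
      by (rule integral_complex_of_real)
    \<comment> \<open>Substitution of \<open>x - s *\<^sub>R u\<close> for \<open>z\<close>: the
      Jacobian cancels the power of \<open>s\<close> in the denominator.\<close>
    also have "(LINT z|lborel. g z * std_gauss ((x - z) /\<^sub>R s) / s ^ CARD('n)) =
        \<bar>- s\<bar> ^ DIM(real^'n) *\<^sub>R (LINT u|lborel. g (x + (- s) *\<^sub>R u) * std_gauss ((x - (x + (- s) *\<^sub>R u)) /\<^sub>R s) / s ^ CARD('n))"
      by (rule integral_lborel_affine[of "\<lambda>z. g z * std_gauss ((x - z) /\<^sub>R s) / s ^ CARD('n)" "- s" x])
        (measurable, use s in simp)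
    also have "\<dots> = (LINT u|lborel. g (x - s *\<^sub>R u) * std_gauss u)"
    proof -
      have "(x - (x + (- s) *\<^sub>R u)) /\<^sub>R s = u" for u using s by simp
      then show ?thesis using s by simp
    qed
    finally show ?thesis .
  qed
  \<comment> \<open>Both sides are passed to the limit along \<open>s = 1 / (n + 1)\<close>: one by
    integrability of the transform, the other by continuity and boundedness of
    \<open>g\<close>.\<close>
  have s0: "(\<lambda>n. inverse (real (Suc n))) \<longlonglongrightarrow> 0" by (rule LIMSEQ_inverse_real_of_nat)
  have "(\<lambda>n. ?I (inverse (real (Suc n)))) \<longlonglongrightarrow> (LINT \<xi>|lborel. exp (\<i> * of_real (x \<bullet> \<xi>)) * fourier g \<xi>)"
  proof (rule integral_dominated_convergence[where w = "\<lambda>\<xi>. norm (fourier g \<xi>)"])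
    show "AE \<xi> in lborel. (\<lambda>n. exp (\<i> * of_real (x \<bullet> \<xi>)) * fourier g \<xi> * of_real (exp (- (norm (inverse (real (Suc n)) *\<^sub>R \<xi>))\<^sup>2 / 2)))
        \<longlonglongrightarrow> exp (\<i> * of_real (x \<bullet> \<xi>)) * fourier g \<xi>"
    proof (intro AE_I2)
      fix \<xi> :: "real^'n"
      have "(\<lambda>n. exp (\<i> * of_real (x \<bullet> \<xi>)) * fourier g \<xi> * of_real (exp (- (norm (inverse (real (Suc n)) *\<^sub>R \<xi>))\<^sup>2 / 2)))
        \<longlonglongrightarrow> exp (\<i> * of_real (x \<bullet> \<xi>)) * fourier g \<xi> * of_real (exp (- (norm (0 *\<^sub>R \<xi>))\<^sup>2 / 2))"
        by (intro tendsto_intros s0) auto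
      then show "(\<lambda>n. exp (\<i> * of_real (x \<bullet> \<xi>)) * fourier g \<xi> * of_real (exp (- (norm (inverse (real (Suc n)) *\<^sub>R \<xi>))\<^sup>2 / 2)))
        \<longlonglongrightarrow> exp (\<i> * of_real (x \<bullet> \<xi>)) * fourier g \<xi>" by simp
    qed
    show "AE \<xi> in lborel. norm (exp (\<i> * of_real (x \<bullet> \<xi>)) * fourier g \<xi> * of_real (exp (- (norm (inverse (real (Suc n)) *\<^sub>R \<xi>))\<^sup>2 / 2))) \<le> norm (fourier g \<xi>)" for n
      by (intro AE_I2) (simp only: mult.assoc norm_iexp_mult, auto simp: norm_mult intro: mult_right_le_one_le)
  qed (use ft in auto)
  moreover have "(\<lambda>n. complex_of_real (LINT u|lborel. g (x - inverse (real (Suc n)) *\<^sub>R u) * std_gauss u)) \<longlonglongrightarrow>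
      of_real (LINT u|lborel. g x * std_gauss (u::real^'n))"
  proof (rule tendsto_of_real, rule integral_dominated_convergence[where w = "\<lambda>u. B * std_gauss u"])
    show "AE u in lborel. (\<lambda>n. g (x - inverse (real (Suc n)) *\<^sub>R u) * std_gauss u) \<longlonglongrightarrow> g x * std_gauss u"
    proof (intro AE_I2 tendsto_mult tendsto_const)
      fix u :: "real^'n"
      have "(\<lambda>n. x - inverse (real (Suc n)) *\<^sub>R u) \<longlonglongrightarrow> x - 0 *\<^sub>R u" by (intro tendsto_intros s0)
      moreover have "isCont g (x - 0 *\<^sub>R u)" using cont by (simp add: continuous_on_eq_continuous_at)
      ultimately show "(\<lambda>n. g (x - inverse (real (Suc n)) *\<^sub>R u)) \<longlonglongrightarrow> g x"
        using isCont_tendsto_compose by fastforce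
    qed
    show "AE u in lborel. norm (g (x - inverse (real (Suc n)) *\<^sub>R u) * std_gauss u) \<le> B * std_gauss u" for n
      by (intro AE_I2) (simp add: abs_mult std_gauss_nonneg mult_right_mono B)
  qed (use integrable_std_gauss in auto)
  moreover have "?I (inverse (real (Suc n))) = of_real (LINT u|lborel. g (x - inverse (real (Suc n)) *\<^sub>R u) * std_gauss u)" for n
    by (rule I) simp
  ultimately show ?thesis
    using LIMSEQ_unique by (fastforce simp: integral_std_gauss)
qed

text \<open>Translation invariance replaces integration by parts: the transform of a difference
  quotient of \<open>g\<close> is the transform of \<open>g\<close> times a difference quotient of
  an exponential, and both sides converge as the step tends to 0.\<close>

lemma fourier_partial_deriv:
  fixes g :: "real^'n::finite \<Rightarrow> real"
  assumes g: "g \<in> C_c_infinity"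
  shows "fourier (partial_deriv j g) \<xi> = \<i> * of_real (\<xi> $ j) * fourier g \<xi>"
proof -
  note cont = C_c_infinity_continuous[OF g]
  have pd: "partial_differentiable j g" and pdg: "partial_deriv j g \<in> C_c_infinity"
    using C_c_infinity_partial_deriv[OF g] by auto
  obtain B where B: "\<And>x. \<bar>partial_deriv j g x\<bar> \<le> B"
    using C_zero_bounded[OF C_c_infinity_C_zero[OF pdg]] by blast
  obtain R where R: "\<And>x. R < norm x \<Longrightarrow> g x = 0" using g by (auto simp: C_c_infinity_iff)
  have [measurable]: "g \<in> borel_measurable borel" "partial_deriv j g \<in> borel_measurable borel"
    using cont C_c_infinity_continuous[OF pdg] borel_measurable_continuous_onI by auto
  have int_g: "integrable lborel g" by (rule integrable_lborel_compact_support[OF cont R])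
  define F where "F = (LINT z|lborel. exp (- \<i> * of_real (z \<bullet> \<xi>)) * complex_of_real (g z))"
  let ?h = "\<lambda>n. inverse (real (Suc n))"
  let ?q = "\<lambda>n z. (g (z + ?h n *\<^sub>R axis j 1) - g z) / ?h n"
  have shift: "(LINT z|lborel. exp (- \<i> * of_real (z \<bullet> \<xi>)) * complex_of_real (?q n z)) =
      (exp (\<i> * of_real (?h n * \<xi> $ j)) - 1) / of_real (?h n) * F" for n
  proof -
    let ?e = "?h n *\<^sub>R axis j 1 :: real^'n"
    have int': "integrable lborel (\<lambda>z. g (z + ?e))"
      using integrable_lborel_affine[OF int_g, of 1 ?e] by (simp add: add.commute)
    have "F = (LINT z|lborel. exp (- \<i> * of_real ((?e + z) \<bullet> \<xi>)) * complex_of_real (g (?e + z)))"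
      unfolding F_def by (subst integral_lborel_affine[where c = 1 and t = ?e]) auto
    also have "\<dots> = (LINT z|lborel. exp (- \<i> * of_real (?h n * \<xi> $ j)) * (exp (- \<i> * of_real (z \<bullet> \<xi>)) * complex_of_real (g (z + ?e))))"
      by (intro Bochner_Integration.integral_cong)
        (auto simp: inner_add_left inner_axis' algebra_simps exp_add exp_diff exp_minus divide_inverse)
    also have "\<dots> = exp (- \<i> * of_real (?h n * \<xi> $ j)) * (LINT z|lborel. exp (- \<i> * of_real (z \<bullet> \<xi>)) * complex_of_real (g (z + ?e)))"
      by (rule integral_mult_right_zero)
    finally have "(LINT z|lborel. exp (- \<i> * of_real (z \<bullet> \<xi>)) * complex_of_real (g (z + ?e))) =
        exp (\<i> * of_real (?h n * \<xi> $ j)) * F"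
      by (simp add: exp_minus field_simps)
    moreover have "(LINT z|lborel. exp (- \<i> * of_real (z \<bullet> \<xi>)) * complex_of_real (?q n z)) =
       (LINT z|lborel. (exp (- \<i> * of_real (z \<bullet> \<xi>)) * complex_of_real (g (z + ?e)) - exp (- \<i> * of_real (z \<bullet> \<xi>)) * complex_of_real (g z)) / of_real (?h n))"
      by (intro Bochner_Integration.integral_cong) (auto simp: algebra_simps diff_divide_distrib)
    moreover have "\<dots> = ((LINT z|lborel. exp (- \<i> * of_real (z \<bullet> \<xi>)) * complex_of_real (g (z + ?e))) - F) / of_real (?h n)"
      unfolding F_def
      by (subst Bochner_Integration.integral_diff[symmetric])
        (use int' int_g integrable_fourier_kernel in \<open>auto simp del: of_real_inverse\<close>)
    ultimately show ?thesis by (simp add: algebra_simps diff_divide_distrib)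
  qed
  have h0: "?h \<longlonglongrightarrow> 0" by (rule LIMSEQ_inverse_real_of_nat)
  have "(\<lambda>n. LINT z|lborel. exp (- \<i> * of_real (z \<bullet> \<xi>)) * complex_of_real (?q n z))
      \<longlonglongrightarrow> (LINT z|lborel. exp (- \<i> * of_real (z \<bullet> \<xi>)) * complex_of_real (partial_deriv j g z))"
  \<comment> \<open>The steps are at most 1, so every difference quotient vanishes outside radius
    \<open>R + 1\<close>. Inside, the mean value theorem bounds it by \<open>B\<close>.\<close>
  proof (rule integral_dominated_convergence[where w = "\<lambda>z. B * indicator (cball 0 (R + 1)) z"])
    show "integrable lborel (\<lambda>z::real^'n. B * indicator (cball 0 (R + 1)) z)"
      by (intro integrable_mult_right integrable_real_indicator) (auto intro: emeasure_lborel_cball_finite[unfolded infinity_ennreal_def])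
    have q: "\<bar>?q n z\<bar> \<le> B" for n z
    proof -
      have "norm (g (z + ?h n *\<^sub>R axis j 1) - g (z + 0 *\<^sub>R axis j 1)) \<le> B * norm (?h n - 0)"
        by (rule field_differentiable_bound[where S = UNIV])
          (use partial_deriv_has_derivative[OF pd] B in auto)
      then show ?thesis by (simp add: divide_le_eq abs_mult)
    qed
    have q0: "?q n z = 0" if "R + 1 < norm z" for n z
    proof -
      have "norm (z + ?h n *\<^sub>R axis j 1) \<ge> norm z - norm (?h n *\<^sub>R axis j 1 :: real^'n)"
        by (metis norm_diff_ineq)
      moreover have "?h n \<le> 1" by (simp add: inverse_le_1_iff)
      ultimately have "R < norm (z + ?h n *\<^sub>R axis j 1)" using that by simp
      then show ?thesis using R that by simp
    qed
    show "AE z in lborel. norm (exp (- \<i> * of_real (z \<bullet> \<xi>)) * complex_of_real (?q n z)) \<le> B * indicator (cball 0 (R + 1)) z" for n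
    proof (intro AE_I2)
      fix z
      have "\<bar>?q n z\<bar> \<le> B * indicator (cball 0 (R + 1)) z"
        using q[where n = n and z = z] q0[where n = n and z = z] by (auto simp: indicator_def not_le)
      then show "norm (exp (- \<i> * of_real (z \<bullet> \<xi>)) * complex_of_real (?q n z)) \<le> B * indicator (cball 0 (R + 1)) z"
        by (simp only: mult_minus_left norm_iexp_mult norm_of_real)
    qed
    have "(\<lambda>n. ?q n z) \<longlonglongrightarrow> partial_deriv j g z" for z
    proof -
      have "\<forall>i. ?h i \<in> UNIV - {0}" by auto
      with partial_deriv_at_0[OF pd, of z] h0 show ?thesis
        unfolding DERIV_def tendsto_at_iff_sequentially o_def by auto
    qed
    then show "AE z in lborel. (\<lambda>n. exp (- \<i> * of_real (z \<bullet> \<xi>)) * complex_of_real (?q n z))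
        \<longlonglongrightarrow> exp (- \<i> * of_real (z \<bullet> \<xi>)) * complex_of_real (partial_deriv j g z)"
      by (intro AE_I2 tendsto_mult tendsto_const tendsto_of_real)
  qed auto
  moreover have "(\<lambda>n. (exp (\<i> * of_real (?h n * \<xi> $ j)) - 1) / of_real (?h n) * F) \<longlonglongrightarrow> \<i> * of_real (\<xi> $ j) * F"
  proof (rule tendsto_mult[OF _ tendsto_const])
    have "((\<lambda>z. exp (\<i> * z * of_real (\<xi> $ j))) has_field_derivative \<i> * of_real (\<xi> $ j)) (at 0)"
      by (auto intro!: derivative_eq_intros)
    moreover have "\<forall>n. complex_of_real (?h n) \<in> UNIV - {0}"
      by (simp only: of_real_eq_0_iff Diff_iff UNIV_I singleton_iff) simp
    moreover have "(\<lambda>n. complex_of_real (?h n)) \<longlonglongrightarrow> 0" using tendsto_of_real[OF h0] by (simp only: of_real_0)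
    ultimately show "(\<lambda>n. (exp (\<i> * of_real (?h n * \<xi> $ j)) - 1) / of_real (?h n)) \<longlonglongrightarrow> \<i> * of_real (\<xi> $ j)"
      unfolding DERIV_def tendsto_at_iff_sequentially o_def by (auto simp: mult.assoc)
  qed
  ultimately have "(LINT z|lborel. exp (- \<i> * of_real (z \<bullet> \<xi>)) * complex_of_real (partial_deriv j g z)) = \<i> * of_real (\<xi> $ j) * F"
    unfolding shift using LIMSEQ_unique by blast
  then show ?thesis by (simp add: fourier_def F_def)
qed

text \<open>In absolute value, the transform of the second derivative in direction \<open>j\<close>
  is the transform of \<open>g\<close> times the square of the \<open>j\<close>-th frequency.
  Summing over \<open>j\<close> trades one factor of \<open>1 + (norm \<xi>)\<^sup>2\<close> for
  test functions of the same kind, so \<open>g\<close> is arbitrary in the induction.\<close>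

lemma fourier_rapid_decay:
  fixes g :: "real^'n::finite \<Rightarrow> real"
  assumes "g \<in> C_c_infinity"
  shows "\<exists>C. \<forall>\<xi>. (1 + (norm \<xi>)\<^sup>2) ^ N * norm (fourier g \<xi>) \<le> C"
  using assms
proof (induction N arbitrary: g)
  case 0
  then show ?case using norm_fourier_le by auto
next
  case (Suc N)
  have "\<forall>j. \<exists>C. \<forall>\<xi>. (1 + (norm \<xi>)\<^sup>2) ^ N * norm (fourier (partial_deriv j (partial_deriv j g)) \<xi>) \<le> C"
    using Suc C_c_infinity_partial_deriv(1) by blast
  then obtain C where C: "\<And>j \<xi>. (1 + (norm \<xi>)\<^sup>2) ^ N * norm (fourier (partial_deriv j (partial_deriv j g)) \<xi>) \<le> C j"
    by metis
  obtain C0 where C0: "\<And>\<xi>. (1 + (norm \<xi>)\<^sup>2) ^ N * norm (fourier g \<xi>) \<le> C0"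
    using Suc by blast
  have "(1 + (norm \<xi>)\<^sup>2) ^ Suc N * norm (fourier g \<xi>) \<le> C0 + (\<Sum>j\<in>UNIV. C j)" for \<xi>
  proof -
    have "norm (fourier (partial_deriv j (partial_deriv j g)) \<xi>) = (\<xi> $ j)\<^sup>2 * norm (fourier g \<xi>)" for j
      by (simp add: fourier_partial_deriv[OF C_c_infinity_partial_deriv(1)[OF Suc.prems]]
          fourier_partial_deriv[OF Suc.prems] norm_mult power2_eq_square flip: abs_mult)
    moreover have "(norm \<xi>)\<^sup>2 = (\<Sum>j\<in>UNIV. (\<xi> $ j)\<^sup>2)"
      unfolding power2_norm_eq_inner by (simp add: inner_vec_def power2_eq_square)
    ultimately have "(1 + (norm \<xi>)\<^sup>2) ^ Suc N * norm (fourier g \<xi>) =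
        (1 + (norm \<xi>)\<^sup>2) ^ N * norm (fourier g \<xi>) +
        (\<Sum>j\<in>UNIV. (1 + (norm \<xi>)\<^sup>2) ^ N * norm (fourier (partial_deriv j (partial_deriv j g)) \<xi>))"
      by (simp add: algebra_simps sum_distrib_left sum_distrib_right)
    also have "\<dots> \<le> C0 + (\<Sum>j\<in>UNIV. C j)"
      by (intro add_mono sum_mono C C0)
    finally show ?thesis .
  qed
  then show ?case by blast
qed

text \<open>The weight is the quadratic growth of the Levy-Khinchin kernel in the frequency. Decay
  of order \<open>DIM + 1\<close> is used: one factor cancels the weight, and the others dominate
  the product of the \<open>1 + (\<xi> \<bullet> b)\<^sup>2\<close>, whose reciprocal is integrable
  coordinate by coordinate.\<close>

lemma fourier_moment_integrable:
  fixes g :: "real^'n::finite \<Rightarrow> real"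
  assumes g: "g \<in> C_c_infinity"
  shows "integrable lborel (\<lambda>\<xi>. (1 + (norm \<xi>)\<^sup>2) * norm (fourier g \<xi>))"
proof -
  let ?P = "\<lambda>\<xi>::real^'n. \<Prod>b\<in>Basis. inverse (1 + (\<xi> \<bullet> b)\<^sup>2)"
  have [measurable]: "g \<in> borel_measurable borel"
    using C_c_infinity_continuous[OF g] borel_measurable_continuous_onI by auto
  obtain C where C: "\<And>\<xi>. (1 + (norm \<xi>)\<^sup>2) ^ Suc DIM(real^'n) * norm (fourier g \<xi>) \<le> C"
    using fourier_rapid_decay[OF g] by blast
  have "integrable lborel (\<lambda>t::real. inverse (1 + t\<^sup>2))"
    using integrable_inverse_1_plus_square by (simp add: set_integrable_def)
  then have "integrable lborel (\<lambda>\<xi>. C * ?P \<xi>)"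
    by (intro integrable_mult_right integrable_lborel_Basis_prod)
  then show ?thesis
  proof (rule Bochner_Integration.integrable_bound)
    have "(1 + (norm \<xi>)\<^sup>2) * norm (fourier g \<xi>) \<le> C * ?P \<xi>" for \<xi>
    proof -
      have pos: "0 < (\<Prod>b\<in>Basis. 1 + (\<xi> \<bullet> b)\<^sup>2)" by (intro prod_pos) (auto intro: add_pos_nonneg)
      have "(\<Prod>b\<in>Basis. 1 + (\<xi> \<bullet> b)\<^sup>2) \<le> (\<Prod>b\<in>(Basis::(real^'n) set). 1 + (norm \<xi>)\<^sup>2)"
        by (intro prod_mono conjI add_left_mono) (auto simp: Basis_le_norm simp flip: abs_le_square_iff)
      then have "(\<Prod>b\<in>Basis. 1 + (\<xi> \<bullet> b)\<^sup>2) * ((1 + (norm \<xi>)\<^sup>2) * norm (fourier g \<xi>)) \<le> 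
          (1 + (norm \<xi>)\<^sup>2) ^ DIM(real^'n) * ((1 + (norm \<xi>)\<^sup>2) * norm (fourier g \<xi>))"
        by (intro mult_right_mono) (auto simp del: DIM_cart)
      also have "\<dots> \<le> C" using C[of \<xi>] by (simp only: power_Suc mult_ac)
      finally have "(1 + (norm \<xi>)\<^sup>2) * norm (fourier g \<xi>) \<le> C / (\<Prod>b\<in>Basis. 1 + (\<xi> \<bullet> b)\<^sup>2)"
        using pos by (simp add: pos_le_divide_eq mult.commute)
      then show ?thesis by (simp add: divide_inverse prod_inversef[symmetric] o_def)
    qed
    then show "AE \<xi> in lborel. norm ((1 + (norm \<xi>)\<^sup>2) * norm (fourier g \<xi>)) \<le> norm (C * ?P \<xi>)"
      by (intro AE_I2) (smt (verit) real_norm_def norm_ge_zero zero_le_power2 mult_nonneg_nonneg)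
  qed auto
qed

lemma C_c_infinity_integrable: "f \<in> C_c_infinity \<Longrightarrow> integrable lborel f"
  using integrable_lborel_compact_support C_c_infinity_continuous unfolding C_c_infinity_iff by blast

lemma C_c_infinity_fourier_integrable:
  fixes g :: "real^'n::finite \<Rightarrow> real"
  assumes g: "g \<in> C_c_infinity"
  shows "integrable lborel (\<lambda>\<xi>. exp (\<i> * of_real (x \<bullet> \<xi>)) * fourier g \<xi>)"
proof (rule Bochner_Integration.integrable_bound[OF fourier_moment_integrable[OF g]])
  have [measurable]: "g \<in> borel_measurable borel" using C_c_infinity_integrable[OF g] by simp
  show "(\<lambda>\<xi>. exp (\<i> * of_real (x \<bullet> \<xi>)) * fourier g \<xi>) \<in> borel_measurable lborel" by measurable
qed (auto simp: abs_mult mult_le_cancel_right1)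

lemma C_c_infinity_inversion:
  fixes g :: "real^'n::finite \<Rightarrow> real"
  assumes g: "g \<in> C_c_infinity"
  shows "(LINT \<xi>|lborel. exp (\<i> * of_real (x \<bullet> \<xi>)) * fourier g \<xi>) = of_real (g x)"
proof -
  have [measurable]: "g \<in> borel_measurable borel" using C_c_infinity_integrable[OF g] by simp
  obtain B where "\<And>x. \<bar>g x\<bar> \<le> B" using C_zero_bounded[OF C_c_infinity_C_zero[OF g]] by blast
  moreover have "integrable lborel (fourier g)"
    using C_c_infinity_fourier_integrable[OF g, of 0] by simp
  ultimately show ?thesis
    using fourier_inversion[OF C_c_infinity_integrable[OF g] C_c_infinity_continuous[OF g]] by blast
qed

subsection \<open>The generator on test functions\<close>

lemma grad_inversion:
  fixes g :: "real^'n::finite \<Rightarrow> real"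
  assumes g: "g \<in> C_c_infinity"
  shows "integrable lborel (\<lambda>\<xi>. exp (\<i> * of_real (x \<bullet> \<xi>)) * (\<i> * of_real (v \<bullet> \<xi>) * fourier g \<xi>))"
    and "(LINT \<xi>|lborel. exp (\<i> * of_real (x \<bullet> \<xi>)) * (\<i> * of_real (v \<bullet> \<xi>) * fourier g \<xi>)) = of_real (v \<bullet> grad g x)"
proof -
  let ?h = "\<lambda>j \<xi>. of_real (v $ j) * (exp (\<i> * of_real (x \<bullet> \<xi>)) * fourier (partial_deriv j g) \<xi>)"
  have pd: "partial_deriv j g \<in> C_c_infinity" for j by (rule C_c_infinity_partial_deriv(1)[OF g])
  have eq: "exp (\<i> * of_real (x \<bullet> \<xi>)) * (\<i> * of_real (v \<bullet> \<xi>) * fourier g \<xi>) = (\<Sum>j\<in>UNIV. ?h j \<xi>)" for \<xi>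
    by (simp add: fourier_partial_deriv[OF g] inner_vec_def sum_distrib_left sum_distrib_right mult_ac)
  have int: "integrable lborel (?h j)" for j
    by (intro integrable_mult_right C_c_infinity_fourier_integrable pd)
  show "integrable lborel (\<lambda>\<xi>. exp (\<i> * of_real (x \<bullet> \<xi>)) * (\<i> * of_real (v \<bullet> \<xi>) * fourier g \<xi>))"
    unfolding eq using int by (intro Bochner_Integration.integrable_sum)
  have summand: "(LINT \<xi>|lborel. ?h j \<xi>) = of_real (v $ j * partial_deriv j g x)" for j
    by (simp add: C_c_infinity_inversion[OF pd])
  show "(LINT \<xi>|lborel. exp (\<i> * of_real (x \<bullet> \<xi>)) * (\<i> * of_real (v \<bullet> \<xi>) * fourier g \<xi>)) = of_real (v \<bullet> grad g x)"
    unfolding eq Bochner_Integration.integral_sum[OF int] summand by (simp add: inner_vec_def grad_def)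
qed

lemma (in pair_sigma_finite) integrable_product_mult:
  fixes f h :: "_ \<Rightarrow> real"
  assumes f: "integrable M1 f" and h: "integrable M2 h"
  shows "integrable (M1 \<Otimes>\<^sub>M M2) (\<lambda>(a, b). f a * h b)"
proof (rule Fubini_integrable)
  have [measurable]: "f \<in> borel_measurable M1" "h \<in> borel_measurable M2" using f h by auto
  show "(\<lambda>(a, b). f a * h b) \<in> borel_measurable (M1 \<Otimes>\<^sub>M M2)" by measurable
  have "(LINT b|M2. \<bar>f a * h b\<bar>) = \<bar>f a\<bar> * (LINT b|M2. \<bar>h b\<bar>)" for a
    by (simp add: abs_mult)
  then show "integrable M1 (\<lambda>a. LINT b|M2. norm (case (a, b) of (a, b) \<Rightarrow> f a * h b))"
    using f by simp
  show "AE a in M1. integrable M2 (\<lambda>b. case (a, b) of (a, b) \<Rightarrow> f a * h b)"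
    using h by simp
qed

section \<open>The Levy-Khinchin kernel and a single Levy measure\<close>

definition levy_kernel :: "real^'n::finite \<Rightarrow> real^'n \<Rightarrow> complex" where
  "levy_kernel y \<xi> = 1 - exp (\<i> * of_real (y \<bullet> \<xi>)) + \<i> * of_real (y \<bullet> \<xi>) * of_real (indicator {0<..<1} (norm y))"

text \<open>For \<open>norm y < 1\<close> the compensator makes the kernel a first-order Taylor
  remainder, hence quadratic in \<open>y \<bullet> \<xi>\<close>. For larger \<open>y\<close> the
  crude bound 2 suffices. The bound is a product of a function of \<xi> and a function of
  \<open>y\<close>, which is what Fubini requires.\<close>

lemma norm_levy_kernel_le:
  assumes "y \<noteq> 0"
  shows "norm (levy_kernel y \<xi>) \<le> 2 * (1 + (norm \<xi>)\<^sup>2) * min ((norm y)\<^sup>2) 1"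
proof (cases "norm y < 1")
  case True
  have "levy_kernel y \<xi> = - (exp (\<i> * of_real (y \<bullet> \<xi>)) - (\<Sum>k\<le>1. (\<i> * of_real (y \<bullet> \<xi>)) ^ k / fact k))"
    using True assms by (simp add: levy_kernel_def)
  then have "norm (levy_kernel y \<xi>) = norm (exp (\<i> * of_real (y \<bullet> \<xi>)) - (\<Sum>k\<le>1. (\<i> * of_real (y \<bullet> \<xi>)) ^ k / fact k))"
    by (simp only: norm_minus_cancel)
  also have "\<dots> \<le> \<bar>y \<bullet> \<xi>\<bar> ^ Suc 1 / fact (Suc 1)"
    by (rule iexp_approx1)
  also have "\<dots> \<le> \<bar>y \<bullet> \<xi>\<bar>\<^sup>2" by (simp add: eval_nat_numeral)
  also have "\<dots> \<le> (norm y * norm \<xi>)\<^sup>2"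
    by (intro power_mono Cauchy_Schwarz_ineq2) auto
  also have "\<dots> \<le> 2 * (1 + (norm \<xi>)\<^sup>2) * (norm y)\<^sup>2"
    unfolding power_mult_distrib by (subst mult.commute, intro mult_right_mono) auto
  finally show ?thesis using True by (simp add: min_def power_le_one)
next
  case False
  have "norm (levy_kernel y \<xi>) = norm (1 - exp (\<i> * of_real (y \<bullet> \<xi>)))"
    using False by (simp add: levy_kernel_def)
  also have "\<dots> \<le> norm (1::complex) + norm (exp (\<i> * of_real (y \<bullet> \<xi>)))" by (rule norm_triangle_ineq4)
  also have "\<dots> \<le> 2 * (1 + (norm \<xi>)\<^sup>2)" by simp
  finally have "norm (levy_kernel y \<xi>) \<le> 2 * (1 + (norm \<xi>)\<^sup>2)" .
  moreover have "min ((norm y)\<^sup>2) 1 = 1" using False by (intro min_absorb2) (simp add: one_le_power)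
  ultimately show ?thesis by (simp only: mult_1_right)
qed

lemma levy_kernel_measurable [measurable]:
  "(\<lambda>(\<xi>, y). levy_kernel y \<xi>) \<in> borel_measurable (borel \<Otimes>\<^sub>M borel)"
  unfolding levy_kernel_def by measurable

lemma levy_kernel_measurable_snd [measurable]: "levy_kernel y \<in> borel_measurable borel"
  unfolding levy_kernel_def[abs_def] by measurable

text \<open>Up to sign, the counterpart of \<open>levy_kernel\<close> under Fourier inversion; the
  correspondence is established in \<open>symbol_to_levy_form\<close>.\<close>

definition levy_increment :: "(real^'n::finite \<Rightarrow> real) \<Rightarrow> real^'n \<Rightarrow> real^'n \<Rightarrow> real" where
  "levy_increment f x y = f (x + y) - f x - (grad f x \<bullet> y) * indicator {0<..<1} (norm y)"

locale levy_measure =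
  fixes \<nu> :: "(real^'n::finite) measure"
  assumes sets_eq: "sets \<nu> = sets (restrict_space borel (- {0}))"
    and nn_integral_finite: "(\<integral>\<^sup>+ y. ennreal (min ((norm y)\<^sup>2) 1) \<partial>\<nu>) < \<infinity>"
begin

lemma space_eq: "space \<nu> = - {0}"
  using sets_eq_imp_space_eq[OF sets_eq] by (simp add: space_restrict_space)

lemma measurable_ident [measurable]: "(\<lambda>y. y) \<in> measurable \<nu> borel"
  unfolding measurable_cong_sets[OF sets_eq refl] by (intro measurable_restrict_space1) simp

lemma integrable_min: "integrable \<nu> (\<lambda>y. min ((norm y)\<^sup>2) 1)"
  using nn_integral_finite by (intro integrableI_bounded) auto

text \<open>A Levy measure may be infinite near 0, while Fubini needs \<sigma>-finiteness. The
  weight is positive off 0, so the sets on which it is at least \<open>1 / n\<close> exhaust the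
  space, and Markov's inequality makes them finite.\<close>

sublocale sigma_finite_measure \<nu>
proof
  define m :: "real^'n \<Rightarrow> real" where "m y = min ((norm y)\<^sup>2) 1" for y
  have m_meas [measurable]: "m \<in> borel_measurable \<nu>" unfolding m_def by measurable
  have m_nonneg: "0 \<le> m y" for y by (simp add: m_def)
  define A where "A n = {y \<in> space \<nu>. 1 \<le> real n * m y}" for n :: nat
  have A_sets: "A n \<in> sets \<nu>" for n unfolding A_def by measurable
  have A_finite: "emeasure \<nu> (A n) < \<infinity>" for n
  proof -
    have "1 \<le> ennreal (real n) * ennreal (m y) \<longleftrightarrow> 1 \<le> real n * m y" for y
      using m_nonneg by (simp add: ennreal_mult[symmetric] ennreal_ge_1)
    then have "A n = {y \<in> space \<nu>. 1 \<le> ennreal (real n) * ennreal (m y)}"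
      by (auto simp: A_def)
    also have "emeasure \<nu> \<dots> \<le> ennreal (real n) * (\<integral>\<^sup>+ y. ennreal (m y) * indicator (space \<nu>) y \<partial>\<nu>)"
      by (rule nn_integral_Markov_inequality) measurable
    also have "(\<integral>\<^sup>+ y. ennreal (m y) * indicator (space \<nu>) y \<partial>\<nu>) = (\<integral>\<^sup>+ y. ennreal (min ((norm y)\<^sup>2) 1) \<partial>\<nu>)"
      by (intro nn_integral_cong) (simp add: m_def)
    also have "ennreal (real n) * \<dots> < \<infinity>"
      using nn_integral_finite by (simp add: ennreal_mult_less_top)
    finally show ?thesis .
  qed
  have "y \<in> (\<Union>n. A n)" if "y \<in> space \<nu>" for y
  proof -
    have "0 < m y" using that by (simp add: space_eq m_def)
    then obtain n where "1 < real n * m y" using reals_Archimedean3 by blast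
    then show ?thesis using that by (auto simp: A_def intro: less_imp_le)
  qed
  then have "\<Union> (range A) = space \<nu>" by (auto simp: A_def)
  then show "\<exists>A. countable A \<and> A \<subseteq> sets \<nu> \<and> \<Union> A = space \<nu> \<and> (\<forall>a\<in>A. emeasure \<nu> a \<noteq> \<infinity>)"
    using A_sets A_finite by (intro exI[of _ "range A"]) (auto simp: less_top)
qed

sublocale pair: pair_sigma_finite lborel \<nu> ..

text \<open>The weight \<open>w\<close> is left general because Fubini is applied twice: with an
  oscillating factor times the transform of a test function, and with a Gaussian.\<close>

lemma weighted_kernel_integrable:
  fixes w :: "real^'n \<Rightarrow> complex"
  assumes [measurable]: "w \<in> borel_measurable borel"
    and w: "integrable lborel (\<lambda>\<xi>. (1 + (norm \<xi>)\<^sup>2) * norm (w \<xi>))"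
  shows "integrable (lborel \<Otimes>\<^sub>M \<nu>) (\<lambda>(\<xi>, y). w \<xi> * levy_kernel y \<xi>)"
proof (rule Bochner_Integration.integrable_bound)
  show "integrable (lborel \<Otimes>\<^sub>M \<nu>) (\<lambda>(\<xi>, y). 2 * ((1 + (norm \<xi>)\<^sup>2) * norm (w \<xi>)) * min ((norm y)\<^sup>2) 1)"
    by (intro pair.integrable_product_mult integrable_mult_right w integrable_min)
  have "(\<lambda>z. levy_kernel (snd z) (fst z)) \<in> borel_measurable (lborel \<Otimes>\<^sub>M \<nu>)"
    using measurable_compose[OF _ levy_kernel_measurable, of "\<lambda>z. (fst z, snd z)" "lborel \<Otimes>\<^sub>M \<nu>"] by simp
  then show "(\<lambda>(\<xi>, y). w \<xi> * levy_kernel y \<xi>) \<in> borel_measurable (lborel \<Otimes>\<^sub>M \<nu>)"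
    by (simp add: case_prod_beta)
  have le: "norm (w \<xi> * levy_kernel y \<xi>) \<le> norm (2 * ((1 + (norm \<xi>)\<^sup>2) * norm (w \<xi>)) * min ((norm y)\<^sup>2) 1)"
    if "y \<noteq> 0" for \<xi> y
  proof -
    have "norm (w \<xi> * levy_kernel y \<xi>) \<le> norm (w \<xi>) * (2 * (1 + (norm \<xi>)\<^sup>2) * min ((norm y)\<^sup>2) 1)"
      unfolding norm_mult by (intro mult_left_mono norm_levy_kernel_le that) auto
    also have "\<dots> \<le> \<bar>2 * ((1 + (norm \<xi>)\<^sup>2) * norm (w \<xi>)) * min ((norm y)\<^sup>2) 1\<bar>"
      by (rule order_trans[OF _ abs_ge_self]) (simp only: mult_ac order_refl)
    finally show ?thesis by simp
  qed
  show "AE z in lborel \<Otimes>\<^sub>M \<nu>. norm (case z of (\<xi>, y) \<Rightarrow> w \<xi> * levy_kernel y \<xi>)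
      \<le> norm (case z of (\<xi>, y) \<Rightarrow> 2 * ((1 + (norm \<xi>)\<^sup>2) * norm (w \<xi>)) * min ((norm y)\<^sup>2) 1)"
  proof (rule AE_I2)
    fix z :: "(real^'n) \<times> (real^'n)" assume "z \<in> space (lborel \<Otimes>\<^sub>M \<nu>)"
    then have "snd z \<noteq> 0" by (auto simp: space_pair_measure space_eq)
    then show "norm (case z of (\<xi>, y) \<Rightarrow> w \<xi> * levy_kernel y \<xi>)
      \<le> norm (case z of (\<xi>, y) \<Rightarrow> 2 * ((1 + (norm \<xi>)\<^sup>2) * norm (w \<xi>)) * min ((norm y)\<^sup>2) 1)"
      unfolding case_prod_beta by (rule le)
  qed
qed

lemma levy_kernel_integrable: "integrable \<nu> (\<lambda>y. levy_kernel y \<xi>)"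
proof (rule Bochner_Integration.integrable_bound)
  show "integrable \<nu> (\<lambda>y. 2 * (1 + (norm \<xi>)\<^sup>2) * min ((norm y)\<^sup>2) 1)"
    by (intro integrable_mult_right integrable_min)
  show "(\<lambda>y. levy_kernel y \<xi>) \<in> borel_measurable \<nu>"
    unfolding levy_kernel_def by measurable
  show "AE y in \<nu>. norm (levy_kernel y \<xi>) \<le> norm (2 * (1 + (norm \<xi>)\<^sup>2) * min ((norm y)\<^sup>2) 1)"
    using order_trans[OF norm_levy_kernel_le abs_ge_self] by (intro AE_I2) (auto simp: space_eq)
qed

text \<open>After the exchange of integrals the frequency integral is evaluated for fixed
  \<open>y\<close>. The kernel splits into three parts, and Fourier inversion gives \<open>g\<close>
  at \<open>x\<close>, \<open>g\<close> at \<open>x + y\<close> and the gradient in direction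
  \<open>y\<close>.\<close>

theorem symbol_to_levy_form:
  assumes g: "g \<in> C_c_infinity"
    and q: "\<And>\<xi>. q \<xi> = - \<i> * of_real (b \<bullet> \<xi>) + (LINT y|\<nu>. levy_kernel y \<xi>)"
  shows "- (LINT \<xi>|lborel. exp (\<i> * of_real (x \<bullet> \<xi>)) * q \<xi> * fourier g \<xi>) =
    of_real (b \<bullet> grad g x + (LINT y|\<nu>. levy_increment g x y))"
proof -
  define w where "w \<xi> = exp (\<i> * of_real (x \<bullet> \<xi>)) * fourier g \<xi>" for \<xi>
  have [measurable]: "g \<in> borel_measurable borel" using C_c_infinity_integrable[OF g] by simp
  have w_meas: "w \<in> borel_measurable borel" unfolding w_def by measurable
  have w: "integrable lborel (\<lambda>\<xi>. (1 + (norm \<xi>)\<^sup>2) * norm (w \<xi>))"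
    using fourier_moment_integrable[OF g] by (simp add: w_def)
  note int = weighted_kernel_integrable[OF w_meas w]
  have drift: "integrable lborel (\<lambda>\<xi>. \<i> * of_real (v \<bullet> \<xi>) * w \<xi>)"
    "(LINT \<xi>|lborel. \<i> * of_real (v \<bullet> \<xi>) * w \<xi>) = of_real (v \<bullet> grad g x)" for v
    using grad_inversion[OF g, of x v] by (simp_all add: w_def mult_ac)
  have inner: "(LINT \<xi>|lborel. w \<xi> * levy_kernel y \<xi>) = - of_real (levy_increment g x y)" for y
  proof -
    have i1: "integrable lborel (\<lambda>\<xi>. exp (\<i> * of_real (z \<bullet> \<xi>)) * fourier g \<xi>)" for z
      by (rule C_c_infinity_fourier_integrable[OF g])
    have "w \<xi> * levy_kernel y \<xi> = exp (\<i> * of_real (x \<bullet> \<xi>)) * fourier g \<xi> - exp (\<i> * of_real ((x + y) \<bullet> \<xi>)) * fourier g \<xi>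
        + of_real (indicator {0<..<1} (norm y)) * (\<i> * of_real (y \<bullet> \<xi>) * w \<xi>)" for \<xi>
    proof -
      have "exp (\<i> * of_real ((x + y) \<bullet> \<xi>)) = exp (\<i> * of_real (x \<bullet> \<xi>)) * exp (\<i> * of_real (y \<bullet> \<xi>))"
        by (simp add: inner_add_left distrib_left exp_add)
      then show ?thesis by (simp add: w_def levy_kernel_def algebra_simps)
    qed
    then have "(LINT \<xi>|lborel. w \<xi> * levy_kernel y \<xi>) = of_real (g x) - of_real (g (x + y))
        + of_real (indicator {0<..<1} (norm y)) * of_real (y \<bullet> grad g x)"
      using i1 drift by (simp add: C_c_infinity_inversion[OF g])
    then show ?thesis by (simp add: levy_increment_def inner_commute mult.commute)
  qed
  have "exp (\<i> * of_real (x \<bullet> \<xi>)) * q \<xi> * fourier g \<xi> =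
      - (\<i> * of_real (b \<bullet> \<xi>) * w \<xi>) + (LINT y|\<nu>. w \<xi> * levy_kernel y \<xi>)" for \<xi>
    by (simp add: q w_def algebra_simps)
  moreover have "integrable lborel (\<lambda>\<xi>. LINT y|\<nu>. w \<xi> * levy_kernel y \<xi>)"
    using pair.integrable_fst'[OF int] by simp
  ultimately have "(LINT \<xi>|lborel. exp (\<i> * of_real (x \<bullet> \<xi>)) * q \<xi> * fourier g \<xi>) =
      - of_real (b \<bullet> grad g x) + (LINT \<xi>|lborel. LINT y|\<nu>. w \<xi> * levy_kernel y \<xi>)"
    using drift[of b] by (simp del: integral_mult_right_zero)
  also have "(LINT \<xi>|lborel. LINT y|\<nu>. w \<xi> * levy_kernel y \<xi>) = (LINT y|\<nu>. LINT \<xi>|lborel. w \<xi> * levy_kernel y \<xi>)"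
    using pair.Fubini_integral[OF int] by simp
  also have "\<dots> = - of_real (LINT y|\<nu>. levy_increment g x y)"
    unfolding inner by simp
  finally show ?thesis by simp
qed

lemma integral_min_le:
  assumes "\<And>y. y \<noteq> 0 \<Longrightarrow> min ((norm y)\<^sup>2) 1 \<le> h y" "integrable \<nu> h"
  shows "(LINT y|\<nu>. min ((norm y)\<^sup>2) 1) \<le> integral\<^sup>L \<nu> h"
  by (rule Bochner_Integration.integral_mono[OF integrable_min assms(2)]) (use assms in \<open>auto simp: space_eq\<close>)

text \<open>At the unit vector in direction \<open>j\<close> the drift contributes exactly
  \<open>b $ j\<close>, while \<open>q\<close> is at most \<open>2 * c\<close> and the kernel at
  most 4 times the truncated square.\<close>

lemma drift_bound:
  assumes q: "\<And>\<xi>. q \<xi> = - \<i> * of_real (b \<bullet> \<xi>) + (LINT y|\<nu>. levy_kernel y \<xi>)"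
    and bound: "\<And>\<xi>. norm (q \<xi>) \<le> c * (1 + (norm \<xi>)\<^sup>2)"
  shows "\<bar>b $ j\<bar> \<le> 2 * c + 4 * (LINT y|\<nu>. min ((norm y)\<^sup>2) 1)"
proof -
  let ?e = "axis j 1 :: real^'n"
  have "norm (LINT y|\<nu>. levy_kernel y ?e) \<le> (LINT y|\<nu>. norm (levy_kernel y ?e))"
    by (rule integral_norm_bound)
  also have "\<dots> \<le> (LINT y|\<nu>. 4 * min ((norm y)\<^sup>2) 1)"
    using norm_levy_kernel_le[of _ ?e]
    by (intro Bochner_Integration.integral_mono integrable_norm levy_kernel_integrable integrable_mult_right integrable_min)
      (auto simp: space_eq)
  finally have "norm (LINT y|\<nu>. levy_kernel y ?e) \<le> 4 * (LINT y|\<nu>. min ((norm y)\<^sup>2) 1)" by simp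
  moreover have "norm (\<i> * complex_of_real (b \<bullet> ?e)) \<le> norm (q ?e) + norm (LINT y|\<nu>. levy_kernel y ?e)"
    using norm_triangle_ineq4[of "LINT y|\<nu>. levy_kernel y ?e" "q ?e"] by (simp add: q add.commute)
  moreover have "norm (q ?e) \<le> 2 * c" using bound[of ?e] by simp
  ultimately show ?thesis by (simp add: norm_mult inner_axis)
qed

text \<open>Averaging \<open>Re q\<close> against a Gaussian weight turns \<open>1 - cos(y \<bullet> \<xi>)\<close> into
  \<open>1 - exp(-|y|^2/2)\<close>, which is bounded below for \<open>|y| \<ge> 1\<close>.\<close>

lemma large_jumps_bound:
  assumes q: "\<And>\<xi>. q \<xi> = - \<i> * of_real (b \<bullet> \<xi>) + (LINT y|\<nu>. levy_kernel y \<xi>)"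
    and bound: "\<And>\<xi>. norm (q \<xi>) \<le> c * (1 + (norm \<xi>)\<^sup>2)"
  shows "integrable \<nu> (\<lambda>y. indicator {y. 1 \<le> norm y} y :: real)"
    and "(LINT y|\<nu>. indicator {y. 1 \<le> norm y} y) * (1 - exp (- 1 / 2)) \<le>
      c * (LINT \<xi>|lborel. (1 + (norm (\<xi>::real^'n))\<^sup>2) * std_gauss \<xi>)"
proof -
  let ?w = "\<lambda>\<xi>::real^'n. complex_of_real (std_gauss \<xi>)"
  have w: "integrable lborel (\<lambda>\<xi>. (1 + (norm \<xi>)\<^sup>2) * norm (?w \<xi>))"
    using std_gauss_moment by (simp add: std_gauss_nonneg)
  have w_meas: "?w \<in> borel_measurable borel" by measurable
  note int = weighted_kernel_integrable[OF w_meas w]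
  have Re_q: "std_gauss \<xi> * Re (q \<xi>) = Re (LINT y|\<nu>. ?w \<xi> * levy_kernel y \<xi>)" for \<xi>
    by (simp add: q)
  \<comment> \<open>The compensator is purely imaginary, so it drops out of the real part, just as
    the drift does in \<open>Re_q\<close>. What remains is the total mass minus the Fourier
    transform of the Gaussian.\<close>
  have E: "Re (LINT \<xi>|lborel. ?w \<xi> * levy_kernel y \<xi>) = 1 - exp (- (norm y)\<^sup>2 / 2)"
    if "integrable lborel (\<lambda>\<xi>. ?w \<xi> * levy_kernel y \<xi>)" for y
  proof -
    have i1: "integrable lborel (\<lambda>\<xi>. exp (\<i> * of_real (y \<bullet> \<xi>)) * ?w \<xi>)"
      by (rule Bochner_Integration.integrable_bound[OF integrable_std_gauss]) auto
    have "Re (LINT \<xi>|lborel. ?w \<xi> * levy_kernel y \<xi>) = (LINT \<xi>|lborel. Re (?w \<xi> * levy_kernel y \<xi>))"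
      using that by (rule integral_Re[symmetric])
    also have "\<dots> = (LINT \<xi>|lborel. std_gauss \<xi> - Re (exp (\<i> * of_real (y \<bullet> \<xi>)) * ?w \<xi>))"
      by (intro Bochner_Integration.integral_cong) (auto simp: levy_kernel_def algebra_simps)
    also have "\<dots> = (LINT \<xi>|lborel. std_gauss (\<xi>::real^'n)) - (LINT \<xi>|lborel. Re (exp (\<i> * of_real (y \<bullet> \<xi>)) * ?w \<xi>))"
      using i1 integrable_std_gauss by (intro Bochner_Integration.integral_diff integrable_Re) auto
    also have "\<dots> = 1 - exp (- (norm y)\<^sup>2 / 2)"
      using i1 by (simp only: integral_Re fourier_std_gauss integral_std_gauss Re_complex_of_real)
    finally show ?thesis .
  qed
  have "(LINT \<xi>|lborel. Re (LINT y|\<nu>. ?w \<xi> * levy_kernel y \<xi>)) \<le>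
      (LINT \<xi>|lborel. c * ((1 + (norm (\<xi>::real^'n))\<^sup>2) * std_gauss \<xi>))"
  proof (rule Bochner_Integration.integral_mono)
    show "integrable lborel (\<lambda>\<xi>. Re (LINT y|\<nu>. ?w \<xi> * levy_kernel y \<xi>))"
      using integrable_Re[OF pair.integrable_fst'[OF int]] by (simp only: prod.case)
    show "integrable lborel (\<lambda>\<xi>::real^'n. c * ((1 + (norm \<xi>)\<^sup>2) * std_gauss \<xi>))"
      using std_gauss_moment by (intro integrable_mult_right)
    show "Re (LINT y|\<nu>. ?w \<xi> * levy_kernel y \<xi>) \<le> c * ((1 + (norm \<xi>)\<^sup>2) * std_gauss \<xi>)" for \<xi>
      unfolding Re_q[symmetric] using mult_right_mono[OF order_trans[OF complex_Re_le_cmod bound] std_gauss_nonneg, of \<xi> \<xi>]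
      by (simp add: mult_ac)
  qed
  moreover have "(LINT \<xi>|lborel. Re (LINT y|\<nu>. ?w \<xi> * levy_kernel y \<xi>)) =
      Re (LINT y|\<nu>. LINT \<xi>|lborel. ?w \<xi> * levy_kernel y \<xi>)"
    using pair.Fubini_integral[OF int] integral_Re[OF pair.integrable_fst'[OF int]] by simp
  moreover have "Re (LINT y|\<nu>. LINT \<xi>|lborel. ?w \<xi> * levy_kernel y \<xi>) =
      (LINT y|\<nu>. Re (LINT \<xi>|lborel. ?w \<xi> * levy_kernel y \<xi>))"
    using integral_Re[OF pair.integrable_snd[OF int]] by simp
  moreover have "integrable \<nu> (\<lambda>y. Re (LINT \<xi>|lborel. ?w \<xi> * levy_kernel y \<xi>))"
    using pair.integrable_snd[OF int] by (intro integrable_Re)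
  moreover have "integrable lborel (\<lambda>\<xi>. ?w \<xi> * levy_kernel y \<xi>)" if "y \<noteq> 0" for y
  proof (rule Bochner_Integration.integrable_bound)
    show "integrable lborel (\<lambda>\<xi>::real^'n. 2 * min ((norm y)\<^sup>2) 1 * ((1 + (norm \<xi>)\<^sup>2) * std_gauss \<xi>))"
      using std_gauss_moment by (intro integrable_mult_right)
    show "(\<lambda>\<xi>. ?w \<xi> * levy_kernel y \<xi>) \<in> borel_measurable lborel"
      by (rule borel_measurable_times) (use w_meas levy_kernel_measurable_snd[of y] in simp_all)
    show "AE \<xi> in lborel. norm (?w \<xi> * levy_kernel y \<xi>) \<le> norm (2 * min ((norm y)\<^sup>2) 1 * ((1 + (norm \<xi>)\<^sup>2) * std_gauss \<xi>))"
    proof (intro AE_I2)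
      fix \<xi> :: "real^'n"
      have "norm (?w \<xi> * levy_kernel y \<xi>) \<le> std_gauss \<xi> * (2 * (1 + (norm \<xi>)\<^sup>2) * min ((norm y)\<^sup>2) 1)"
        unfolding norm_mult using norm_levy_kernel_le[OF that, of \<xi>] std_gauss_nonneg[of \<xi>]
        by (intro mult_mono) auto
      also have "\<dots> \<le> \<bar>2 * min ((norm y)\<^sup>2) 1 * ((1 + (norm \<xi>)\<^sup>2) * std_gauss \<xi>)\<bar>"
        by (rule order_trans[OF _ abs_ge_self]) (simp only: mult_ac order_refl)
      finally show "norm (?w \<xi> * levy_kernel y \<xi>) \<le> norm (2 * min ((norm y)\<^sup>2) 1 * ((1 + (norm \<xi>)\<^sup>2) * std_gauss \<xi>))"
        by simp
    qed
  qed
  note E' = E[OF this]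
  ultimately have int_e: "integrable \<nu> (\<lambda>y. 1 - exp (- (norm y)\<^sup>2 / 2))"
    and le: "(LINT y|\<nu>. 1 - exp (- (norm y)\<^sup>2 / 2)) \<le> c * (LINT \<xi>|lborel. (1 + (norm (\<xi>::real^'n))\<^sup>2) * std_gauss \<xi>)"
    using Bochner_Integration.integral_cong[OF refl, of \<nu> "\<lambda>y. Re (LINT \<xi>|lborel. ?w \<xi> * levy_kernel y \<xi>)" "\<lambda>y. 1 - exp (- (norm y)\<^sup>2 / 2)"]
      Bochner_Integration.integrable_cong[OF refl, of \<nu> "\<lambda>y. Re (LINT \<xi>|lborel. ?w \<xi> * levy_kernel y \<xi>)" "\<lambda>y. 1 - exp (- (norm y)\<^sup>2 / 2)"]
    by (simp_all add: space_eq)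
  show ind: "integrable \<nu> (\<lambda>y. indicator {y. 1 \<le> norm y} y :: real)"
    by (rule Bochner_Integration.integrable_bound[OF integrable_min]) (auto simp: indicator_def one_le_power)
  \<comment> \<open>Among all \<open>y\<close> with \<open>norm y \<ge> 1\<close> the averaged
    kernel is smallest on the unit sphere, where it equals \<open>1 - exp (- 1 / 2)\<close>.\<close>
  have "(LINT y|\<nu>. indicator {y. 1 \<le> norm y} y * (1 - exp (- 1 / 2))) \<le> (LINT y|\<nu>. 1 - exp (- (norm y)\<^sup>2 / 2))"
    by (rule Bochner_Integration.integral_mono) (use ind int_e in \<open>auto simp: indicator_def one_le_power\<close>)
  with le show "(LINT y|\<nu>. indicator {y. 1 \<le> norm y} y) * (1 - exp (- 1 / 2)) \<le>
      c * (LINT \<xi>|lborel. (1 + (norm (\<xi>::real^'n))\<^sup>2) * std_gauss \<xi>)" by simp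
qed

end

subsection \<open>Feller generators are closed\<close>

lemma C_zero_linear:
  assumes "f \<in> C_zero" "g \<in> C_zero"
  shows "(\<lambda>x. a * f x + b * g x) \<in> C_zero"
proof -
  have "((\<lambda>x. a * f x + b * g x) \<longlongrightarrow> a * 0 + b * 0) at_infinity"
    using assms unfolding C_zero_def by (intro tendsto_intros) auto
  then show ?thesis using assms by (auto simp: C_zero_def intro!: continuous_intros)
qed

lemma C_zero_diff: "f \<in> C_zero \<Longrightarrow> g \<in> C_zero \<Longrightarrow> (\<lambda>x. f x - g x) \<in> C_zero"
  using C_zero_linear[of f g 1 "-1"] by simp

lemma C_zero_scale: "f \<in> C_zero \<Longrightarrow> (\<lambda>x. c * f x) \<in> C_zero"
  using C_zero_linear[of f f c 0] by simp

lemma C_zero_max_0: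
  assumes "f \<in> C_zero" shows "(\<lambda>x. max 0 (f x)) \<in> C_zero"
proof -
  have "((\<lambda>x. max 0 (f x)) \<longlongrightarrow> max 0 0) at_infinity"
    using assms unfolding C_zero_def by (intro tendsto_max tendsto_const) auto
  then show ?thesis using assms by (auto simp: C_zero_def intro!: continuous_intros)
qed

lemma C_zero_uniform_limit:
  assumes lim: "uniform_limit UNIV F f sequentially" and F: "\<And>n. F n \<in> C_zero"
  shows "f \<in> C_zero"
proof -
  have "continuous_on UNIV f"
    using F by (intro uniform_limit_theorem[OF _ lim]) (auto simp: C_zero_def)
  moreover have "(f \<longlongrightarrow> 0) at_infinity"
  proof (rule tendstoI)
    fix e :: real assume "e > 0"
    then have "\<forall>\<^sub>F n in sequentially. \<forall>x. dist (F n x) (f x) < e / 2"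
      using uniform_limitD[OF lim, of "e / 2"] by simp
    then obtain n where n: "\<And>x. dist (F n x) (f x) < e / 2"
      by (auto simp: eventually_sequentially)
    have "\<forall>\<^sub>F x in at_infinity. dist (F n x) 0 < e / 2"
      using F[of n] \<open>e > 0\<close> by (intro tendstoD) (auto simp: C_zero_def)
    then show "\<forall>\<^sub>F x in at_infinity. dist (f x) 0 < e"
    proof eventually_elim
      case (elim x)
      then show ?case using n[of x] unfolding dist_real_def by argo
    qed
  qed
  ultimately show ?thesis by (simp add: C_zero_def)
qed

text \<open>Uniform limits are pointwise limits along a nontrivial filter, so at most one
  \<open>g\<close> fits the description that defines \<open>generator\<close>.\<close>

lemma generator_eqI:
  assumes "generator_graph T f g"
  shows "generator T f = g"
  unfolding generator_def
proof (rule the_equality)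
  show "generator_graph T f g" by fact
next
  have lim: "((\<lambda>t. (T t f x - f x) / t) \<longlongrightarrow> h x) (at_right 0)" if "generator_graph T f h" for h x
    by (rule tendsto_uniform_limitI[where S = UNIV and f = "\<lambda>t x. (T t f x - f x) / t"])
      (use that in \<open>simp_all add: generator_graph_def\<close>)
  fix g' assume "generator_graph T f g'"
  then show "g' = g"
    using tendsto_unique[OF trivial_limit_at_right_real lim lim] assms by blast
qed

context
  fixes T :: "real \<Rightarrow> (real^'n::finite \<Rightarrow> real) \<Rightarrow> real^'n \<Rightarrow> real"
  assumes feller: "feller_semigroup T"
begin

lemma feller_C_zero: "0 \<le> t \<Longrightarrow> f \<in> C_zero \<Longrightarrow> T t f \<in> C_zero"
  using feller by (simp add: feller_semigroup_def)

lemma feller_linear: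
  "0 \<le> t \<Longrightarrow> f \<in> C_zero \<Longrightarrow> g \<in> C_zero \<Longrightarrow> T t (\<lambda>x. a * f x + b * g x) = (\<lambda>x. a * T t f x + b * T t g x)"
  using feller by (simp add: feller_semigroup_def)

lemma feller_diff:
  "0 \<le> t \<Longrightarrow> f \<in> C_zero \<Longrightarrow> g \<in> C_zero \<Longrightarrow> T t (\<lambda>x. f x - g x) x = T t f x - T t g x"
  using feller_linear[of t f g 1 "-1"] by simp

lemma feller_scale: "0 \<le> t \<Longrightarrow> f \<in> C_zero \<Longrightarrow> T t (\<lambda>x. c * f x) x = c * T t f x"
  using feller_linear[of t f f c 0] by simp

lemma feller_0: "f \<in> C_zero \<Longrightarrow> T 0 f = f"
  using feller by (simp add: feller_semigroup_def)

lemma feller_add: "0 \<le> s \<Longrightarrow> 0 \<le> t \<Longrightarrow> f \<in> C_zero \<Longrightarrow> T (s + t) f = T s (T t f)"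
  using feller by (simp add: feller_semigroup_def)

lemma feller_unit_interval:
  "0 \<le> t \<Longrightarrow> f \<in> C_zero \<Longrightarrow> (\<And>x. 0 \<le> f x \<and> f x \<le> 1) \<Longrightarrow> 0 \<le> T t f x \<and> T t f x \<le> 1"
  using feller by (simp add: feller_semigroup_def)

lemma feller_strongly_continuous:
  "f \<in> C_zero \<Longrightarrow> uniform_limit UNIV (\<lambda>t. T t f) f (at_right 0)"
  using feller by (simp add: feller_semigroup_def)

text \<open>The semigroup axioms speak of functions with values in [0, 1] only. The positive and the
  negative part of \<open>f / c\<close> are of this kind, and two numbers in [0, 1] differ by at
  most 1. Division by \<open>c\<close> forces the separate case \<open>c = 0\<close>.\<close>

lemma feller_contraction:
  assumes t: "0 \<le> t" and f: "f \<in> C_zero" and c: "\<And>x. \<bar>f x\<bar> \<le> c"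
  shows "\<bar>T t f x\<bar> \<le> c"
proof -
  have "c \<ge> 0" using c[of 0] by linarith
  show ?thesis
  proof (cases "c = 0")
    case True
    then have "f = (\<lambda>x. 0 * f x)" using c by (auto simp: fun_eq_iff)
    then show ?thesis using feller_scale[OF t f, of 0 x] True by simp
  next
    case False
    with \<open>c \<ge> 0\<close> have "c > 0" by simp
    define p where "p x = (1 / c) * max 0 (f x)" for x
    define m where "m x = (1 / c) * max 0 (- 1 * f x)" for x
    have pm: "p \<in> C_zero" "m \<in> C_zero"
      unfolding p_def m_def by (intro C_zero_scale C_zero_max_0 f)+
    have "0 \<le> p x \<and> p x \<le> 1" "0 \<le> m x \<and> m x \<le> 1" for x
      using c[of x] \<open>c > 0\<close> by (auto simp: p_def m_def divide_simps max_def)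
    then have "0 \<le> T t p x \<and> T t p x \<le> 1" "0 \<le> T t m x \<and> T t m x \<le> 1" for x
      using feller_unit_interval[OF t] pm by simp_all
    moreover have "f = (\<lambda>x. c * p x + (- c) * m x)"
      using \<open>c > 0\<close> by (auto simp: p_def m_def fun_eq_iff max_def)
    then have "T t f x = c * T t p x + (- c) * T t m x"
      using feller_linear[OF t pm, of c "- c"] by simp
    then have "T t f x = c * (T t p x - T t m x)" by (simp add: algebra_simps)
    moreover have "\<bar>T t p x - T t m x\<bar> \<le> 1" using calculation(1,2)[of x] by linarith
    ultimately show ?thesis
      using \<open>c > 0\<close> mult_left_mono[of "\<bar>T t p x - T t m x\<bar>" 1 c] by (simp add: abs_mult)
  qed
qed

lemma feller_telescope:
  assumes h: "0 \<le> h" and f: "f \<in> C_zero"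
  shows "T (real n * h) f x - f x = (\<Sum>k<n. T (real k * h) (\<lambda>y. T h f y - f y) x)"
proof (induction n)
  case 0
  then show ?case by (simp add: feller_0[OF f])
next
  case (Suc n)
  have "T (real (Suc n) * h) f = T (real n * h) (T h f)"
    using feller_add[of "real n * h" h f] h f by (simp add: algebra_simps)
  moreover have "T (real n * h) (\<lambda>y. T h f y - f y) x = T (real n * h) (T h f) x - T (real n * h) f x"
    using h f feller_C_zero by (intro feller_diff) auto
  ultimately show ?case using Suc by simp
qed

text \<open>The difference quotient minus \<open>g\<close> is morally the time average of
  \<open>T s g - g\<close> over [0, t]. Telescoping gives a Riemann sum of this average, in which
  \<open>g\<close> is replaced by the difference quotient \<open>D\<close> of a short step
  \<open>h\<close>; contraction bounds the replacement error by \<eta>, uniformly in the number of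
  steps.\<close>

lemma generator_rate:
  assumes gen: "generator_graph T f g" and "0 < t"
    and e: "\<And>s y. 0 \<le> s \<Longrightarrow> s \<le> t \<Longrightarrow> \<bar>T s g y - g y\<bar> \<le> e"
  shows "\<bar>(T t f x - f x) / t - g x\<bar> \<le> e"
proof (rule field_le_epsilon)
  fix \<eta> :: real assume "\<eta> > 0"
  have f: "f \<in> C_zero" and g: "g \<in> C_zero"
    and lim: "uniform_limit UNIV (\<lambda>t x. (T t f x - f x) / t) g (at_right 0)"
    using gen by (auto simp: generator_graph_def)
  obtain d where d: "d > 0" "\<And>h y. 0 < h \<Longrightarrow> h < d \<Longrightarrow> \<bar>(T h f y - f y) / h - g y\<bar> < \<eta>"
    using uniform_limitD[OF lim \<open>\<eta> > 0\<close>] unfolding eventually_at_right_field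
    by (auto simp: dist_real_def)
  \<comment> \<open>So many steps that the step length \<open>t / n\<close> falls below
    \<open>d\<close>, where the difference quotient is \<eta>-close to \<open>g\<close>.\<close>
  obtain n where n: "t / d < real n" using reals_Archimedean2 by blast
  have "t / d > 0" using d \<open>0 < t\<close> by simp
  with n have "n > 0" by (cases n) auto
  define h where "h = t / real n"
  have h: "0 < h" "h < d" "real n * h = t"
    using n d \<open>n > 0\<close> \<open>0 < t\<close> by (auto simp: h_def field_simps)
  define D where "D y = (1 / h) * (T h f y - f y)" for y
  have Tf: "T h f \<in> C_zero" using feller_C_zero[of h f] h f by simp
  have Df: "(\<lambda>y. T h f y - f y) \<in> C_zero" by (rule C_zero_diff[OF Tf f])
  have D: "D \<in> C_zero" unfolding D_def by (rule C_zero_scale[OF Df])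
  have "(T t f x - f x) / t = (\<Sum>k<n. T (real k * h) (\<lambda>y. T h f y - f y) x) / (real n * h)"
    using feller_telescope[of h f n x] h f by simp
  also have "\<dots> = (\<Sum>k<n. T (real k * h) D x) / real n"
  proof -
    have "T (real k * h) D x = (1 / h) * T (real k * h) (\<lambda>y. T h f y - f y) x" for k
      unfolding D_def by (rule feller_scale[OF _ Df]) (use h in auto)
    then have "T (real k * h) (\<lambda>y. T h f y - f y) x = h * T (real k * h) D x" for k
      using h by simp
    then have "(\<Sum>k<n. T (real k * h) (\<lambda>y. T h f y - f y) x) = h * (\<Sum>k<n. T (real k * h) D x)"
      by (simp only: sum_distrib_left)
    then show ?thesis using h(1) by simp
  qed
  finally have eq: "(T t f x - f x) / t - g x = (\<Sum>k<n. T (real k * h) D x - g x) / real n"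
    using \<open>n > 0\<close> by (simp add: sum_subtractf diff_divide_distrib)
  have "\<bar>T (real k * h) D x - g x\<bar> \<le> e + \<eta>" if "k < n" for k
  proof -
    have "\<bar>T (real k * h) (\<lambda>y. D y - g y) x\<bar> \<le> \<eta>"
    proof (rule feller_contraction)
      show "\<bar>D y - g y\<bar> \<le> \<eta>" for y using d(2)[OF h(1,2), of y] by (simp add: D_def)
    qed (use h D g in \<open>auto intro: C_zero_diff\<close>)
    moreover have "T (real k * h) (\<lambda>y. D y - g y) x = T (real k * h) D x - T (real k * h) g x"
      using h D g by (intro feller_diff) auto
    moreover have "real k * h \<le> t" using that h by (auto simp flip: h(3) intro!: mult_right_mono)
    then have "\<bar>T (real k * h) g x - g x\<bar> \<le> e" using e h by simp
    ultimately show ?thesis by linarith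
  qed
  then have "(\<Sum>k<n. \<bar>T (real k * h) D x - g x\<bar>) \<le> (\<Sum>k<n. e + \<eta>)"
    by (intro sum_mono) auto
  then have "\<bar>\<Sum>k<n. T (real k * h) D x - g x\<bar> \<le> real n * (e + \<eta>)"
    by (intro order_trans[OF sum_abs]) simp
  then show "\<bar>(T t f x - f x) / t - g x\<bar> \<le> e + \<eta>"
    unfolding eq using \<open>n > 0\<close> by (simp add: divide_le_eq mult.commute)
qed

text \<open>By \<open>generator_rate\<close> the speed of convergence depends only on how far the
  semigroup moves \<open>G n\<close> up to time \<open>t\<close>. As \<open>G n\<close> is uniformly
  close to \<open>g\<close>, the time threshold can be taken from \<open>g\<close> alone; then
  \<open>n\<close> goes to infinity at fixed \<open>t\<close>.\<close>

theorem generator_closed: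
  assumes gen: "\<And>n. generator_graph T (F n) (G n)" and f: "f \<in> C_zero"
    and F: "uniform_limit UNIV F f sequentially" and G: "uniform_limit UNIV G g sequentially"
  shows "generator_graph T f g"
proof -
  have FC: "F n \<in> C_zero" and GC: "G n \<in> C_zero" for n using gen by (auto simp: generator_graph_def)
  have g: "g \<in> C_zero" by (rule C_zero_uniform_limit[OF G GC])
  have "uniform_limit UNIV (\<lambda>t x. (T t f x - f x) / t) g (at_right 0)"
  proof (rule uniform_limitI)
    fix e :: real assume "e > 0"
    have cont: "uniform_limit UNIV (\<lambda>t. T t g) g (at_right 0)"
      by (rule feller_strongly_continuous[OF g])
    obtain d where d: "d > 0" "\<And>s y. 0 < s \<Longrightarrow> s < d \<Longrightarrow> \<bar>T s g y - g y\<bar> < e / 4"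
      using uniform_limitD[OF cont, of "e / 4"] \<open>e > 0\<close>
      unfolding eventually_at_right_field by (auto simp: dist_real_def)
    \<comment> \<open>The errors \<open>e / 8\<close>, \<open>e / 4\<close> and \<open>e / 8\<close>
      add up to \<open>e / 2\<close>. A non-strict bound survives the limit in \<open>n\<close> and
      still leaves room below \<open>e\<close>.\<close>
    have small: "\<bar>(T t f x - f x) / t - g x\<bar> \<le> e / 2" if t: "0 < t" "t < d" for t x
    proof (rule tendsto_upperbound)
      have GxT: "(\<lambda>n. G n x) \<longlonglongrightarrow> g x" and FxT: "(\<lambda>n. F n x) \<longlonglongrightarrow> f x"
        using tendsto_uniform_limitI[OF G] tendsto_uniform_limitI[OF F] by auto
      have TF: "(\<lambda>n. T t (F n) x) \<longlonglongrightarrow> T t f x"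
      proof (rule tendstoI)
        fix r :: real assume "r > 0"
        have "\<forall>\<^sub>F n in sequentially. \<forall>x\<in>UNIV. dist (F n x) (f x) < r / 2"
          using uniform_limitD[OF F, of "r / 2"] \<open>r > 0\<close> by simp
        then show "\<forall>\<^sub>F n in sequentially. dist (T t (F n) x) (T t f x) < r"
        proof eventually_elim
          case (elim n)
          have "\<bar>T t (\<lambda>y. F n y - f y) x\<bar> \<le> r / 2"
            using elim t by (intro feller_contraction C_zero_diff FC f) (auto simp: dist_real_def less_imp_le)
          then show ?case using feller_diff[of t "F n" f x] t FC f \<open>r > 0\<close> by (simp add: dist_real_def)
        qed
      qed
      show "(\<lambda>n. \<bar>(T t (F n) x - F n x) / t - G n x\<bar>) \<longlonglongrightarrow> \<bar>(T t f x - f x) / t - g x\<bar>"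
        using t by (intro tendsto_intros TF FxT GxT) auto
      have "\<forall>\<^sub>F n in sequentially. \<forall>x\<in>UNIV. dist (G n x) (g x) < e / 8"
        using uniform_limitD[OF G, of "e / 8"] \<open>e > 0\<close> by simp
      then show "\<forall>\<^sub>F n in sequentially. \<bar>(T t (F n) x - F n x) / t - G n x\<bar> \<le> e / 2"
      proof eventually_elim
        case (elim n)
        show ?case
        proof (rule generator_rate[OF gen t(1)])
          fix s y assume s: "0 \<le> s" "s \<le> t"
          have "\<bar>T s (\<lambda>y. G n y - g y) y\<bar> \<le> e / 8"
            using elim s by (intro feller_contraction C_zero_diff GC g) (auto simp: dist_real_def less_imp_le)
          moreover have "T s (\<lambda>y. G n y - g y) y = T s (G n) y - T s g y"
            by (rule feller_diff[OF s(1) GC g])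
          moreover have "\<bar>T s g y - g y\<bar> \<le> e / 4"
            using d(2)[of s y] s t feller_0[OF g] \<open>e > 0\<close> by (cases "s = 0") auto
          moreover have "\<bar>G n y - g y\<bar> < e / 8" using elim by (simp add: dist_real_def)
          ultimately show "\<bar>T s (G n) y - G n y\<bar> \<le> e / 2" by linarith
        qed
      qed
    qed simp
    have "dist ((T t f x - f x) / t) (g x) < e" if "0 < t" "t < d" for t x
      using small[OF that, of x] \<open>e > 0\<close> unfolding dist_real_def by linarith
    then show "\<forall>\<^sub>F t in at_right 0. \<forall>x\<in>UNIV. dist ((T t f x - f x) / t) (g x) < e"
      unfolding eventually_at_right_field using d(1) by blast
  qed
  with f g show ?thesis by (simp add: generator_graph_def)
qed

end

subsection \<open>The Levy-type operator on Hoelder functions\<close>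

lemma inner_le_sum_components:
  "\<bar>u \<bullet> (y::real^'n::finite)\<bar> \<le> (\<Sum>j\<in>UNIV. \<bar>u $ j\<bar>) * norm y"
proof -
  have "\<bar>u \<bullet> y\<bar> \<le> norm u * norm y" by (rule Cauchy_Schwarz_ineq2)
  also have "\<dots> \<le> (\<Sum>j\<in>UNIV. \<bar>u $ j\<bar>) * norm y" by (intro mult_right_mono norm_le_l1_cart) auto
  finally show ?thesis .
qed

lemma inner_le_component_bound:
  assumes "\<And>j. \<bar>u $ j\<bar> \<le> M"
  shows "\<bar>u \<bullet> (y::real^'n::finite)\<bar> \<le> real CARD('n) * M * norm y"
proof -
  have "(\<Sum>j\<in>UNIV. \<bar>u $ j\<bar>) \<le> (\<Sum>j\<in>(UNIV::'n set). M)" by (intro sum_mono assms)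
  then have "(\<Sum>j\<in>UNIV. \<bar>u $ j\<bar>) * norm y \<le> real CARD('n) * M * norm y" by (intro mult_right_mono) auto
  with inner_le_sum_components[of u y] show ?thesis by linarith
qed

lemma C_one_mvt:
  assumes "C_one f"
  obtains \<theta> :: real where "0 < \<theta>" "\<theta> < 1" "f (x + y) - f x = grad f (x + \<theta> *\<^sub>R y) \<bullet> y"
proof -
  have "\<exists>\<theta>>0. \<theta> < 1 \<and> f (x + 1 *\<^sub>R y) - f (x + 0 *\<^sub>R y) = (1 - 0) * (grad f (x + \<theta> *\<^sub>R y) \<bullet> y)"
    by (rule MVT2) (auto intro: C_one_line_derivative[OF assms])
  then show ?thesis using that by auto
qed

lemma C_one_lipschitz:
  fixes f :: "real^'n::finite \<Rightarrow> real"
  assumes "C_one f" "\<And>j x. \<bar>partial_deriv j f x\<bar> \<le> M"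
  shows "\<bar>f (x + y) - f x\<bar> \<le> real CARD('n) * M * norm y"
proof -
  obtain \<theta> where \<theta>: "0 < \<theta>" "\<theta> < 1" "f (x + y) - f x = grad f (x + \<theta> *\<^sub>R y) \<bullet> y"
    by (rule C_one_mvt[OF assms(1), where x = x and y = y])
  show ?thesis unfolding \<theta>(3)
    by (rule inner_le_component_bound) (simp add: grad_def assms(2))
qed

lemma C_one_diff:
  assumes "C_one f" "C_one g"
  shows "C_one (\<lambda>x. f x - g x)"
    and "partial_deriv j (\<lambda>x. f x - g x) x = partial_deriv j f x - partial_deriv j g x"
    and "grad (\<lambda>x. f x - g x) x = grad f x - grad g x"
  using assms by (auto simp: C_one_def partial_deriv_diff grad_def vec_eq_iff intro!: continuous_intros)

lemma C_one_continuous: "C_one f \<Longrightarrow> continuous_on UNIV f"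
  by (meson C_one_has_derivative has_derivative_continuous continuous_at_imp_continuous_on)

text \<open>Both indicators contain the unit sphere, matching the region of the moment hypothesis
  and that of the large jump bound; the weight is 2 there, which is harmless for a majorant.\<close>

definition levy_weight :: "real \<Rightarrow> real^'n::finite \<Rightarrow> real" where
  "levy_weight a y = norm y powr a * indicator {y. 0 < norm y \<and> norm y \<le> 1} y + indicator {y. 1 \<le> norm y} y"

lemma levy_weight_small: "y \<noteq> 0 \<Longrightarrow> norm y < 1 \<Longrightarrow> levy_weight a y = norm y powr a"
  and levy_weight_large: "1 \<le> norm y \<Longrightarrow> 1 \<le> levy_weight a y"
  and levy_weight_nonneg: "0 \<le> levy_weight a y"
  by (auto simp: levy_weight_def)

lemma min_le_levy_weight:
  assumes "y \<noteq> 0" "a \<le> 2"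
  shows "min ((norm y)\<^sup>2) 1 \<le> levy_weight a y"
proof (cases "norm y < 1")
  case True
  then have "norm y powr 2 \<le> norm y powr a" using assms by (intro powr_mono') auto
  then show ?thesis using True assms by (simp add: levy_weight_small powr_numeral)
next
  case False
  then have "1 \<le> levy_weight a y" by (intro levy_weight_large) simp
  then show ?thesis by (rule order_trans[OF min.cobounded2])
qed

text \<open>Below \<open>r\<close>, the mean value theorem and the Hoelder bound give the power
  \<open>1 + \<kappa>\<close>, which leaves \<open>r powr \<delta>\<close> after the weight is split
  off. From \<open>r\<close> on, only the sup bounds \<eta> are used, and the weight is at least
  \<open>r\<^sup>2\<close>. Thus \<open>K\<close> needs only to stay bounded while \<eta> tends to
  0.\<close>

lemma levy_increment_bound:
  fixes w :: "real^'n::finite \<Rightarrow> real"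
  assumes w: "C_one w" and \<eta>: "\<And>x. \<bar>w x\<bar> \<le> \<eta>" "\<And>j x. \<bar>partial_deriv j w x\<bar> \<le> \<eta>"
    and hoelder: "\<And>j y. 0 < norm y \<Longrightarrow> norm y \<le> 1 \<Longrightarrow> \<bar>partial_deriv j w (x + y) - partial_deriv j w x\<bar> \<le> K * norm y powr \<kappa>"
    and \<kappa>: "0 \<le> \<kappa>" "a + \<delta> \<le> 1 + \<kappa>" and a: "a \<le> 2" and \<delta>: "0 < \<delta>"
    and K: "0 \<le> K" and r: "0 < r" "r \<le> 1" and y: "y \<noteq> 0"
  shows "\<bar>levy_increment w x y\<bar> \<le> (real CARD('n) * K * r powr \<delta> + (2 * real CARD('n) + 2) * \<eta> / r\<^sup>2) * levy_weight a y"
    (is "_ \<le> (?A + ?B) * _")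
proof -
  have "\<eta> \<ge> 0" using \<eta>(1)[of 0] by linarith
  have A: "0 \<le> ?A" and B: "0 \<le> ?B" using K \<open>\<eta> \<ge> 0\<close> by auto
  have r2: "r\<^sup>2 \<le> 1" "0 < r\<^sup>2" using r by (auto simp: power_le_one)
  obtain \<theta> where \<theta>: "0 < \<theta>" "\<theta> < 1" "w (x + y) - w x = grad w (x + \<theta> *\<^sub>R y) \<bullet> y"
    by (rule C_one_mvt[OF w, where x = x and y = y])
  have small: "levy_increment w x y = (grad w (x + \<theta> *\<^sub>R y) - grad w x) \<bullet> y" if "norm y < 1"
    using that y \<theta>(3) by (simp add: levy_increment_def inner_diff_left)
  consider "norm y < r" | "r \<le> norm y" "norm y < 1" | "1 \<le> norm y" by linarith
  then show ?thesis
  proof cases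
    case 1
    then have y1: "norm y < 1" using r by linarith
    have "\<bar>levy_increment w x y\<bar> \<le> real CARD('n) * (K * norm y powr \<kappa>) * norm y"
      unfolding small[OF y1]
    proof (rule inner_le_component_bound)
      fix j
      have ny: "norm (\<theta> *\<^sub>R y) \<le> norm y" using \<theta> by (simp add: mult_left_le_one_le)
      have "\<bar>partial_deriv j w (x + \<theta> *\<^sub>R y) - partial_deriv j w x\<bar> \<le> K * norm (\<theta> *\<^sub>R y) powr \<kappa>"
        using \<theta> y order_trans[OF ny less_imp_le[OF y1]] by (intro hoelder) auto
      also have "\<dots> \<le> K * norm y powr \<kappa>"
        using ny \<kappa> K by (intro mult_left_mono powr_mono2) auto
      finally show "\<bar>(grad w (x + \<theta> *\<^sub>R y) - grad w x) $ j\<bar> \<le> K * norm y powr \<kappa>"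
        by (simp add: grad_def)
    qed
    also have "\<dots> = real CARD('n) * K * norm y powr (1 + \<kappa>)"
      using y by (simp add: powr_add)
    also have "\<dots> \<le> real CARD('n) * K * (r powr \<delta> * norm y powr a)"
    proof (intro mult_left_mono)
      have "norm y powr (1 + \<kappa>) \<le> norm y powr (\<delta> + a)"
        using y1 \<kappa> by (intro powr_mono') auto
      also have "\<dots> = norm y powr \<delta> * norm y powr a" by (rule powr_add)
      also have "\<dots> \<le> r powr \<delta> * norm y powr a"
        using 1 \<delta> by (intro mult_right_mono powr_mono2) auto
      finally show "norm y powr (1 + \<kappa>) \<le> r powr \<delta> * norm y powr a" .
    qed (use K in auto)
    also have "\<dots> = ?A * levy_weight a y" using y y1 by (simp add: levy_weight_small)
    also have "\<dots> \<le> (?A + ?B) * levy_weight a y"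
      using B by (intro mult_right_mono levy_weight_nonneg) auto
    finally show ?thesis .
  next
    case 2
    have "\<bar>levy_increment w x y\<bar> \<le> real CARD('n) * (2 * \<eta>) * norm y"
      unfolding small[OF 2(2)]
    proof (rule inner_le_component_bound)
      show "\<bar>(grad w (x + \<theta> *\<^sub>R y) - grad w x) $ j\<bar> \<le> 2 * \<eta>" for j
        using \<eta>(2)[of j x] \<eta>(2)[of j "x + \<theta> *\<^sub>R y"] by (simp add: grad_def)
    qed
    also have "\<dots> \<le> real CARD('n) * (2 * \<eta>) * 1" using 2 \<open>\<eta> \<ge> 0\<close> by (intro mult_left_mono) auto
    also have "\<dots> \<le> (2 * real CARD('n) + 2) * \<eta>" using \<open>\<eta> \<ge> 0\<close> by (simp add: algebra_simps)
    also have "\<dots> = ?B * r\<^sup>2" using r2 by simp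
    also have "\<dots> \<le> ?B * levy_weight a y"
    proof (intro mult_left_mono B)
      have "r\<^sup>2 \<le> (norm y)\<^sup>2" using 2 r by (intro power_mono) auto
      also have "(norm y)\<^sup>2 = min ((norm y)\<^sup>2) 1" using 2 by (simp add: min_def power_le_one)
      also have "\<dots> \<le> levy_weight a y" by (rule min_le_levy_weight[OF y a])
      finally show "r\<^sup>2 \<le> levy_weight a y" .
    qed
    also have "\<dots> \<le> (?A + ?B) * levy_weight a y"
      using A by (intro mult_right_mono levy_weight_nonneg) auto
    finally show ?thesis .
  next
    case 3
    have "\<bar>levy_increment w x y\<bar> \<le> 2 * \<eta>"
      using 3 \<eta>(1)[of x] \<eta>(1)[of "x + y"] by (simp add: levy_increment_def)
    also have "\<dots> \<le> (2 * real CARD('n) + 2) * \<eta>" using \<open>\<eta> \<ge> 0\<close> by (simp add: algebra_simps)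
    also have "\<dots> = ?B * r\<^sup>2" using r2 by simp
    also have "\<dots> \<le> ?B * levy_weight a y"
      using r2 levy_weight_large[OF 3, of a] by (intro mult_left_mono B) linarith
    also have "\<dots> \<le> (?A + ?B) * levy_weight a y"
      using A by (intro mult_right_mono levy_weight_nonneg) auto
    finally show ?thesis .
  qed
qed

context levy_measure
begin

lemma
  fixes w :: "real^'n \<Rightarrow> real"
  assumes w: "C_one w" and \<eta>: "\<And>x. \<bar>w x\<bar> \<le> \<eta>" "\<And>j x. \<bar>partial_deriv j w x\<bar> \<le> \<eta>"
    and hoelder: "\<And>j y. 0 < norm y \<Longrightarrow> norm y \<le> 1 \<Longrightarrow> \<bar>partial_deriv j w (x + y) - partial_deriv j w x\<bar> \<le> K * norm y powr \<kappa>"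
    and \<kappa>: "0 \<le> \<kappa>" "a + \<delta> \<le> 1 + \<kappa>" and a: "a \<le> 2" and \<delta>: "0 < \<delta>"
    and K: "0 \<le> K" and r: "0 < r" "r \<le> 1"
    and weight: "integrable \<nu> (levy_weight a)" "integral\<^sup>L \<nu> (levy_weight a) \<le> N"
  shows levy_increment_integrable: "integrable \<nu> (levy_increment w x)"
    and levy_increment_integral_le: "\<bar>LINT y|\<nu>. levy_increment w x y\<bar> \<le>
      (real CARD('n) * K * r powr \<delta> + (2 * real CARD('n) + 2) * \<eta> / r\<^sup>2) * N"
proof -
  let ?C = "real CARD('n) * K * r powr \<delta> + (2 * real CARD('n) + 2) * \<eta> / r\<^sup>2"
  have "\<eta> \<ge> 0" using \<eta>(1)[of 0] by linarith
  then have C: "0 \<le> ?C" using K by auto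
  have bound: "\<bar>levy_increment w x y\<bar> \<le> ?C * levy_weight a y" if "y \<noteq> 0" for y
    by (rule levy_increment_bound[OF w \<eta> hoelder \<kappa> a \<delta> K r that])
  have [measurable]: "w \<in> borel_measurable borel"
    by (rule borel_measurable_continuous_onI[OF C_one_continuous[OF w]])
  show int: "integrable \<nu> (levy_increment w x)"
  proof (rule Bochner_Integration.integrable_bound)
    show "integrable \<nu> (\<lambda>y. ?C * levy_weight a y)" using weight by simp
    show "levy_increment w x \<in> borel_measurable \<nu>"
      unfolding levy_increment_def[abs_def] by measurable
    show "AE y in \<nu>. norm (levy_increment w x y) \<le> norm (?C * levy_weight a y)"
    proof (rule AE_I2)
      fix y assume "y \<in> space \<nu>"
      then have "\<bar>levy_increment w x y\<bar> \<le> ?C * levy_weight a y" by (intro bound) (simp add: space_eq)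
      then show "norm (levy_increment w x y) \<le> norm (?C * levy_weight a y)" by simp
    qed
  qed
  have "\<bar>LINT y|\<nu>. levy_increment w x y\<bar> \<le> (LINT y|\<nu>. \<bar>levy_increment w x y\<bar>)"
    by (rule integral_abs_bound)
  also have "\<dots> \<le> (LINT y|\<nu>. ?C * levy_weight a y)"
    by (rule Bochner_Integration.integral_mono) (use int weight bound in \<open>auto simp: space_eq\<close>)
  also have "\<dots> = ?C * integral\<^sup>L \<nu> (levy_weight a)" by simp
  also have "\<dots> \<le> ?C * N" by (rule mult_left_mono[OF weight(2) C])
  finally show "\<bar>LINT y|\<nu>. levy_increment w x y\<bar> \<le> ?C * N" .
qed

end

section \<open>Families of Levy measures with uniform bounds\<close>

definition levy_operator ::
  "(real^'n::finite \<Rightarrow> real^'n) \<Rightarrow> (real^'n \<Rightarrow> (real^'n) measure) \<Rightarrow> (real^'n \<Rightarrow> real) \<Rightarrow> real^'n \<Rightarrow> real" where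
  "levy_operator b \<nu> f x = b x \<bullet> grad f x + (LINT y|\<nu> x. levy_increment f x y)"

text \<open>Here \<open>a\<close> is the moment exponent, \<kappa> the Hoelder exponent of the
  gradients, and \<delta> the surplus of \<open>1 + \<kappa>\<close> over \<open>a\<close>, which
  has to be the same at all points. \<open>B\<close> and \<open>N\<close> carry the uniformity in
  \<open>x\<close>.\<close>

locale bounded_levy_family =
  fixes b :: "real^'n::finite \<Rightarrow> real^'n" and \<nu> :: "real^'n \<Rightarrow> (real^'n) measure"
    and a \<kappa> :: "real^'n \<Rightarrow> real" and B N \<delta> :: real
  assumes levy: "levy_measure (\<nu> x)"
    and b_le: "\<bar>b x $ j\<bar> \<le> B"
    and weight_integrable: "integrable (\<nu> x) (levy_weight (a x))"
    and weight_le: "integral\<^sup>L (\<nu> x) (levy_weight (a x)) \<le> N"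
    and a_le: "a x \<le> 2" and \<kappa>_nonneg: "0 \<le> \<kappa> x" and \<kappa>_ge: "a x + \<delta> \<le> 1 + \<kappa> x" and \<delta>_pos: "0 < \<delta>"
begin

lemma N_nonneg: "0 \<le> N"
  using Bochner_Integration.integral_nonneg[of "\<nu> 0" "levy_weight (a 0)"] levy_weight_nonneg weight_le[of 0]
  by (meson order_trans)

definition hoelder_grad :: "real \<Rightarrow> (real^'n \<Rightarrow> real) \<Rightarrow> bool" where
  "hoelder_grad K w \<longleftrightarrow> (\<forall>j x y. 0 < norm y \<longrightarrow> norm y \<le> 1 \<longrightarrow>
     \<bar>partial_deriv j w (x + y) - partial_deriv j w x\<bar> \<le> K * norm y powr \<kappa> x)"

lemma hoelder_grad_integrable:
  assumes "C_one w" "\<And>x. \<bar>w x\<bar> \<le> \<eta>" "\<And>j x. \<bar>partial_deriv j w x\<bar> \<le> \<eta>" "hoelder_grad K w" "0 \<le> K"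
  shows "integrable (\<nu> x) (levy_increment w x)"
proof -
  interpret levy_measure "\<nu> x" by (rule levy)
  show ?thesis
    by (rule levy_increment_integrable[where r = 1 and a = "a x" and \<kappa> = "\<kappa> x" and \<delta> = \<delta>])
      (use assms \<kappa>_nonneg \<kappa>_ge a_le \<delta>_pos weight_integrable weight_le in \<open>auto simp: hoelder_grad_def\<close>)
qed

lemma levy_operator_le:
  assumes w: "C_one w" "\<And>x. \<bar>w x\<bar> \<le> \<eta>" "\<And>j x. \<bar>partial_deriv j w x\<bar> \<le> \<eta>" "hoelder_grad K w" "0 \<le> K"
    and r: "0 < r" "r \<le> 1"
  shows "\<bar>levy_operator b \<nu> w x\<bar> \<le> (real CARD('n))\<^sup>2 * B * \<eta> +
    (real CARD('n) * K * r powr \<delta> + (2 * real CARD('n) + 2) * \<eta> / r\<^sup>2) * N"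
proof -
  interpret levy_measure "\<nu> x" by (rule levy)
  have "\<bar>LINT y|\<nu> x. levy_increment w x y\<bar> \<le>
      (real CARD('n) * K * r powr \<delta> + (2 * real CARD('n) + 2) * \<eta> / r\<^sup>2) * N"
    by (rule levy_increment_integral_le[where \<kappa> = "\<kappa> x" and a = "a x"])
      (use w r \<kappa>_nonneg \<kappa>_ge a_le \<delta>_pos weight_integrable weight_le in \<open>auto simp: hoelder_grad_def\<close>)
  moreover have "\<bar>b x \<bullet> grad w x\<bar> \<le> (real CARD('n))\<^sup>2 * B * \<eta>"
  proof -
    have "B \<ge> 0" using b_le[of 0 undefined] by linarith
    have le: "\<bar>b x \<bullet> grad w x\<bar> \<le> real CARD('n) * B * norm (grad w x)"
      by (rule inner_le_component_bound[OF b_le])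
    have "norm (grad w x) \<le> (\<Sum>j\<in>UNIV. \<bar>grad w x $ j\<bar>)" by (rule norm_le_l1_cart)
    also have "\<dots> \<le> (\<Sum>j\<in>(UNIV::'n set). \<eta>)" by (intro sum_mono) (simp add: grad_def w)
    finally have "real CARD('n) * B * norm (grad w x) \<le> real CARD('n) * B * (real CARD('n) * \<eta>)"
      using \<open>B \<ge> 0\<close> by (intro mult_left_mono) auto
    with le have "\<bar>b x \<bullet> grad w x\<bar> \<le> real CARD('n) * B * (real CARD('n) * \<eta>)" by linarith
    then show ?thesis by (simp only: power2_eq_square mult_ac)
  qed
  ultimately show ?thesis unfolding levy_operator_def by linarith
qed

text \<open>The difference of \<open>F n\<close> and \<open>f\<close> always has Hoelder constant
  \<open>2 * K\<close>, which does not become small. Hence \<open>r\<close> is chosen first, to make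
  the small jump term tiny, and only then the required \<open>C^1\<close> closeness \<eta>, which is
  divided by \<open>r\<^sup>2\<close> in the estimate.\<close>

theorem levy_operator_uniform_limit:
  assumes F: "\<And>n. C_one (F n)" "\<And>n. F n \<in> C_zero" "\<And>n j. partial_deriv j (F n) \<in> C_zero" "\<And>n. hoelder_grad K (F n)"
    and f: "C_one f" "f \<in> C_zero" "\<And>j. partial_deriv j f \<in> C_zero" "hoelder_grad K f"
    and K: "0 \<le> K"
    and lim: "uniform_limit UNIV F f sequentially"
    and lim_grad: "\<And>j. uniform_limit UNIV (\<lambda>n. partial_deriv j (F n)) (partial_deriv j f) sequentially"
  shows "uniform_limit UNIV (\<lambda>n. levy_operator b \<nu> (F n)) (levy_operator b \<nu> f) sequentially"
proof (rule uniform_limitI)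
  fix e :: real assume "e > 0"
  let ?d = "real CARD('n)"
  have bounded: "\<exists>\<eta>. (\<forall>x. \<bar>h x\<bar> \<le> \<eta>) \<and> (\<forall>j x. \<bar>partial_deriv j h x\<bar> \<le> \<eta>)"
    if h: "h \<in> C_zero" "\<And>j. partial_deriv j h \<in> C_zero" for h :: "real^'n \<Rightarrow> real"
  proof -
    obtain c0 where c0: "\<And>x. \<bar>h x\<bar> \<le> c0" using C_zero_bounded[OF h(1)] by blast
    have "\<forall>j. \<exists>c. \<forall>x. \<bar>partial_deriv j h x\<bar> \<le> c" using C_zero_bounded[OF h(2)] by metis
    then obtain c where c: "\<And>j x. \<bar>partial_deriv j h x\<bar> \<le> c j" by metis
    have "c j \<le> (\<Sum>j\<in>UNIV. \<bar>c j\<bar>)" for j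
      using member_le_sum[of j UNIV "\<lambda>j. \<bar>c j\<bar>"] by simp
    then have "\<bar>h x\<bar> \<le> \<bar>c0\<bar> + (\<Sum>j\<in>UNIV. \<bar>c j\<bar>)" "\<bar>partial_deriv j h x\<bar> \<le> \<bar>c0\<bar> + (\<Sum>j\<in>UNIV. \<bar>c j\<bar>)" for j x
      using c0[of x] c[of j x] sum_nonneg[of UNIV "\<lambda>j. \<bar>c j\<bar>"] by (smt (verit) abs_ge_zero)+
    then show ?thesis by blast
  qed
  have int: "integrable (\<nu> x) (levy_increment h x)"
    if h: "C_one h" "h \<in> C_zero" "\<And>j. partial_deriv j h \<in> C_zero" "hoelder_grad K h" for h x
    using bounded[OF h(2,3)] hoelder_grad_integrable[OF h(1) _ _ h(4) K] by blast
  have "((\<lambda>r. ?d * (2 * K) * r powr \<delta> * N) \<longlongrightarrow> ?d * (2 * K) * 0 * N) (at_right 0)"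
  proof (intro tendsto_intros)
    have "((\<lambda>r. r powr \<delta>) \<longlongrightarrow> 0 powr \<delta>) (at_right 0)"
      by (rule tendsto_powr') (auto simp: \<delta>_pos eventually_at_right_less intro: eventually_mono[OF eventually_at_right_less] less_imp_le)
    then show "((\<lambda>r. r powr \<delta>) \<longlongrightarrow> 0) (at_right 0)" by simp
  qed
  then have "\<forall>\<^sub>F r in at_right 0. ?d * (2 * K) * r powr \<delta> * N < e / 2"
    using \<open>e > 0\<close> by (intro order_tendstoD) auto
  then have "\<forall>\<^sub>F r in at_right 0. ?d * (2 * K) * r powr \<delta> * N < e / 2 \<and> 0 < r \<and> r < 1"
    by (intro eventually_conj eventually_at_right_less) (auto simp: eventually_at_right_field intro: exI[of _ 1])
  then obtain r where r: "?d * (2 * K) * r powr \<delta> * N < e / 2" "0 < r" "r < 1"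
    by (auto dest: eventually_happens)
  \<comment> \<open>All coefficients of \<eta> in \<open>levy_operator_le\<close>. The added 1 keeps
    \<open>C\<close> positive and makes \<open>(C - 1) * \<eta> < e / 2\<close> strict.\<close>
  define C where "C = ?d\<^sup>2 * B + (2 * ?d + 2) / r\<^sup>2 * N + 1"
  have "0 \<le> B" using b_le[of 0 undefined] by linarith
  then have "C > 0" unfolding C_def using N_nonneg r by (intro add_nonneg_pos add_nonneg_nonneg mult_nonneg_nonneg) auto
  define \<eta> where "\<eta> = e / (2 * C)"
  have "\<eta> > 0" using \<open>e > 0\<close> \<open>C > 0\<close> by (simp add: \<eta>_def)
  have ev: "\<forall>\<^sub>F n in sequentially. (\<forall>x\<in>UNIV. dist (F n x) (f x) < \<eta>) \<and>
      (\<forall>j. \<forall>x\<in>UNIV. dist (partial_deriv j (F n) x) (partial_deriv j f x) < \<eta>)"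
    by (intro eventually_conj eventually_all_finite uniform_limitD[OF lim \<open>\<eta> > 0\<close>] uniform_limitD[OF lim_grad \<open>\<eta> > 0\<close>])
  then show "\<forall>\<^sub>F n in sequentially. \<forall>x\<in>UNIV. dist (levy_operator b \<nu> (F n) x) (levy_operator b \<nu> f x) < e"
  proof eventually_elim
    case (elim n)
    define w where "w = (\<lambda>x. F n x - f x)"
    note diff = C_one_diff[OF F(1)[of n] f(1), folded w_def]
    have w: "\<bar>w x\<bar> \<le> \<eta>" "\<bar>partial_deriv j w x\<bar> \<le> \<eta>" for j x
      using elim unfolding diff(2) by (auto simp: w_def dist_real_def less_imp_le)
    have hw: "hoelder_grad (2 * K) w"
      unfolding hoelder_grad_def
    proof (intro allI impI)
      fix j x and y :: "real^'n" assume y: "0 < norm y" "norm y \<le> 1"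
      have "\<bar>partial_deriv j (F n) (x + y) - partial_deriv j (F n) x\<bar> \<le> K * norm y powr \<kappa> x"
        "\<bar>partial_deriv j f (x + y) - partial_deriv j f x\<bar> \<le> K * norm y powr \<kappa> x"
        using F(4)[of n] f(4) y by (auto simp: hoelder_grad_def)
      then show "\<bar>partial_deriv j w (x + y) - partial_deriv j w x\<bar> \<le> 2 * K * norm y powr \<kappa> x"
        unfolding diff(2) by linarith
    qed
    show ?case
    proof
      fix x
      have "levy_increment w x y = levy_increment (F n) x y - levy_increment f x y" for y
        by (simp add: levy_increment_def w_def diff(3)[unfolded w_def] inner_diff_left algebra_simps)
      then have "levy_operator b \<nu> w x = levy_operator b \<nu> (F n) x - levy_operator b \<nu> f x"
        using int[OF F(1)[of n] F(2)[of n] F(3)[where n = n] F(4)[of n], of x] int[OF f, of x]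
        by (simp add: levy_operator_def diff(3) inner_diff_right)
      moreover have "\<bar>levy_operator b \<nu> w x\<bar> \<le> ?d\<^sup>2 * B * \<eta> + (?d * (2 * K) * r powr \<delta> + (2 * ?d + 2) * \<eta> / r\<^sup>2) * N"
        using K r by (intro levy_operator_le diff w hw) auto
      moreover have "\<dots> = ?d * (2 * K) * r powr \<delta> * N + (C - 1) * \<eta>"
        by (simp add: C_def algebra_simps)
      moreover have "C * \<eta> = e / 2" using \<open>C > 0\<close> by (simp add: \<eta>_def)
      then have "(C - 1) * \<eta> < e / 2" using \<open>\<eta> > 0\<close> by (simp add: algebra_simps)
      ultimately show "dist (levy_operator b \<nu> (F n) x) (levy_operator b \<nu> f x) < e"
        using r(1) unfolding dist_real_def by linarith
    qed
  qed
qed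

end

subsection \<open>Smooth approximation preserving variable-order Hoelder bounds\<close>

lemma C_k_scaled: "C_k k f \<Longrightarrow> C_k k (\<lambda>x. f (c *\<^sub>R x))"
proof (induction k arbitrary: f)
  case 0
  then have "continuous_on UNIV f" by simp
  from continuous_on_compose2[OF this, of UNIV "\<lambda>x. c *\<^sub>R x"] show ?case
    by (simp add: continuous_intros)
next
  case (Suc k)
  have "continuous_on UNIV (\<lambda>x. f (c *\<^sub>R x))"
    using continuous_on_compose2[OF C_k_continuous[OF Suc.prems], of UNIV "\<lambda>x. c *\<^sub>R x"]
    by (simp add: continuous_intros)
  moreover have "C_k k (\<lambda>x. c * partial_deriv j f (c *\<^sub>R x))" for j
    using Suc by (intro C_k_mult C_k_const Suc.IH) simp
  ultimately show ?case using Suc.prems by (simp add: partial_deriv_scaled)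
qed

lemma C_c_infinity_cmult: "f \<in> C_c_infinity \<Longrightarrow> (\<lambda>x. c * f x) \<in> C_c_infinity"
  unfolding C_c_infinity_iff by (auto intro!: C_k_mult C_k_const simp del: C_k.simps)

lemma C_c_infinity_scaled:
  assumes "f \<in> C_c_infinity" "0 < c"
  shows "(\<lambda>x. f (c *\<^sub>R x)) \<in> C_c_infinity"
proof -
  obtain R where R: "\<And>x. R < norm x \<Longrightarrow> f x = 0" using assms(1) by (auto simp: C_c_infinity_iff)
  have "f (c *\<^sub>R x) = 0" if "R / c < norm x" for x
    using that assms(2) by (intro R) (simp add: divide_less_eq mult.commute)
  then show ?thesis using assms(1) C_k_scaled unfolding C_c_infinity_iff by blast
qed

lemma mollifier_exists:
  assumes "\<delta> > 0"
  obtains u :: "real^'n::finite \<Rightarrow> real"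
  where "u \<in> C_c_infinity" "\<And>z. 0 \<le> u z" "(LINT z|lborel. u z) = 1" "\<And>z. \<delta> < norm z \<Longrightarrow> u z = 0"
proof -
  obtain \<phi> :: "real^'n \<Rightarrow> real" where \<phi>: "\<phi> \<in> C_c_infinity" "\<And>x. 0 \<le> \<phi> x" "0 < \<phi> 0"
    "\<And>x. real CARD('n) < norm x \<Longrightarrow> \<phi> x = 0" using smooth_bump_exists[where 'n = 'n] by blast
  \<comment> \<open>The bump vanishes beyond radius \<open>CARD('n)\<close>; this scaling shrinks
    that radius to \<delta>.\<close>
  define c where "c = real CARD('n) / \<delta>"
  have "c > 0" using assms by (simp add: c_def)
  define \<psi> where "\<psi> x = \<phi> (c *\<^sub>R x)" for x
  have \<psi>: "\<psi> \<in> C_c_infinity" unfolding \<psi>_def by (rule C_c_infinity_scaled[OF \<phi>(1) \<open>c > 0\<close>])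
  have int: "integrable lborel \<psi>" by (rule C_c_infinity_integrable[OF \<psi>])
  have pos: "0 < (LINT z|lborel. \<psi> z)"
  proof -
    have "isCont \<psi> 0" using C_c_infinity_continuous[OF \<psi>] by (simp add: continuous_on_eq_continuous_at)
    then have "(\<psi> \<longlongrightarrow> \<psi> 0) (nhds 0)" by (simp only: isCont_def tendsto_at_iff_tendsto_nhds)
    then have "\<forall>\<^sub>F z in nhds 0. \<psi> 0 / 2 < \<psi> z"
      by (rule order_tendstoD(1)) (use \<phi>(3) in \<open>simp add: \<psi>_def\<close>)
    then obtain e where e: "e > 0" "\<And>z. dist z 0 < e \<Longrightarrow> \<psi> 0 / 2 < \<psi> z"
      unfolding eventually_nhds_metric by blast
    have fin: "emeasure lborel (ball (0::real^'n) e) < \<infinity>"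
      by (rule emeasure_lborel_ball_finite)
    have "0 < \<psi> 0 / 2 * measure lborel (ball (0::real^'n) e)"
      using content_ball_pos[OF e(1), of "0::real^'n"] \<phi>(3) by (simp add: \<psi>_def)
    also have "\<dots> = (LINT z|lborel. \<psi> 0 / 2 * indicator (ball (0::real^'n) e) z)" by simp
    also have "\<dots> \<le> (LINT z|lborel. \<psi> z)"
    proof (rule Bochner_Integration.integral_mono)
      show "integrable lborel (\<lambda>z::real^'n. \<psi> 0 / 2 * indicator (ball 0 e) z)"
        using fin by (intro integrable_mult_right integrable_real_indicator) auto
      show "\<psi> 0 / 2 * indicator (ball 0 e) z \<le> \<psi> z" for z
        using e(2)[of z] \<phi>(2) by (auto simp: indicator_def dist_commute less_imp_le \<psi>_def)
    qed (rule int)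
    finally show ?thesis .
  qed
  show ?thesis
  proof (rule that[of "\<lambda>z. 1 / (LINT z|lborel. \<psi> z) * \<psi> z"])
    show "(\<lambda>z. 1 / (LINT z|lborel. \<psi> z) * \<psi> z) \<in> C_c_infinity" by (rule C_c_infinity_cmult[OF \<psi>])
    show "0 \<le> 1 / (LINT z|lborel. \<psi> z) * \<psi> z" for z using pos \<phi>(2) by (simp add: \<psi>_def)
    show "(LINT z|lborel. 1 / (LINT z|lborel. \<psi> z) * \<psi> z) = 1" using pos by simp
    fix z :: "real^'n" assume "\<delta> < norm z"
    then have "real CARD('n) < norm (c *\<^sub>R z)" using assms by (simp add: c_def field_simps)
    then show "1 / (LINT z|lborel. \<psi> z) * \<psi> z = 0" by (simp add: \<psi>_def \<phi>(4))
  qed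
qed

text \<open>An average against a probability density on a small ball stays as close to
  \<open>m\<close> as the values themselves. The number \<open>m\<close> is free: it is
  \<open>h x\<close> for approximation and 0 for increments.\<close>

lemma convolution_near:
  assumes u: "integrable lborel u" "\<And>z. 0 \<le> u z" "(LINT z|lborel. u z) = 1" "\<And>z. \<delta> < norm z \<Longrightarrow> u z = 0"
    and h: "continuous_on UNIV h" "\<And>x. \<bar>h x\<bar> \<le> M"
    and near: "\<And>z. norm z \<le> \<delta> \<Longrightarrow> \<bar>h (x - z) - m\<bar> \<le> e"
  shows "\<bar>func_convolution u h x - m\<bar> \<le> e"
proof -
  have int: "integrable lborel (\<lambda>z. u z * h (x - z))"
    by (rule convolution_integrable[OF u(1) h])
  have "func_convolution u h x - m = (LINT z|lborel. u z * h (x - z)) - (LINT z|lborel. u z * m)"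
    using u(3) by (simp add: func_convolution_def)
  also have "\<dots> = (LINT z|lborel. u z * h (x - z) - u z * m)"
    using int u(1) by (intro Bochner_Integration.integral_diff[symmetric]) auto
  finally have "\<bar>func_convolution u h x - m\<bar> \<le> (LINT z|lborel. \<bar>u z * h (x - z) - u z * m\<bar>)"
    by (simp only: integral_abs_bound)
  also have "\<dots> \<le> (LINT z|lborel. u z * e)"
  proof (rule Bochner_Integration.integral_mono)
    show "\<bar>u z * h (x - z) - u z * m\<bar> \<le> u z * e" for z
    proof (cases "norm z \<le> \<delta>")
      case True
      have "\<bar>u z * h (x - z) - u z * m\<bar> = u z * \<bar>h (x - z) - m\<bar>"
        using u(2)[of z] by (simp add: abs_mult flip: right_diff_distrib)
      also have "\<dots> \<le> u z * e" by (intro mult_left_mono near True u(2))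
      finally show ?thesis .
    qed (use u(4) in auto)
  qed (use int u(1) in auto)
  also have "\<dots> = e" using u(3) by simp
  finally show ?thesis .
qed

text \<open>The convolved function varies along with the mollifier, since cutoff and smoothing take
  place at the same time. Uniform continuity of the limit handles both errors.\<close>

lemma convolution_uniform_limit:
  fixes h :: "real^'n::finite \<Rightarrow> real"
  assumes u: "\<And>n. integrable lborel (u n)" "\<And>n z. 0 \<le> u n z" "\<And>n. (LINT z|lborel. u n z) = 1"
      "\<And>n z. \<delta> n < norm z \<Longrightarrow> u n z = 0" and \<delta>: "\<delta> \<longlonglongrightarrow> 0"
    and H: "\<And>n. H n \<in> C_zero" and h: "h \<in> C_zero" and lim: "uniform_limit UNIV H h sequentially"
  shows "uniform_limit UNIV (\<lambda>n. func_convolution (u n) (H n)) h sequentially"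
proof (rule uniform_limitI)
  fix e :: real assume "e > 0"
  obtain d where d: "d > 0" "\<And>x y. dist y x < d \<Longrightarrow> dist (h y) (h x) < e / 4"
    using C_zero_uniformly_continuous[OF h] \<open>e > 0\<close>
    unfolding uniformly_continuous_on_def by (metis UNIV_I zero_less_divide_iff zero_less_numeral)
  have "\<forall>\<^sub>F n in sequentially. \<delta> n < d" using \<delta> d(1) by (rule order_tendstoD)
  moreover have "\<forall>\<^sub>F n in sequentially. \<forall>x\<in>UNIV. dist (H n x) (h x) < e / 4"
    using \<open>e > 0\<close> by (intro uniform_limitD[OF lim]) auto
  ultimately show "\<forall>\<^sub>F n in sequentially. \<forall>x\<in>UNIV. dist (func_convolution (u n) (H n) x) (h x) < e"
  proof eventually_elim
    case (elim n)
    show ?case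
    proof
      fix x
      obtain M where M: "\<And>x. \<bar>H n x\<bar> \<le> M" using C_zero_bounded[OF H] by metis
      have "\<bar>func_convolution (u n) (H n) x - h x\<bar> \<le> e / 2"
      proof (rule convolution_near[OF u(1-4)[of n] _ M])
        show "continuous_on UNIV (H n)" using H by (auto simp: C_zero_def)
        show "\<bar>H n (x - z) - h x\<bar> \<le> e / 2" if "norm z \<le> \<delta> n" for z
        proof -
          have "dist (x - z) x < d" using that elim by (simp add: dist_norm)
          then have "dist (h (x - z)) (h x) < e / 4" by (rule d(2))
          moreover have "dist (H n (x - z)) (h (x - z)) < e / 4" using elim by auto
          ultimately show ?thesis unfolding dist_real_def by linarith
        qed
      qed auto
      then show "dist (func_convolution (u n) (H n) x) (h x) < e"
        using \<open>e > 0\<close> unfolding dist_real_def by linarith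
    qed
  qed
qed

text \<open>The increment of a convolution is the convolution of the increment. The bound
  \<open>e\<close> is required at the shifted points \<open>x - z\<close> only, and this is where
  exponents at nearby points enter.\<close>

lemma convolution_increment:
  assumes u: "integrable lborel u" "\<And>z. 0 \<le> u z" "(LINT z|lborel. u z) = 1" "\<And>z. \<delta> < norm z \<Longrightarrow> u z = 0"
    and h: "continuous_on UNIV h" "\<And>x. \<bar>h x\<bar> \<le> M"
    and near: "\<And>z. norm z \<le> \<delta> \<Longrightarrow> \<bar>h (x - z + y) - h (x - z)\<bar> \<le> e"
  shows "\<bar>func_convolution u h (x + y) - func_convolution u h x\<bar> \<le> e"
proof -
  let ?H = "\<lambda>t. h (t + y) - h t"
  have "func_convolution u h (x + y) - func_convolution u h x = (LINT z|lborel. u z * h (x + y - z) - u z * h (x - z))"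
    unfolding func_convolution_def
    by (intro Bochner_Integration.integral_diff[symmetric] convolution_integrable[OF u(1) h])
  also have "\<dots> = func_convolution u ?H x - 0"
    by (simp add: func_convolution_def algebra_simps)
  finally have eq: "func_convolution u h (x + y) - func_convolution u h x = func_convolution u ?H x - 0" .
  show ?thesis unfolding eq
  proof (rule convolution_near[OF u])
    show "continuous_on UNIV ?H"
      by (intro continuous_intros continuous_on_compose2[OF h(1)]) auto
    show "\<bar>?H t\<bar> \<le> 2 * M" for t using h(2)[of t] h(2)[of "t + y"] by linarith
    show "\<bar>?H (x - z) - 0\<bar> \<le> e" if "norm z \<le> \<delta>" for z using near[OF that] by simp
  qed
qed

text \<open>Far out, \<open>h\<close> is small and the cutoff bounded. On a fixed ball the scaled
  argument tends to 0, where the cutoff has the value 1.\<close>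

lemma cutoff_uniform_limit:
  fixes h :: "real^'n::finite \<Rightarrow> real"
  assumes h: "h \<in> C_zero" and \<zeta>: "\<And>x. \<bar>\<zeta> x\<bar> \<le> M" "\<And>x. \<bar>\<zeta> x - 1\<bar> \<le> L * norm x" and c: "c \<longlonglongrightarrow> 0"
  shows "uniform_limit UNIV (\<lambda>n x. h x * \<zeta> (c n *\<^sub>R x)) h sequentially"
proof (rule uniform_limitI)
  fix e :: real assume "e > 0"
  have "M \<ge> 0" using \<zeta>(1)[of 0] by linarith
  obtain B where B: "B > 0" "\<And>x. \<bar>h x\<bar> \<le> B" using C_zero_bounded[OF h] by blast
  have "e / (M + 1) > 0" using \<open>e > 0\<close> \<open>M \<ge> 0\<close> by simp
  then obtain R where R: "\<And>x. R \<le> norm x \<Longrightarrow> \<bar>h x\<bar> < e / (M + 1)"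
    using C_zero_small_outside[OF h] by blast
  have "(\<lambda>n. B * (\<bar>L\<bar> * (\<bar>c n\<bar> * \<bar>R\<bar>))) \<longlonglongrightarrow> B * (\<bar>L\<bar> * (\<bar>0\<bar> * \<bar>R\<bar>))"
    by (intro tendsto_intros c)
  then have "\<forall>\<^sub>F n in sequentially. B * (\<bar>L\<bar> * (\<bar>c n\<bar> * \<bar>R\<bar>)) < e"
    using \<open>e > 0\<close> by (intro order_tendstoD) auto
  then show "\<forall>\<^sub>F n in sequentially. \<forall>x\<in>UNIV. dist (h x * \<zeta> (c n *\<^sub>R x)) (h x) < e"
  proof eventually_elim
    case (elim n)
    show ?case
    proof
      fix x
      have eq: "dist (h x * \<zeta> (c n *\<^sub>R x)) (h x) = \<bar>h x\<bar> * \<bar>\<zeta> (c n *\<^sub>R x) - 1\<bar>"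
        by (simp add: dist_real_def flip: abs_mult) (simp add: algebra_simps)
      show "dist (h x * \<zeta> (c n *\<^sub>R x)) (h x) < e"
      proof (cases "R \<le> norm x")
        case True
        have "\<bar>\<zeta> (c n *\<^sub>R x) - 1\<bar> \<le> M + 1" using \<zeta>(1)[of "c n *\<^sub>R x"] by linarith
        then have "\<bar>h x\<bar> * \<bar>\<zeta> (c n *\<^sub>R x) - 1\<bar> \<le> \<bar>h x\<bar> * (M + 1)" by (intro mult_left_mono) auto
        also have "\<dots> < e" using R[OF True] \<open>M \<ge> 0\<close> by (simp add: less_divide_eq)
        finally show ?thesis unfolding eq .
      next
        case False
        have "\<bar>\<zeta> (c n *\<^sub>R x) - 1\<bar> \<le> L * (\<bar>c n\<bar> * norm x)" using \<zeta>(2)[of "c n *\<^sub>R x"] by simp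
        also have "\<dots> \<le> \<bar>L\<bar> * (\<bar>c n\<bar> * \<bar>R\<bar>)" using False by (intro mult_mono) auto
        finally have "\<bar>h x\<bar> * \<bar>\<zeta> (c n *\<^sub>R x) - 1\<bar> \<le> B * (\<bar>L\<bar> * (\<bar>c n\<bar> * \<bar>R\<bar>))"
          using B by (intro mult_mono) auto
        with elim show ?thesis unfolding eq by linarith
      qed
    qed
  qed
qed

lemma C_zero_family_bounded:
  fixes H :: "'i::finite \<Rightarrow> real^'n::finite \<Rightarrow> real"
  assumes "\<And>i. H i \<in> C_zero"
  obtains M where "\<And>i x. \<bar>H i x\<bar> \<le> M"
proof -
  have "\<forall>i. \<exists>c. \<forall>x. \<bar>H i x\<bar> \<le> c" using C_zero_bounded[OF assms] by metis
  then obtain c where c: "\<And>i x. \<bar>H i x\<bar> \<le> c i" by metis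
  have "c i \<le> (\<Sum>i\<in>UNIV. \<bar>c i\<bar>)" for i
    using member_le_sum[of i UNIV "\<lambda>i. \<bar>c i\<bar>"] by simp
  then show ?thesis using c that by (meson order_trans)
qed

lemma abs_product_increment_le:
  fixes a a' b b' :: real
  assumes "\<bar>a' - a\<bar> \<le> da" "\<bar>b' - b\<bar> \<le> db" "\<bar>a\<bar> \<le> A" "\<bar>b'\<bar> \<le> B"
  shows "\<bar>a' * b' - a * b\<bar> \<le> da * B + A * db"
proof -
  have "a' * b' - a * b = (a' - a) * b' + a * (b' - b)" by (simp add: algebra_simps)
  also have "\<bar>\<dots>\<bar> \<le> \<bar>a' - a\<bar> * \<bar>b'\<bar> + \<bar>a\<bar> * \<bar>b' - b\<bar>"
    using abs_triangle_ineq[of "(a' - a) * b'" "a * (b' - b)"] by (simp add: abs_mult)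
  also have "\<dots> \<le> da * B + A * db"
    using assms by (intro add_mono mult_mono) auto
  finally show ?thesis .
qed

text \<open>A cutoff gives compact support, after which a convolution gives smoothness. The constant
  \<open>K'\<close> is independent of \<open>n\<close>, and the exponent \<kappa>' need only lie
  below \<kappa> on a ball around each point.\<close>

theorem smooth_approximation:
  fixes f :: "real^'n::finite \<Rightarrow> real" and \<kappa> \<kappa>' :: "real^'n \<Rightarrow> real"
  assumes f: "C_one f" "f \<in> C_zero" "\<And>j. partial_deriv j f \<in> C_zero"
    and \<kappa>: "\<And>x. 0 \<le> \<kappa> x" "\<And>x. \<kappa> x \<le> 1"
    and hoelder: "\<And>j x y. 0 < norm y \<Longrightarrow> norm y \<le> 1 \<Longrightarrow>
      \<bar>partial_deriv j f (x + y) - partial_deriv j f x\<bar> \<le> K * norm y powr \<kappa> x"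
    and \<kappa>': "\<delta>0 > 0" "\<And>x z. norm z \<le> \<delta>0 \<Longrightarrow> \<kappa>' x \<le> \<kappa> (x - z)"
    and K: "0 \<le> K"
  obtains g K' where "\<And>n::nat. g n \<in> C_c_infinity" "0 \<le> K'"
    "uniform_limit UNIV g f sequentially"
    "\<And>j. uniform_limit UNIV (\<lambda>n. partial_deriv j (g n)) (partial_deriv j f) sequentially"
    "\<And>n j x y. 0 < norm y \<Longrightarrow> norm y \<le> 1 \<Longrightarrow>
      \<bar>partial_deriv j (g n) (x + y) - partial_deriv j (g n) x\<bar> \<le> K' * norm y powr \<kappa>' x"
proof -
  let ?d = "real CARD('n)"
  obtain \<phi> :: "real^'n \<Rightarrow> real" where \<phi>: "\<phi> \<in> C_c_infinity" "\<And>x. 0 \<le> \<phi> x" "0 < \<phi> 0"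
    "\<And>x. ?d < norm x \<Longrightarrow> \<phi> x = 0" using smooth_bump_exists[where 'n = 'n] by blast
  define \<zeta> where "\<zeta> x = 1 / \<phi> 0 * \<phi> x" for x
  have \<zeta>: "\<zeta> \<in> C_c_infinity" unfolding \<zeta>_def by (rule C_c_infinity_cmult[OF \<phi>(1)])
  have \<zeta>0: "\<zeta> 0 = 1" using \<phi>(3) by (simp add: \<zeta>_def)
  obtain R where R: "\<And>x. R < norm x \<Longrightarrow> \<zeta> x = 0" using \<zeta> by (auto simp: C_c_infinity_iff)
  note d\<zeta> = C_c_infinity_partial_deriv[OF \<zeta>]
  note dd\<zeta> = C_c_infinity_partial_deriv[OF d\<zeta>(1)]
  obtain M1 where M1: "\<And>x. \<bar>f x\<bar> \<le> M1" using C_zero_bounded[OF f(2)] by blast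
  obtain M2 where M2: "\<And>j x. \<bar>partial_deriv j f x\<bar> \<le> M2" using C_zero_family_bounded[of "\<lambda>j. partial_deriv j f", OF f(3)] by blast
  obtain X0 where X0: "\<And>x. \<bar>\<zeta> x\<bar> \<le> X0" using C_zero_bounded[OF C_c_infinity_C_zero[OF \<zeta>]] by blast
  obtain X1 where X1: "\<And>j x. \<bar>partial_deriv j \<zeta> x\<bar> \<le> X1"
    using C_zero_family_bounded[of "\<lambda>j. partial_deriv j \<zeta>", OF C_c_infinity_C_zero[OF d\<zeta>(1)]] by blast
  \<comment> \<open>Pairs of coordinates serve as a single finite index type, so one bound covers
    all second derivatives.\<close>
  obtain X2 where X2: "\<And>j i x. \<bar>partial_deriv i (partial_deriv j \<zeta>) x\<bar> \<le> X2"
  proof -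
    obtain X2 where "\<And>p x. \<bar>partial_deriv (snd p) (partial_deriv (fst p) \<zeta>) x\<bar> \<le> X2"
      using C_zero_family_bounded[of "\<lambda>p. partial_deriv (snd p) (partial_deriv (fst p) \<zeta>)",
          OF C_c_infinity_C_zero[OF dd\<zeta>(1)]] by blast
    from this[of "(_, _)"] show ?thesis by (intro that) simp
  qed
  have nonneg: "0 \<le> M1" "0 \<le> M2" "0 \<le> X0" "0 \<le> X1" "0 \<le> X2"
    using M1[of 0] M2[of undefined 0] X0[of 0] X1[of undefined 0] X2[of undefined undefined 0] by linarith+
  define c where "c n = inverse (real (Suc n))" for n
  have c: "0 < c n" "c n \<le> 1" for n by (auto simp: c_def inverse_le_1_iff)
  have c0: "c \<longlonglongrightarrow> 0" unfolding c_def by (rule LIMSEQ_inverse_real_of_nat)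
  define F where "F n x = f x * \<zeta> (c n *\<^sub>R x)" for n x
  define DF where "DF n j x = partial_deriv j f x * \<zeta> (c n *\<^sub>R x) + f x * (c n * partial_deriv j \<zeta> (c n *\<^sub>R x))" for n j x
  have pd_f: "partial_differentiable j f" for j using f(1) by (auto simp: C_one_def)
  have F: "partial_differentiable j (F n)" "partial_deriv j (F n) = DF n j" for n j
    unfolding F_def[abs_def] DF_def[abs_def]
    using partial_deriv_mult[OF pd_f partial_deriv_scaled(1)[OF d\<zeta>(2)], of j "c n"]
    by (simp_all add: partial_deriv_scaled(2)[OF d\<zeta>(2)])
  have cont_scaled: "continuous_on UNIV (\<lambda>x. h (s *\<^sub>R x))" if "continuous_on UNIV h" for h :: "real^'n \<Rightarrow> real" and s
    using continuous_on_compose2[OF that, of UNIV "\<lambda>x. s *\<^sub>R x"] by (simp add: continuous_intros)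
  have F_cont: "continuous_on UNIV (F n)" for n
    unfolding F_def[abs_def]
    by (intro continuous_intros cont_scaled C_c_infinity_continuous[OF \<zeta>] C_one_continuous[OF f(1)])
  have DF_cont: "continuous_on UNIV (DF n j)" for n j
    unfolding DF_def[abs_def] using f(3)
    by (intro continuous_intros cont_scaled C_c_infinity_continuous[OF \<zeta>] C_c_infinity_continuous[OF d\<zeta>(1)] C_one_continuous[OF f(1)])
      (auto simp: C_zero_def)
  have F_supp: "F n x = 0" if "R / c n < norm x" for n x
    using that c(1)[of n] R[of "c n *\<^sub>R x"] by (simp add: F_def divide_less_eq mult.commute)
  have F_zero: "F n \<in> C_zero" for n by (rule C_zero_I[OF F_cont F_supp])
  have DF_zero: "DF n j \<in> C_zero" for n j
    using partial_deriv_zero_outside[of "R / c n" "F n", OF F_supp] by (intro C_zero_I[OF DF_cont]) (auto simp: F(2))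
  have \<zeta>_lip: "\<bar>\<zeta> (x + y) - \<zeta> x\<bar> \<le> ?d * X1 * norm y" for x y
    by (rule C_one_lipschitz[OF C_c_infinity_C_one[OF \<zeta>] X1])
  have d\<zeta>_lip: "\<bar>partial_deriv j \<zeta> (x + y) - partial_deriv j \<zeta> x\<bar> \<le> ?d * X2 * norm y" for x y j
    by (rule C_one_lipschitz[OF C_c_infinity_C_one[OF d\<zeta>(1)] X2])
  have f_lip: "\<bar>f (x + y) - f x\<bar> \<le> ?d * M2 * norm y" for x y
    by (rule C_one_lipschitz[OF f(1) M2])
  have \<zeta>_near: "\<bar>\<zeta> x - 1\<bar> \<le> ?d * X1 * norm x" for x
    using \<zeta>_lip[of 0 x] \<zeta>0 by simp
  have F_lim: "uniform_limit UNIV F f sequentially"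
    unfolding F_def[abs_def] by (rule cutoff_uniform_limit[OF f(2) X0 \<zeta>_near c0])
  have DF_lim: "uniform_limit UNIV (\<lambda>n. DF n j) (partial_deriv j f) sequentially" for j
  proof -
    have "uniform_limit UNIV (\<lambda>n x. f x * (c n * partial_deriv j \<zeta> (c n *\<^sub>R x))) (\<lambda>x. 0) sequentially"
    proof (rule uniform_limitI)
      fix e :: real assume "e > 0"
      have "(\<lambda>n. M1 * (c n * X1)) \<longlonglongrightarrow> M1 * (0 * X1)" by (intro tendsto_intros c0)
      then have "\<forall>\<^sub>F n in sequentially. M1 * (c n * X1) < e" using \<open>e > 0\<close> by (intro order_tendstoD) auto
      then show "\<forall>\<^sub>F n in sequentially. \<forall>x\<in>UNIV. dist (f x * (c n * partial_deriv j \<zeta> (c n *\<^sub>R x))) 0 < e"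
      proof eventually_elim
        case (elim n)
        have "\<bar>f x * (c n * partial_deriv j \<zeta> (c n *\<^sub>R x))\<bar> \<le> M1 * (c n * X1)" for x
          unfolding abs_mult using c[of n] M1[of x] X1[of j "c n *\<^sub>R x"] nonneg by (intro mult_mono) auto
        then show ?case using elim by (auto simp: dist_real_def intro: le_less_trans)
      qed
    qed
    from uniform_limit_add[OF cutoff_uniform_limit[OF f(3) X0 \<zeta>_near c0] this] show ?thesis
      by (simp add: DF_def[abs_def])
  qed
  \<comment> \<open>The product rule gives two products, and each contributes two terms through
    \<open>abs_product_increment_le\<close>. The factors \<open>c n\<close> are at most 1, so
    \<open>n\<close> disappears.\<close>
  define K' where "K' = K * X0 + M2 * (?d * X1) + (?d * M2 * X1 + M1 * (?d * X2))"
  have "0 \<le> K'" using nonneg K by (simp add: K'_def)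
  have DF_hoelder: "\<bar>DF n j (x + y) - DF n j x\<bar> \<le> K' * norm y powr \<kappa> x" if y: "0 < norm y" "norm y \<le> 1" for n j x y
  proof -
    let ?p = "norm y powr \<kappa> x"
    \<comment> \<open>Since \<kappa> is at most 1 and \<open>norm y \<le> 1\<close>, every Lipschitz
      bound is also a Hoelder bound of order \<open>\<kappa> x\<close>.\<close>
    have "norm y powr 1 \<le> ?p" using y \<kappa> by (intro powr_mono') auto
    then have le_p: "norm y \<le> ?p" using y by simp
    have lip: "s * norm y \<le> s * ?p" if "0 \<le> s" for s using le_p that by (intro mult_left_mono)
    have cy: "norm (c n *\<^sub>R y) \<le> norm y" using c[of n] by (simp add: mult_left_le_one_le)
    have \<zeta>1: "\<bar>\<zeta> (c n *\<^sub>R (x + y)) - \<zeta> (c n *\<^sub>R x)\<bar> \<le> ?d * X1 * ?p"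
    proof -
      have "\<bar>\<zeta> (c n *\<^sub>R x + c n *\<^sub>R y) - \<zeta> (c n *\<^sub>R x)\<bar> \<le> ?d * X1 * norm (c n *\<^sub>R y)" by (rule \<zeta>_lip)
      also have "\<dots> \<le> ?d * X1 * ?p" using nonneg by (intro mult_left_mono order_trans[OF cy le_p]) auto
      finally show ?thesis by (simp add: scaleR_add_right)
    qed
    have \<zeta>2: "\<bar>c n * partial_deriv j \<zeta> (c n *\<^sub>R (x + y)) - c n * partial_deriv j \<zeta> (c n *\<^sub>R x)\<bar> \<le> ?d * X2 * ?p"
    proof -
      have "\<bar>partial_deriv j \<zeta> (c n *\<^sub>R x + c n *\<^sub>R y) - partial_deriv j \<zeta> (c n *\<^sub>R x)\<bar> \<le> ?d * X2 * norm (c n *\<^sub>R y)" by (rule d\<zeta>_lip)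
      also have "\<dots> \<le> ?d * X2 * ?p" using nonneg by (intro mult_left_mono order_trans[OF cy le_p]) auto
      finally have "c n * \<bar>partial_deriv j \<zeta> (c n *\<^sub>R x + c n *\<^sub>R y) - partial_deriv j \<zeta> (c n *\<^sub>R x)\<bar> \<le> 1 * (?d * X2 * ?p)"
        using c[of n] by (intro mult_mono) auto
      then show ?thesis using c(1)[of n] by (simp add: scaleR_add_right abs_mult flip: right_diff_distrib)
    qed
    have c\<zeta>: "\<bar>c n * partial_deriv j \<zeta> z\<bar> \<le> X1" for z
      using mult_mono[OF c(2)[of n] X1[of j z]] c(1)[of n] nonneg by (simp add: abs_mult)
    have f1: "\<bar>f (x + y) - f x\<bar> \<le> ?d * M2 * ?p"
      using f_lip[of x y] lip[of "?d * M2"] nonneg by (smt (verit) mult_nonneg_nonneg of_nat_0_le_iff)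
    have A: "\<bar>partial_deriv j f (x + y) * \<zeta> (c n *\<^sub>R (x + y)) - partial_deriv j f x * \<zeta> (c n *\<^sub>R x)\<bar>
        \<le> (K * ?p) * X0 + M2 * (?d * X1 * ?p)"
      by (rule abs_product_increment_le[OF hoelder[OF y] \<zeta>1 M2 X0])
    have B: "\<bar>f (x + y) * (c n * partial_deriv j \<zeta> (c n *\<^sub>R (x + y))) - f x * (c n * partial_deriv j \<zeta> (c n *\<^sub>R x))\<bar>
        \<le> (?d * M2 * ?p) * X1 + M1 * (?d * X2 * ?p)"
      by (rule abs_product_increment_le[OF f1 \<zeta>2 M1 c\<zeta>])
    have "K' * ?p = ((K * ?p) * X0 + M2 * (?d * X1 * ?p)) + ((?d * M2 * ?p) * X1 + M1 * (?d * X2 * ?p))"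
      unfolding K'_def by (simp add: algebra_simps)
    then show ?thesis using A B unfolding DF_def by linarith
  qed
  \<comment> \<open>The radius must tend to 0 and must never exceed \<open>\<delta>0\<close>, within
    which the exponents are comparable.\<close>
  define \<delta> where "\<delta> n = min \<delta>0 (c n)" for n
  have "\<delta> n > 0" for n using \<kappa>'(1) c by (simp add: \<delta>_def)
  then have "\<forall>n. \<exists>u::real^'n \<Rightarrow> real. u \<in> C_c_infinity \<and> (\<forall>z. 0 \<le> u z) \<and> (LINT z|lborel. u z) = 1 \<and> (\<forall>z. \<delta> n < norm z \<longrightarrow> u z = 0)"
    using mollifier_exists by metis
  then obtain u :: "nat \<Rightarrow> real^'n \<Rightarrow> real" where u: "\<And>n. u n \<in> C_c_infinity" "\<And>n z. 0 \<le> u n z"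
    "\<And>n. (LINT z|lborel. u n z) = 1" "\<And>n z. \<delta> n < norm z \<Longrightarrow> u n z = 0" by metis
  have u_int: "integrable lborel (u n)" for n by (rule C_c_infinity_integrable[OF u(1)])
  have \<delta>0: "\<delta> \<longlonglongrightarrow> 0"
  proof (rule tendsto_sandwich[OF _ _ tendsto_const c0])
    show "\<forall>\<^sub>F n in sequentially. 0 \<le> \<delta> n" using \<open>\<And>n. \<delta> n > 0\<close> by (simp add: less_imp_le)
    show "\<forall>\<^sub>F n in sequentially. \<delta> n \<le> c n" by (simp add: \<delta>_def)
  qed
  define g where "g n = func_convolution (u n) (F n)" for n
  have pd_g: "partial_deriv j (g n) = func_convolution (u n) (DF n j)" for n j
  proof -
    obtain M where M: "\<And>x. \<bar>F n x\<bar> \<le> M" using C_zero_bounded[OF F_zero] by metis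
    obtain M' where M': "\<And>x. \<bar>DF n j x\<bar> \<le> M'" using C_zero_bounded[OF DF_zero] by metis
    show ?thesis
      using convolution_partial_deriv(2)[OF u_int F_cont M F(1), unfolded F(2), OF DF_cont M']
      by (simp add: g_def)
  qed
  show ?thesis
  proof (rule that[of g K'])
    show "g n \<in> C_c_infinity" for n
    proof -
      \<comment> \<open>Smoothness is read off with the derivatives on \<open>u n\<close>, whereas
        \<open>pd_g\<close> puts the derivative on \<open>F n\<close> to keep its Hoelder
        bound.\<close>
      have "g n = func_convolution (F n) (u n)"
        unfolding g_def using C_c_infinity_continuous[OF u(1)] F_cont
        by (intro convolution_commute borel_measurable_continuous_onI)
      then show ?thesis using C_c_infinity_convolution[OF F_cont F_supp u(1)] by simp
    qed
    show "uniform_limit UNIV g f sequentially"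
      unfolding g_def[abs_def] by (rule convolution_uniform_limit[OF u_int u(2-4) \<delta>0 F_zero f(2) F_lim])
    show "uniform_limit UNIV (\<lambda>n. partial_deriv j (g n)) (partial_deriv j f) sequentially" for j
      unfolding pd_g by (rule convolution_uniform_limit[OF u_int u(2-4) \<delta>0 DF_zero f(3) DF_lim])
    fix n j and x y :: "real^'n" assume y: "0 < norm y" "norm y \<le> 1"
    obtain M where M: "\<And>x. \<bar>DF n j x\<bar> \<le> M" using C_zero_bounded[OF DF_zero] by metis
    show "\<bar>partial_deriv j (g n) (x + y) - partial_deriv j (g n) x\<bar> \<le> K' * norm y powr \<kappa>' x"
      unfolding pd_g
    proof (rule convolution_increment[OF u_int u(2-4) DF_cont M])
      fix z :: "real^'n" assume "norm z \<le> \<delta> n"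
      then have "\<kappa>' x \<le> \<kappa> (x - z)" by (intro \<kappa>'(2)) (simp add: \<delta>_def)
      then have "norm y powr \<kappa> (x - z) \<le> norm y powr \<kappa>' x" using y by (intro powr_mono') auto
      then have "K' * norm y powr \<kappa> (x - z) \<le> K' * norm y powr \<kappa>' x" using \<open>0 \<le> K'\<close> by (rule mult_left_mono)
      with DF_hoelder[OF y] show "\<bar>DF n j (x - z + y) - DF n j (x - z)\<bar> \<le> K' * norm y powr \<kappa>' x"
        by (rule order_trans)
    qed
  qed (fact \<open>0 \<le> K'\<close>)
qed

subsection \<open>The domain of the generator\<close>

lemma C_zero_Holder_bound:
  assumes "h \<in> C_zero_Holder \<kappa>"
  obtains K where "0 \<le> K" "\<And>x y. 0 < norm y \<Longrightarrow> norm y \<le> 1 \<Longrightarrow> \<bar>h (x + y) - h x\<bar> \<le> K * norm y powr \<kappa> x"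
proof -
  let ?q = "\<lambda>x y. ereal (\<bar>h (x + y) - h x\<bar> / norm y powr \<kappa> x)"
  let ?S = "SUP x. SUP y\<in>{y. 0 < norm y \<and> norm y \<le> 1}. ?q x y"
  have "?S < \<infinity>" using assms by (simp add: C_zero_Holder_def)
  then obtain K :: nat where K: "?S < ereal (real K)" using less_PInf_Ex_of_nat by auto
  show ?thesis
  proof (rule that[of "real K"])
    fix x y :: "real^'a" assume y: "0 < norm y" "norm y \<le> 1"
    have "?q x y \<le> (SUP y\<in>{y. 0 < norm y \<and> norm y \<le> 1}. ?q x y)"
      using y by (intro SUP_upper) auto
    also have "\<dots> \<le> ?S" by (intro SUP_upper) auto
    finally have "?q x y < ereal (real K)" using K by (rule le_less_trans)
    then show "\<bar>h (x + y) - h x\<bar> \<le> real K * norm y powr \<kappa> x"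
      using y by (simp add: divide_less_eq)
  qed simp
qed

lemma C_zero_1_Holder_D:
  assumes "f \<in> C_zero_1_Holder \<kappa>"
  shows "C_one f" "f \<in> C_zero" "partial_deriv j f \<in> C_zero"
    and "\<exists>K\<ge>0. \<forall>j x y. 0 < norm y \<longrightarrow> norm y \<le> 1 \<longrightarrow>
      \<bar>partial_deriv j f (x + y) - partial_deriv j f x\<bar> \<le> K * norm y powr \<kappa> x"
proof -
  have f: "f \<in> C_zero_1" and h: "partial_deriv j f \<in> C_zero_Holder \<kappa>" for j
    using assms by (auto simp: C_zero_1_Holder_def)
  then show "C_one f" "f \<in> C_zero" "partial_deriv j f \<in> C_zero"
    by (auto simp: C_zero_1_def C_one_def C_zero_def)
  have "\<forall>j. \<exists>K. 0 \<le> K \<and> (\<forall>x y. 0 < norm y \<longrightarrow> norm y \<le> 1 \<longrightarrow>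
      \<bar>partial_deriv j f (x + y) - partial_deriv j f x\<bar> \<le> K * norm y powr \<kappa> x)"
    using C_zero_Holder_bound[OF h] by metis
  then obtain K where K: "\<And>j. 0 \<le> K j" "\<And>j x y. 0 < norm y \<Longrightarrow> norm y \<le> 1 \<Longrightarrow>
      \<bar>partial_deriv j f (x + y) - partial_deriv j f x\<bar> \<le> K j * norm y powr \<kappa> x" by metis
  have "K j \<le> (\<Sum>j\<in>UNIV. K j)" for j using K(1) by (intro member_le_sum) auto
  then have "K j * norm y powr \<kappa> x \<le> (\<Sum>j\<in>UNIV. K j) * norm y powr \<kappa> x" for j x and y :: "real^'a"
    by (intro mult_right_mono) auto
  then have "\<forall>j x y. 0 < norm y \<longrightarrow> norm y \<le> 1 \<longrightarrow>
      \<bar>partial_deriv j f (x + y) - partial_deriv j f x\<bar> \<le> (\<Sum>j\<in>UNIV. K j) * norm y powr \<kappa> x"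
    using K(2) by (meson order_trans)
  moreover have "0 \<le> (\<Sum>j\<in>UNIV. K j)" using K(1) by (intro sum_nonneg)
  ultimately show "\<exists>K\<ge>0. \<forall>j x y. 0 < norm y \<longrightarrow> norm y \<le> 1 \<longrightarrow>
      \<bar>partial_deriv j f (x + y) - partial_deriv j f x\<bar> \<le> K * norm y powr \<kappa> x" by blast
qed

lemma has_characteristics_D:
  assumes "has_characteristics q b (\<lambda>_. 0) \<nu>" "\<forall>x. q x 0 = 0"
  shows "levy_measure (\<nu> x)"
    and "q x \<xi> = - \<i> * of_real (b x \<bullet> \<xi>) + (LINT y|\<nu> x. levy_kernel y \<xi>)"
proof -
  show "levy_measure (\<nu> x)"
    using assms unfolding has_characteristics_def levy_triplet_def levy_measure_def by blast
  have "q x \<xi> = q x 0 - \<i> * of_real (b x \<bullet> \<xi>) + of_real (\<xi> \<bullet> (0 *v \<xi>)) / 2 + (LINT y|\<nu> x. levy_kernel y \<xi>)"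
    using assms(1) unfolding has_characteristics_def levy_kernel_def by blast
  then show "q x \<xi> = - \<i> * of_real (b x \<bullet> \<xi>) + (LINT y|\<nu> x. levy_kernel y \<xi>)"
    using assms(2) by simp
qed

text \<open>Passage from the extended nonnegative supremum of the hypothesis to Bochner integrals;
  finiteness of \<open>S\<close> is what makes \<open>enn2real\<close> monotone here.\<close>

lemma (in levy_measure) levy_weight_integral:
  assumes small: "(\<integral>\<^sup>+ y\<in>{y. 0 < norm y \<and> norm y \<le> 1}. ennreal (norm y powr a) \<partial>\<nu>) \<le> S" and S: "S < \<infinity>"
    and large: "integrable \<nu> (\<lambda>y. indicator {y. 1 \<le> norm y} y :: real)" "(LINT y|\<nu>. indicator {y. 1 \<le> norm y} y) \<le> J"
  shows "integrable \<nu> (levy_weight a)" "integral\<^sup>L \<nu> (levy_weight a) \<le> enn2real S + J"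
proof -
  let ?p = "\<lambda>y::real^'n. norm y powr a * indicator {y. 0 < norm y \<and> norm y \<le> 1} y"
  have nn: "(\<integral>\<^sup>+ y. ennreal (?p y) \<partial>\<nu>) = (\<integral>\<^sup>+ y\<in>{y. 0 < norm y \<and> norm y \<le> 1}. ennreal (norm y powr a) \<partial>\<nu>)"
    by (intro nn_integral_cong) (simp add: indicator_def)
  have meas: "?p \<in> borel_measurable \<nu>" by measurable
  have int: "integrable \<nu> ?p"
    using meas le_less_trans[OF small S] nn by (intro integrableI_bounded) (simp_all add: abs_mult)
  have "integral\<^sup>L \<nu> ?p = enn2real (\<integral>\<^sup>+ y. ennreal (?p y) \<partial>\<nu>)"
    using meas by (intro integral_eq_nn_integral) auto
  also have "\<dots> \<le> enn2real S" unfolding nn using small S by (intro enn2real_mono) auto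
  finally have le: "integral\<^sup>L \<nu> ?p \<le> enn2real S" .
  show "integrable \<nu> (levy_weight a)"
    unfolding levy_weight_def[abs_def] using int large(1) by (rule Bochner_Integration.integrable_add)
  have "integral\<^sup>L \<nu> (levy_weight a) = integral\<^sup>L \<nu> ?p + (LINT y|\<nu>. indicator {y. 1 \<le> norm y} y)"
    unfolding levy_weight_def[abs_def] using int large(1) by (rule Bochner_Integration.integral_add)
  then show "integral\<^sup>L \<nu> (levy_weight a) \<le> enn2real S + J" using le large(2) by linarith
qed

text \<open>The order of the bounds matters: large jumps are controlled by the symbol, with the
  moment hypothesis they give the full weight \<open>N\<close>, and only with \<open>N\<close> can
  the drift be separated from the jump part.\<close>

lemma bounded_levy_family_I:
  fixes q :: "real^'n::finite \<Rightarrow> real^'n \<Rightarrow> complex"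
  assumes char: "has_characteristics q b (\<lambda>_. 0) \<nu>" and q0: "\<forall>x. q x 0 = 0"
    and bdd: "bounded_coefficients q"
    and a: "\<And>x. a x \<le> 2" "\<And>x. 0 \<le> \<kappa> x" "\<And>x. a x + \<delta> \<le> 1 + \<kappa> x" "0 < \<delta>"
    and sup: "(SUP x. \<integral>\<^sup>+ y\<in>{y. 0 < norm y \<and> norm y \<le> 1}. ennreal (norm y powr a x) \<partial>\<nu> x) < \<infinity>"
  shows "\<exists>B N. bounded_levy_family b \<nu> a \<kappa> B N \<delta>"
proof -
  note levy = has_characteristics_D(1)[OF char q0]
  note q = has_characteristics_D(2)[OF char q0]
  obtain c where c: "\<And>x \<xi>. norm (q x \<xi>) \<le> c * (1 + (norm \<xi>)\<^sup>2)"
    using bdd by (auto simp: bounded_coefficients_def)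
  define S where "S = (SUP x. \<integral>\<^sup>+ y\<in>{y. 0 < norm y \<and> norm y \<le> 1}. ennreal (norm y powr a x) \<partial>\<nu> x)"
  \<comment> \<open>The Gaussian average of the growth bound on \<open>q\<close>, divided by the
    least value of the averaged kernel on large jumps.\<close>
  define J where "J = c * (LINT \<xi>|lborel. (1 + (norm (\<xi>::real^'n))\<^sup>2) * std_gauss \<xi>) / (1 - exp (- 1 / 2))"
  define N where "N = enn2real S + J"
  have small: "(\<integral>\<^sup>+ y\<in>{y. 0 < norm y \<and> norm y \<le> 1}. ennreal (norm y powr a x) \<partial>\<nu> x) \<le> S" for x
    unfolding S_def by (rule SUP_upper) simp
  have pos: "0 < 1 - exp (- 1 / 2 :: real)" by simp
  have large: "integrable (\<nu> x) (\<lambda>y. indicator {y. 1 \<le> norm y} y :: real)"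
    "(LINT y|\<nu> x. indicator {y. 1 \<le> norm y} y) \<le> J" for x
    using levy_measure.large_jumps_bound[OF levy q c, of x] pos
    by (simp_all only: J_def pos_le_divide_eq)
  have weight: "integrable (\<nu> x) (levy_weight (a x))" "integral\<^sup>L (\<nu> x) (levy_weight (a x)) \<le> N" for x
    unfolding N_def using levy_measure.levy_weight_integral[OF levy small _ large] sup
    by (simp_all add: S_def)
  have "\<bar>b x $ j\<bar> \<le> 2 * c + 4 * N" for x j
  proof -
    have "(LINT y|\<nu> x. min ((norm y)\<^sup>2) 1) \<le> integral\<^sup>L (\<nu> x) (levy_weight (a x))"
      using a(1) weight(1) by (intro levy_measure.integral_min_le[OF levy] min_le_levy_weight) auto
    then show ?thesis
      using weight(2)[of x] levy_measure.drift_bound[OF levy q c, of x j] by linarith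
  qed
  then have "bounded_levy_family b \<nu> a \<kappa> (2 * c + 4 * N) N \<delta>"
    using levy weight a by (simp add: bounded_levy_family_def)
  then show ?thesis by blast
qed

theorem corollary5p3:
  fixes M :: "'w measure"
    and P :: "real^'n::finite \<Rightarrow> 'w measure"
    and X :: "real \<Rightarrow> 'w \<Rightarrow> real^'n"
    and q :: "real^'n \<Rightarrow> real^'n \<Rightarrow> complex"
    and b :: "real^'n \<Rightarrow> real^'n"
    and \<nu> :: "real^'n \<Rightarrow> (real^'n) measure"
    and \<epsilon> :: real
    and \<alpha> :: "real^'n \<Rightarrow> real"
  assumes "rich_levy_type_process M P X"
    and "has_symbol P X q"
    and "has_characteristics q b (\<lambda>_. 0) \<nu>"
    and "\<forall>x. q x 0 = 0"
    and "bounded_coefficients q"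
    and "\<epsilon> > 0"
    and "\<forall>x. \<epsilon> < \<alpha> x \<and> \<alpha> x \<le> 2"
    and "uniformly_continuous_on UNIV \<alpha>"
    and "sector_condition q \<or> (\<forall>x. \<alpha> x - \<epsilon> \<ge> BG_index_infinity q x)"
    and "(SUP x. \<integral>\<^sup>+ y\<in>{y. 0 < norm y \<and> norm y \<le> 1}.
                   ennreal (norm y powr (\<alpha> x - \<epsilon>)) \<partial>\<nu> x) < \<infinity>"
  shows "C_zero_1_Holder (\<lambda>x. max (\<alpha> x - 1) 0)
           \<subseteq> generator_domain (transition_semigroup P X) \<and>
         (\<forall>x. \<forall>f\<in>C_zero_1_Holder (\<lambda>x. max (\<alpha> x - 1) 0).
           integrable (\<nu> x) (\<lambda>y. f (x + y) - f x - (grad f x \<bullet> y) * indicator {0<..<1} (norm y)) \<and>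
           generator (transition_semigroup P X) f x =
             b x \<bullet> grad f x +
             (LINT y|\<nu> x. f (x + y) - f x - (grad f x \<bullet> y) * indicator {0<..<1} (norm y)))"
proof -
  let ?T = "transition_semigroup P X"
  interpret rich_levy_type_process M P X by fact
  define \<kappa> where "\<kappa> x = max (\<alpha> x - 1) 0" for x
  \<comment> \<open>The moment exponent is \<open>\<alpha> x - \<epsilon>\<close>, so lowering the
    Hoelder exponent by \<open>\<epsilon> / 2\<close> still leaves a surplus of
    \<open>\<epsilon> / 2\<close>. Truncation at 0 does no harm: it only enlarges the exponent, and
    it happens where \<open>\<alpha> x - \<epsilon> / 2\<close> is below 1.\<close>
  define \<kappa>' where "\<kappa>' x = max (\<alpha> x - 1 - \<epsilon> / 2) 0" for x
  have "\<exists>B N. bounded_levy_family b \<nu> (\<lambda>x. \<alpha> x - \<epsilon>) \<kappa>' B N (\<epsilon> / 2)"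
  proof (rule bounded_levy_family_I[OF assms(3,4,5)])
    fix x
    have "\<alpha> x \<le> 2" using assms(7) by simp
    then show "\<alpha> x - \<epsilon> \<le> 2" using assms(6) by linarith
    show "0 \<le> \<kappa>' x" by (simp add: \<kappa>'_def)
    show "\<alpha> x - \<epsilon> + \<epsilon> / 2 \<le> 1 + \<kappa>' x" by (simp add: \<kappa>'_def max_def field_simps)
  qed (use assms in auto)
  then obtain B N where "bounded_levy_family b \<nu> (\<lambda>x. \<alpha> x - \<epsilon>) \<kappa>' B N (\<epsilon> / 2)" by blast
  then interpret L: bounded_levy_family b \<nu> "\<lambda>x. \<alpha> x - \<epsilon>" \<kappa>' B N "\<epsilon> / 2" .
  \<comment> \<open>Richness supplies some image \<open>h\<close> of the test function; the symbol
    then identifies it.\<close>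
  have test: "generator_graph ?T g (levy_operator b \<nu> g)" if g: "g \<in> C_c_infinity" for g
  proof -
    obtain h where h: "generator_graph ?T g h" using subsetD[OF rich g] unfolding generator_domain_def by blast
    have "complex_of_real (h x) = of_real (levy_operator b \<nu> g x)" for x
    proof -
      have "complex_of_real (h x) = - (LINT \<xi>|lborel. exp (\<i> * of_real (x \<bullet> \<xi>)) * q x \<xi> * fourier g \<xi>)"
        using assms(2) g unfolding has_symbol_def generator_eqI[OF h, symmetric] by blast
      also have "\<dots> = of_real (levy_operator b \<nu> g x)"
        unfolding levy_operator_def
        by (rule levy_measure.symbol_to_levy_form[OF has_characteristics_D(1)[OF assms(3,4)] g
              has_characteristics_D(2)[OF assms(3,4)]])
      finally show ?thesis .
    qed
    then have "h = levy_operator b \<nu> g" by (intro ext) (simp only: of_real_eq_iff)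
    with h show ?thesis by simp
  qed
  have main: "generator_graph ?T f (levy_operator b \<nu> f) \<and> (\<forall>x. integrable (\<nu> x) (levy_increment f x))"
    if f: "f \<in> C_zero_1_Holder \<kappa>" for f
  proof -
    note fD = C_zero_1_Holder_D[OF f]
    obtain K where K: "0 \<le> K" "\<And>j x y. 0 < norm y \<Longrightarrow> norm y \<le> 1 \<Longrightarrow>
      \<bar>partial_deriv j f (x + y) - partial_deriv j f x\<bar> \<le> K * norm y powr \<kappa> x" using fD(4) by blast
    obtain d where d: "d > 0" "\<And>x x'. dist x' x < d \<Longrightarrow> dist (\<alpha> x') (\<alpha> x) < \<epsilon> / 2"
      using assms(6,8) unfolding uniformly_continuous_on_def by (metis UNIV_I half_gt_zero)
    \<comment> \<open>The mollification scale is \<open>d / 2\<close>, which turns the non-strict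
      bound on \<open>norm z\<close> into the strict one needed for uniform continuity.\<close>
    have \<kappa>_shift: "\<kappa>' x \<le> \<kappa> (x - z)" if "norm z \<le> d / 2" for x z
    proof -
      have "dist (x - z) x < d" using that d(1) by (simp add: dist_norm)
      then have "dist (\<alpha> (x - z)) (\<alpha> x) < \<epsilon> / 2" by (rule d(2))
      then show ?thesis unfolding \<kappa>_def \<kappa>'_def dist_real_def by linarith
    qed
    have \<kappa>: "0 \<le> \<kappa> x" "\<kappa> x \<le> 1" for x using assms(7) by (auto simp: \<kappa>_def)
    have "d / 2 > 0" using d by simp
    obtain g K' where g: "\<And>n::nat. g n \<in> C_c_infinity" "0 \<le> K'"
      "uniform_limit UNIV g f sequentially"
      "\<And>j. uniform_limit UNIV (\<lambda>n. partial_deriv j (g n)) (partial_deriv j f) sequentially"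
      "\<And>n j x y. 0 < norm y \<Longrightarrow> norm y \<le> 1 \<Longrightarrow>
        \<bar>partial_deriv j (g n) (x + y) - partial_deriv j (g n) x\<bar> \<le> K' * norm y powr \<kappa>' x"
      using smooth_approximation[OF fD(1,2,3) \<kappa> K(2) \<open>d / 2 > 0\<close> \<kappa>_shift K(1)] by blast
    \<comment> \<open>The limit theorem asks for one constant and one exponent common to
      \<open>f\<close> and all \<open>g n\<close>. The function \<open>f\<close> meets the lower
      exponent \<kappa>' as well, because jumps of size at most 1 are compared.\<close>
    define K'' where "K'' = max K K'"
    have "0 \<le> K''" using K by (simp add: K''_def)
    have hf: "L.hoelder_grad K'' f"
      unfolding L.hoelder_grad_def
    proof (intro allI impI)
      fix j x and y :: "real^'n" assume y: "0 < norm y" "norm y \<le> 1"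
      have "\<kappa>' x \<le> \<kappa> x" using \<kappa>_shift[of 0 x] d by simp
      then have "norm y powr \<kappa> x \<le> norm y powr \<kappa>' x" using y by (intro powr_mono') auto
      then have "K * norm y powr \<kappa> x \<le> K'' * norm y powr \<kappa>' x"
        using K by (intro mult_mono) (auto simp: K''_def)
      with K(2)[OF y, of j x] show "\<bar>partial_deriv j f (x + y) - partial_deriv j f x\<bar> \<le> K'' * norm y powr \<kappa>' x"
        by linarith
    qed
    have hg: "L.hoelder_grad K'' (g n)" for n
      unfolding L.hoelder_grad_def
    proof (intro allI impI)
      fix j x and y :: "real^'n" assume y: "0 < norm y" "norm y \<le> 1"
      have "K' * norm y powr \<kappa>' x \<le> K'' * norm y powr \<kappa>' x"
        by (intro mult_right_mono) (auto simp: K''_def)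
      with g(5)[OF y, of j n x] show "\<bar>partial_deriv j (g n) (x + y) - partial_deriv j (g n) x\<bar> \<le> K'' * norm y powr \<kappa>' x"
        by linarith
    qed
    have "uniform_limit UNIV (\<lambda>n. levy_operator b \<nu> (g n)) (levy_operator b \<nu> f) sequentially"
      by (rule L.levy_operator_uniform_limit[OF C_c_infinity_C_one[OF g(1)] C_c_infinity_C_zero[OF g(1)]
            C_c_infinity_C_zero[OF C_c_infinity_partial_deriv(1)[OF g(1)]] hg fD(1,2,3) hf \<open>0 \<le> K''\<close> g(3,4)])
    then have "generator_graph ?T f (levy_operator b \<nu> f)"
      by (rule generator_closed[OF feller test[OF g(1)] fD(2) g(3)])
    \<comment> \<open>Integrability is recorded separately: \<open>LINT\<close> would be 0 by
      default on a non-integrable function, so the formula alone would not guarantee a meaningful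
      integral.\<close>
    moreover have "integrable (\<nu> x) (levy_increment f x)" for x
    proof -
      obtain c1 where c1: "\<And>x. \<bar>f x\<bar> \<le> c1" using C_zero_bounded[OF fD(2)] by blast
      obtain c2 where c2: "\<And>j x. \<bar>partial_deriv j f x\<bar> \<le> c2"
        using C_zero_family_bounded[of "\<lambda>j. partial_deriv j f", OF fD(3)] by blast
      have "\<bar>f x\<bar> \<le> max c1 c2" "\<bar>partial_deriv j f x\<bar> \<le> max c1 c2" for j x
        using c1[of x] c2[of j x] by auto
      then show ?thesis by (rule L.hoelder_grad_integrable[OF fD(1) _ _ hf \<open>0 \<le> K''\<close>])
    qed
    ultimately show ?thesis by blast
  qed
  have \<kappa>_eq: "(\<lambda>x. max (\<alpha> x - 1) 0) = \<kappa>" by (simp add: \<kappa>_def fun_eq_iff)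
  show ?thesis
    unfolding \<kappa>_eq levy_increment_def[symmetric]
  proof (intro conjI subsetI allI ballI)
    fix f assume "f \<in> C_zero_1_Holder \<kappa>"
    then show "f \<in> generator_domain ?T" using main by (auto simp: generator_domain_def)
  next
    fix x f assume f: "f \<in> C_zero_1_Holder \<kappa>"
    show "integrable (\<nu> x) (levy_increment f x)" using main[OF f] by blast
    show "generator ?T f x = b x \<bullet> grad f x + integral\<^sup>L (\<nu> x) (levy_increment f x)"
      using generator_eqI[of ?T f "levy_operator b \<nu> f"] main[OF f] by (simp add: levy_operator_def)
  qed
qed

end
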